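(* Let $\Omega\subset\mathbb{C}$ be a bounded connected open set and $\varphi:\mathbb{D}\to\Omega$ an analytic covering map. Let $\alpha\in\partial\mathbb{D}$ be such that the radial limit $p=\lim_{r\to1^-}\varphi(r\alpha)$ exists (so $p\in\partial\Omega$). (1) If $p$ is not isolated in $\partial\Omega$, then for every sufficiently small simple closed curve $S$ in $\mathbb{C}$ containing $p$ in its interior (bounded complementary domain), there is a component $\widehat S$ of $\varphi^{-1}(S)$ whose closure in $\overline{\mathbb{D}}$ is an arc separating $\alpha$ from $0$ in $\overline{\mathbb{D}}$. (2) If $p$ is isolated in $\partial\Omega$, then for every sufficiently small simple closed curve $S\subset\Omega$ containing $p$ in its interior, there is a component $\widehat S$ of $\varphi^{-1}(S)$ whose closure is a simple closed curve meeting $\partial\mathbb{D}$ exactly in $\{\alpha\}$. Moreover, in both cases the diameter of $\widehat S$ can be made arbitrarily small by choosing $S$ sufficiently small.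
   Context: $\mathbb{D}$ is the open unit disk in $\mathbb{C}$. *)

theory Defs
  imports "HOL-Analysis.Analysis"
begin

end

theory Submission
  imports Defs "HOL-Complex_Analysis.Complex_Analysis" "HOL-Real_Asymp.Real_Asymp"
begin

text \<open>
  Let \<^emph>\<open>S\<close> be the curve. The preimage of \<^emph>\<open>S\<close> separates 0 from the end of the radius, hence so does
  one of its components \<^emph>\<open>C\<close>, which is the image of an injective lift of an open arc of \<^emph>\<open>S\<close> or of the
  universal cover of \<^emph>\<open>S\<close>. A lemma of Koebe shows that connected sets near the circle on which the
  covering map is close to a constant are small; this gives the diameter estimate and, when \<^emph>\<open>S\<close>
  leaves the domain, convergence of both ends of \<^emph>\<open>C\<close>.

  If the two ends of \<^emph>\<open>C\<close> coincided, then by Lindelof's theorem the image of the region enclosed by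
  \<^emph>\<open>C\<close> would have its boundary in \<^emph>\<open>S\<close>, so it would contain the whole inside of \<^emph>\<open>S\<close> and in particular
  the boundary point \<^emph>\<open>p\<close>. If an end were \<^emph>\<open>\<alpha>\<close>, then by Lindelof's theorem its limit value on \<^emph>\<open>S\<close>
  would be the radial limit \<^emph>\<open>p\<close>.

  If \<^emph>\<open>S\<close> lies in the domain, \<^emph>\<open>C\<close> is invariant under a fixed point free deck transformation, which in
  a half plane coordinate is \<^emph>\<open>y \<mapsto> a y + i b\<close>. For \<^emph>\<open>a \<noteq> 1\<close> its ends are the two fixed points, neither
  of which is \<^emph>\<open>\<alpha>\<close>: otherwise the invariance would make the radial limit \<^emph>\<open>p\<close> a value of the covering
  map. For \<^emph>\<open>a = 1\<close> both ends agree, and the covering map factors through an exponential, the quotient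
  extending over the puncture; so \<^emph>\<open>p\<close> is isolated. Conversely, if \<^emph>\<open>p\<close> is isolated, lifting the
  exponential map onto a punctured disc around \<^emph>\<open>p\<close> shows that both ends are \<^emph>\<open>\<alpha>\<close>.
\<close>

section \<open>Planar topology\<close>

lemma paths_cross_box_complex:
  fixes f g :: "real \<Rightarrow> complex"
  assumes "path f" "path g" "path_image f \<subseteq> cbox a b" "path_image g \<subseteq> cbox a b"
    and "Re (pathstart f) = Re a" "Re (pathfinish f) = Re b"
    and "Im (pathstart g) = Im a" "Im (pathfinish g) = Im b"
  shows "path_image f \<inter> path_image g \<noteq> {}"
proof -
  define v :: "complex \<Rightarrow> real^2" where "v z = (\<chi> i. if i = 1 then Re z else Im z)" for z
  have v_nth [simp]: "v z $ 1 = Re z" "v z $ 2 = Im z" for z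
    by (simp_all add: v_def)
  have v_inject: "v z = v w \<Longrightarrow> z = w" for z w
    by (metis complex_eqI v_nth)
  have cont_v: "continuous_on S v" for S
  proof -
    have "continuous_on S (\<lambda>z. if i = 1 then Re z else Im z)" for i :: 2
      by (cases "i = 1") (auto intro!: continuous_intros)
    then show ?thesis unfolding v_def by (rule continuous_on_vec_lambda)
  qed
  have v_cbox: "v z \<in> cbox (v a) (v b)" if "z \<in> cbox a b" for z
    using that by (auto simp: mem_box_cart forall_2 in_cbox_complex_iff)
  obtain z where "z \<in> path_image (v \<circ> f)" "z \<in> path_image (v \<circ> g)"
  proof (rule fashoda[of "v \<circ> f" "v \<circ> g" "v a" "v b"])
    show "path (v \<circ> f)" "path (v \<circ> g)"
      using assms cont_v by (auto intro: path_continuous_image)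
    show "path_image (v \<circ> f) \<subseteq> cbox (v a) (v b)" "path_image (v \<circ> g) \<subseteq> cbox (v a) (v b)"
      using assms v_cbox by (auto simp: path_image_compose)
  qed (use assms in \<open>auto simp: pathstart_compose pathfinish_compose\<close>)
  then show ?thesis
    using v_inject by (auto simp: path_image_compose)
qed

text \<open>Clamping both paths to the box does not create new intersections.\<close>

lemma paths_cross_strips:
  fixes vert horiz :: "real \<Rightarrow> complex"
  assumes vert: "path vert" "\<And>z. z \<in> path_image vert \<Longrightarrow> u < Re z \<and> Re z < v"
    "Im (pathstart vert) \<le> c" "d \<le> Im (pathfinish vert)"
    and horiz: "path horiz" "\<And>z. z \<in> path_image horiz \<Longrightarrow> c < Im z \<and> Im z < d"
    "Re (pathstart horiz) \<le> u" "v \<le> Re (pathfinish horiz)"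
  shows "path_image vert \<inter> path_image horiz \<noteq> {}"
proof -
  define \<kappa> where "\<kappa> z = Complex (max u (min v (Re z))) (max c (min d (Im z)))" for z
  have Re_Im_clamp [simp]: "Re (\<kappa> z) = max u (min v (Re z))" "Im (\<kappa> z) = max c (min d (Im z))" for z
    by (simp_all add: \<kappa>_def)
  have cont_clamp: "continuous_on S \<kappa>" for S
    unfolding \<kappa>_def by (simp add: Complex_eq) (intro continuous_intros)
  have uv: "u < v" using vert(2)[OF pathstart_in_path_image] by linarith
  have cd: "c < d" using horiz(2)[OF pathstart_in_path_image] by linarith
  have "path_image (\<kappa> \<circ> horiz) \<inter> path_image (\<kappa> \<circ> vert) \<noteq> {}"
  proof (rule paths_cross_box_complex)
    show "path (\<kappa> \<circ> horiz)" "path (\<kappa> \<circ> vert)"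
      using horiz(1) vert(1) cont_clamp by (auto intro: path_continuous_image)
    show "path_image (\<kappa> \<circ> horiz) \<subseteq> cbox (Complex u c) (Complex v d)"
      "path_image (\<kappa> \<circ> vert) \<subseteq> cbox (Complex u c) (Complex v d)"
      using uv cd by (auto simp: path_image_compose in_cbox_complex_iff)
  qed (use uv cd horiz(3,4) vert(3,4) in \<open>auto simp: pathstart_compose pathfinish_compose\<close>)
  then obtain z w where zw: "z \<in> path_image horiz" "w \<in> path_image vert" "\<kappa> z = \<kappa> w"
    by (auto simp: path_image_compose)
  then have "Re (\<kappa> z) = Re w" "Im z = Im (\<kappa> w)"
    using vert(2)[of w] horiz(2)[of z] by (metis Re_Im_clamp less_imp_le max.absorb2 min.absorb2)+
  then have "z = w"
    using vert(2)[of w] horiz(2)[of z] zw by (auto simp: complex_eq_iff max_def min_def split: if_splits)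
  then show ?thesis using zw by blast
qed

lemma inside_subset_ball:
  fixes S :: "'a::{real_normed_vector, perfect_space} set"
  assumes "S \<subseteq> cball a r" "closed S"
  shows "inside S \<subseteq> ball a r"
proof -
  have "inside S \<subseteq> cball a r"
    using inside_mono[OF assms(1)] inside_convex[OF convex_cball, of a r] assms(1) by blast
  then have "interior (inside S) \<subseteq> ball a r" by (metis interior_cball interior_mono)
  then show ?thesis
    using open_inside[OF assms(2)] by (simp add: interior_open)
qed

lemma simple_loop_inside_subset_ball:
  fixes c :: "real \<Rightarrow> complex"
  assumes "simple_path c" "path_image c \<subseteq> cball a r"
  shows "inside (path_image c) \<subseteq> ball a r"
  by (rule inside_subset_ball[OF assms(2)]) (use assms(1) in \<open>simp add: closed_path_image simple_path_imp_path\<close>)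

lemma simple_loop_inside_subset_open:
  fixes c :: "real \<Rightarrow> complex"
  assumes c: "simple_path c" "pathfinish c = pathstart c"
    and G: "open G" "G \<noteq> {}" "bounded G" "frontier G \<subseteq> path_image c"
  shows "inside (path_image c) \<subseteq> G"
proof -
  note Jordan = Jordan_inside_outside[OF c]
  have sub: "X \<subseteq> G" if "connected X" "X \<inter> G \<noteq> {}" "X \<inter> path_image c = {}" for X
    using connected_Int_frontier[of X G] that G(4) by blast
  have outside_disjoint: "outside (path_image c) \<inter> G = {}"
  proof (rule ccontr)
    assume "outside (path_image c) \<inter> G \<noteq> {}"
    then have "outside (path_image c) \<subseteq> G"
      using Jordan outside_no_overlap[of "path_image c"] by (intro sub) auto
    then show False using Jordan G(3) bounded_subset by blast
  qed
  have "G \<inter> closure (outside (path_image c)) = {}"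
    using outside_disjoint open_Int_closure_eq_empty[OF G(1)] by (simp add: Int_commute)
  then have "G \<inter> path_image c = {}"
    using Jordan by (auto simp: frontier_def)
  then have "inside (path_image c) \<inter> G \<noteq> {}"
    using outside_disjoint G(2) inside_Un_outside[of "path_image c"] by blast
  then show ?thesis
    using Jordan inside_no_overlap[of "path_image c"] by (intro sub) auto
qed

lemma closure_inside_simple_loop:
  fixes c :: "real \<Rightarrow> complex"
  assumes "simple_path c" "pathfinish c = pathstart c"
  shows "closure (inside (path_image c)) = inside (path_image c) \<union> path_image c"
  using Jordan_inside_outside[OF assms] closure_Un_frontier[of "inside (path_image c)"] by simp

text \<open>The boundary of the image consists of cluster values of \<^term>\<open>f\<close> at the loop \<^term>\<open>c\<close>.\<close>

lemma simple_loop_inside_subset_image: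
  fixes f :: "complex \<Rightarrow> complex"
  assumes g: "simple_path g" "pathfinish g = pathstart g"
    and c: "simple_path c" "pathfinish c = pathstart c" "inside (path_image c) \<subseteq> D"
    and D: "open D" "connected D"
    and f: "f holomorphic_on D" "\<not> f constant_on D" "bounded (f ` inside (path_image c))"
    and cluster: "\<And>u z y. \<lbrakk>\<And>n::nat. u n \<in> inside (path_image c); u \<longlonglongrightarrow> z; z \<in> path_image c;
        (\<lambda>n. f (u n)) \<longlonglongrightarrow> y\<rbrakk> \<Longrightarrow> y \<in> path_image g"
  shows "inside (path_image g) \<subseteq> f ` inside (path_image c)"
proof (rule simple_loop_inside_subset_open[OF g])
  define V where "V = inside (path_image c)"
  note Jordan = Jordan_inside_outside[OF c(1,2), folded V_def]
  have clV: "closure V = V \<union> path_image c"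
    unfolding V_def by (rule closure_inside_simple_loop[OF c(1,2)])
  show open_image: "open (f ` inside (path_image c))"
    using open_mapping_thm[OF f(1) D _ c(3) f(2)] Jordan by (simp add: V_def)
  show "f ` inside (path_image c) \<noteq> {}" using Jordan by (simp add: V_def)
  show "frontier (f ` inside (path_image c)) \<subseteq> path_image g"
  proof
    fix y assume "y \<in> frontier (f ` inside (path_image c))"
    then have y: "y \<in> closure (f ` V)" "y \<notin> f ` V"
      using open_image by (auto simp: frontier_def V_def interior_open)
    then obtain w where w: "\<And>n::nat. w n \<in> f ` V" "w \<longlonglongrightarrow> y"
      unfolding closure_sequential by blast
    have "\<forall>n. \<exists>x\<in>V. f x = w n" using w(1) by (metis imageE)
    then obtain u where "\<And>n. u n \<in> V" "\<And>n. f (u n) = w n" by metis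
    with w(2) have u: "\<And>n. u n \<in> V" "(\<lambda>n. f (u n)) \<longlonglongrightarrow> y" by simp_all
    have "compact (closure V)" using Jordan by (simp add: compact_closure)
    moreover have "\<forall>n. u n \<in> closure V" using u closure_subset by blast
    ultimately obtain z r where z: "z \<in> closure V" "strict_mono (r::nat\<Rightarrow>nat)" "(u \<circ> r) \<longlonglongrightarrow> z"
      unfolding compact_def by metis
    have lim: "(\<lambda>n. f ((u \<circ> r) n)) \<longlonglongrightarrow> y"
      using LIMSEQ_subseq_LIMSEQ[OF u(2) z(2)] by (simp add: o_def)
    have "z \<notin> V"
    proof
      assume "z \<in> V"
      then have "isCont f z"
        using c(3) D(1) holomorphic_on_imp_continuous_on[OF f(1)]
        by (auto simp: V_def continuous_on_eq_continuous_at)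
      then have "y = f z"
        using isCont_tendsto_compose[OF _ z(3)] lim LIMSEQ_unique by blast
      then show False using y \<open>z \<in> V\<close> by blast
    qed
    then show "y \<in> path_image g"
      using cluster[of "u \<circ> r" z y] u z lim clV by (auto simp: V_def)
  qed
qed (rule f(3))

lemma simple_loop_inside_subset_holomorphic_image:
  fixes f :: "complex \<Rightarrow> complex"
  assumes g: "simple_path g" "pathfinish g = pathstart g"
    and c: "simple_path c" "pathfinish c = pathstart c" "path_image c \<subseteq> ball a r"
    and f: "f holomorphic_on ball a r" "\<not> f constant_on ball a r"
    and image: "f ` path_image c \<subseteq> path_image g"
  shows "inside (path_image g) \<subseteq> f ` inside (path_image c)"
proof (rule simple_loop_inside_subset_image[OF g c(1,2) _ open_ball connected_ball f])
  have cont: "continuous_on (ball a r) f" by (rule holomorphic_on_imp_continuous_on[OF f(1)])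
  show inside: "inside (path_image c) \<subseteq> ball a r"
    using simple_loop_inside_subset_ball[OF c(1)] c(3) ball_subset_cball by blast
  have "continuous_on (closure (inside (path_image c))) f"
    using cont inside c(3) closure_inside_simple_loop[OF c(1,2)] by (auto intro: continuous_on_subset)
  then have "compact (f ` closure (inside (path_image c)))"
    using Jordan_inside_outside[OF c(1,2)] by (intro compact_continuous_image) (auto simp: compact_closure)
  then show "bounded (f ` inside (path_image c))"
    by (meson bounded_subset closure_subset compact_imp_bounded image_mono)
  fix u z y
  assume u: "u \<longlonglongrightarrow> z" "z \<in> path_image c" "(\<lambda>n::nat. f (u n)) \<longlonglongrightarrow> y"
  then have "isCont f z" using cont c(3) by (auto simp: continuous_on_eq_continuous_at)
  then have "y = f z" using isCont_tendsto_compose[OF _ u(1)] u(3) LIMSEQ_unique by blast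
  then show "y \<in> path_image g" using image u(2) by blast
qed

lemma connected_clopen_imp_component:
  assumes S: "connected S" "S \<noteq> {}" "openin (top_of_set A) S" "closedin (top_of_set A) S"
  shows "S \<in> components A"
  unfolding in_components_maximal
proof (intro conjI allI impI)
  fix D assume D: "D \<noteq> {} \<and> S \<subseteq> D \<and> D \<subseteq> A \<and> connected D"
  then have "openin (top_of_set D) S" "closedin (top_of_set D) S"
    using S(3,4) openin_subset_trans closedin_subset_trans by blast+
  then show "D = S" using D S(2) by (metis connected_clopen)
qed (use S openin_imp_subset in auto)

lemma connected_component_image:
  assumes "connected_component S x y" "continuous_on S f" "f ` S \<subseteq> S'"
  shows "connected_component S' (f x) (f y)"
proof -
  obtain T where T: "connected T" "T \<subseteq> S" "x \<in> T" "y \<in> T"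
    using assms(1) unfolding connected_component_def by blast
  then have "connected (f ` T)" "f ` T \<subseteq> S'"
    using assms(2,3) by (auto intro: connected_continuous_image continuous_on_subset)
  then show ?thesis using T(3,4) unfolding connected_component_def by blast
qed

lemma separation_by_component_homeomorphic_UNIV:
  fixes h :: "'a::topological_space \<Rightarrow> 'b::euclidean_space"
  assumes hk: "homeomorphism X UNIV h k" and A: "closedin (top_of_set X) A"
    and sep: "\<not> connected_component (X - A) x y" and xy: "x \<in> X" "y \<in> X"
  obtains C where "C \<in> components A" "\<not> connected_component (X - C) x y"
proof -
  have hk_eq: "\<And>z. z \<in> X \<Longrightarrow> k (h z) = z" "\<And>z. h (k z) = z" "\<And>z. k z \<in> X"
    and cont: "\<And>S. S \<subseteq> X \<Longrightarrow> continuous_on S h" "\<And>S. continuous_on S k"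
    using hk by (auto simp: homeomorphism_def intro: continuous_on_subset)
  have AX: "A \<subseteq> X" using A by (rule closedin_imp_subset)
  have "closed (h ` A)" using homeomorphism_imp_closed_map[OF hk A] by simp
  moreover have "\<not> connected_component (- (h ` A)) (h x) (h y)"
  proof
    assume "connected_component (- (h ` A)) (h x) (h y)"
    moreover have "k ` (- (h ` A)) \<subseteq> X - A" using hk_eq(2,3) by (auto; metis imageI)
    ultimately have "connected_component (X - A) (k (h x)) (k (h y))"
      by (rule connected_component_image[OF _ cont(2)])
    then show False using sep xy by (simp add: hk_eq)
  qed
  ultimately obtain C' where C': "C' \<in> components (h ` A)" "\<not> connected_component (- C') (h x) (h y)"
    using separation_by_component_closed_pointwise by blast
  have "k ` C' \<subseteq> A" using in_components_subset[OF C'(1)] AX hk_eq(1) by force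
  moreover have "connected (k ` C')"
    by (intro connected_continuous_image cont in_components_connected[OF C'(1)])
  moreover have "A \<noteq> {}" using in_components_nonempty[OF C'(1)] in_components_subset[OF C'(1)] by blast
  ultimately obtain C where C: "C \<in> components A" "k ` C' \<subseteq> C" using exists_component_superset by metis
  have "\<not> connected_component (X - C) x y"
  proof
    assume "connected_component (X - C) x y"
    moreover have "h ` (X - C) \<subseteq> - C'" using C(2) hk_eq(1) by force
    ultimately show False using C'(2) connected_component_image[OF _ cont(1)] by blast
  qed
  then show thesis using that C(1) by blast
qed

lemma closure_separates_radius_end:
  fixes \<alpha> :: "'a::{real_normed_vector,heine_borel}"
  assumes sep: "\<forall>\<^sub>F r in at_left (1::real). \<not> connected_component (ball 0 1 - C) 0 (r *\<^sub>R \<alpha>)"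
  shows "\<not> connected_component (cball 0 1 - closure C) 0 \<alpha>"
proof
  assume "connected_component (cball 0 1 - closure C) 0 \<alpha>"
  moreover have "openin (top_of_set (cball (0::'a) 1)) (cball 0 1 - closure C)"
    by (metis Diff_eq closed_closure open_Compl openin_open_Int)
  then have "locally path_connected (cball 0 1 - closure C)"
    by (rule locally_open_subset[OF convex_imp_locally_path_connected[OF convex_cball]])
  ultimately have "path_component (cball 0 1 - closure C) 0 \<alpha>"
    by (simp add: path_component_eq_connected_component)
  then obtain h where h: "path h" "path_image h \<subseteq> cball 0 1 - closure C" "pathstart h = 0" "pathfinish h = \<alpha>"
    unfolding path_component_def by blast
  obtain d where d: "d > 0" "\<And>x y. x \<in> path_image h \<Longrightarrow> y \<in> closure C \<Longrightarrow> d \<le> dist x y"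
    using separate_compact_closed[of "path_image h" "closure C"] h(1,2) by blast
  have "connected_component (ball 0 1 - C) 0 (r *\<^sub>R \<alpha>)" if r: "max 0 (1 - d) < r" "r < 1" for r
  proof -
    have in_ball: "r *\<^sub>R x \<in> ball 0 1 - C" if x: "x \<in> path_image h" for x
    proof -
      have norm_x: "norm x \<le> 1" using x h(2) by auto
      then have "r * norm x < 1" using r mult_left_le[of "norm x" r] by linarith
      moreover have "x - r *\<^sub>R x = (1 - r) *\<^sub>R x" by (simp add: algebra_simps)
      then have "dist x (r *\<^sub>R x) \<le> 1 - r"
        using r norm_x mult_left_le[of "norm x" "1 - r"] by (simp add: dist_norm)
      then have "r *\<^sub>R x \<notin> C" using d(2)[OF x, of "r *\<^sub>R x"] closure_subset r(1) by fastforce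
      ultimately show ?thesis using r by simp
    qed
    have "connected_component (path_image h) 0 \<alpha>"
      using connected_path_image[OF h(1)] pathstart_in_path_image[of h] pathfinish_in_path_image[of h] h(3,4)
      unfolding connected_component_def by auto
    moreover have "continuous_on (path_image h) (\<lambda>x. r *\<^sub>R x)" by (intro continuous_intros)
    moreover have "(\<lambda>x. r *\<^sub>R x) ` path_image h \<subseteq> ball 0 1 - C" using in_ball by blast
    ultimately have "connected_component (ball 0 1 - C) (r *\<^sub>R 0) (r *\<^sub>R \<alpha>)" by (rule connected_component_image)
    then show ?thesis by simp
  qed
  then have "\<forall>\<^sub>F r in at_left (1::real). connected_component (ball 0 1 - C) 0 (r *\<^sub>R \<alpha>)"
    unfolding eventually_at_left_field using d(1) by (intro exI[of _ "max 0 (1 - d)"]) auto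
  with sep have "\<forall>\<^sub>F r in at_left (1::real). False" by eventually_elim blast
  then show False by simp
qed

section \<open>A two constants estimate\<close>

text \<open>
  A path in the component from \<^term>\<open>x\<close> to a point closer to the edge of the strip than \<^term>\<open>l\<close>, joined to
  its mirror image, would have to cross \<^term>\<open>l\<close>.
\<close>

lemma symmetric_component_confined:
  fixes x w t :: real
  assumes l: "path l" "\<And>z. z \<in> path_image l \<Longrightarrow> \<bar>Im z\<bar> \<le> t"
    "Re (pathstart l) \<le> x - h" "x + h \<le> Re (pathfinish l)"
    and z: "z \<in> connected_component_set
      ({z. \<bar>Re z - x\<bar> < h \<and> \<bar>Im z\<bar> < w} - (path_image l \<union> cnj ` path_image l)) (of_real x)"
  shows "\<bar>Im z\<bar> \<le> t"
proof (rule ccontr)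
  assume far: "\<not> \<bar>Im z\<bar> \<le> t"
  define E where "E = path_image l \<union> cnj ` path_image l"
  define R where "R = {z. \<bar>Re z - x\<bar> < h \<and> \<bar>Im z\<bar> < w}"
  have "compact E"
    unfolding E_def using l(1) by (intro compact_Un compact_continuous_image continuous_intros) auto
  moreover have "open R"
    unfolding R_def by (intro open_Collect_conj open_Collect_less continuous_intros)
  ultimately have "open (R - E)" by (simp add: compact_imp_closed open_Diff)
  then have "path_component (R - E) (of_real x) z"
    using z by (simp add: open_path_connected_component E_def R_def)
  then obtain P where P: "path P" "path_image P \<subseteq> R - E" "pathstart P = of_real x" "pathfinish P = z"
    unfolding path_component_def by blast
  define Q where "Q = reversepath (cnj \<circ> P) +++ P"
  have "path (cnj \<circ> P)"
    by (rule path_continuous_image[OF P(1)]) (intro continuous_intros)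
  then have Q: "path Q" "pathstart Q = cnj z" "pathfinish Q = z"
    "path_image Q = cnj ` path_image P \<union> path_image P"
    using P by (auto simp: Q_def pathfinish_compose pathstart_compose path_image_join path_image_compose)
  have "cnj ` path_image P \<subseteq> R - E"
    using P(2) by (force simp: R_def E_def image_iff)
  then have Q_sub: "path_image Q \<subseteq> R - E" using P(2) Q(4) by blast
  have no_vertical_path: False
    if V: "path V" "path_image V = path_image Q" "Im (pathstart V) \<le> - \<bar>Im z\<bar>"
      "\<bar>Im z\<bar> \<le> Im (pathfinish V)" for V
  proof -
    have "path_image V \<inter> path_image l \<noteq> {}"
    proof (rule paths_cross_strips[OF V(1) _ V(3,4) l(1) _ l(3,4)])
      show "x - h < Re v \<and> Re v < x + h" if "v \<in> path_image V" for v
        using that Q_sub V(2) by (auto simp: R_def abs_less_iff)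
      show "- \<bar>Im z\<bar> < Im v \<and> Im v < \<bar>Im z\<bar>" if "v \<in> path_image l" for v
        using l(2)[OF that] far by linarith
    qed
    then show False using Q_sub V(2) by (auto simp: E_def)
  qed
  show False
    using no_vertical_path[of Q] no_vertical_path[of "reversepath Q"] Q by (cases "Im z \<ge> 0") auto
qed

lemma symmetric_component_exists:
  fixes x w :: real
  assumes h: "h > 0"
    and l: "path l" "\<And>z. z \<in> path_image l \<Longrightarrow> \<bar>Im z\<bar> < w"
      "Re (pathstart l) \<le> x - h" "x + h \<le> Re (pathfinish l)"
    and x: "of_real x \<notin> path_image l"
  obtains W where "open W" "of_real x \<in> W" "closure W \<subseteq> {z. \<bar>Re z - x\<bar> \<le> h \<and> \<bar>Im z\<bar> < w}"
    "frontier W \<subseteq> path_image l \<union> cnj ` path_image l \<union> {z. \<bar>Re z - x\<bar> = h}"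
proof -
  define E where "E = path_image l \<union> cnj ` path_image l"
  define R where "R = {z. \<bar>Re z - x\<bar> < h \<and> \<bar>Im z\<bar> < w}"
  define W where "W = connected_component_set (R - E) (of_real x)"
  have "compact E"
    unfolding E_def using l(1) by (intro compact_Un compact_continuous_image continuous_intros) auto
  moreover have "open R"
    unfolding R_def by (intro open_Collect_conj open_Collect_less continuous_intros)
  ultimately have "open (R - E)" by (simp add: compact_imp_closed open_Diff)
  then have "open W" "frontier W \<inter> (R - E) = {}"
    unfolding W_def using frontier_of_connected_component_subset[of "R - E" "of_real x"]
    by (auto simp: open_connected_component frontier_def interior_open)
  have "compact ((\<lambda>z. \<bar>Im z\<bar>) ` path_image l)"
    using l(1) by (intro compact_continuous_image continuous_intros) auto
  then obtain v where v: "v \<in> path_image l" "\<And>z. z \<in> path_image l \<Longrightarrow> \<bar>Im z\<bar> \<le> \<bar>Im v\<bar>"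
    using compact_attains_sup[of "(\<lambda>z. \<bar>Im z\<bar>) ` path_image l"] by auto
  have "\<bar>Re z - x\<bar> \<le> h \<and> \<bar>Im z\<bar> \<le> \<bar>Im v\<bar>" if "z \<in> W" for z
    using symmetric_component_confined[OF l(1) v(2) l(3,4) that[unfolded W_def R_def E_def]]
      connected_component_subset[of "R - E" "of_real x"] that by (auto simp: W_def R_def)
  then have "closure W \<subseteq> {z. \<bar>Re z - x\<bar> \<le> h \<and> \<bar>Im z\<bar> \<le> \<bar>Im v\<bar>}"
    by (intro closure_minimal closed_Collect_conj closed_Collect_le continuous_intros) auto
  then have closure_W: "closure W \<subseteq> {z. \<bar>Re z - x\<bar> \<le> h \<and> \<bar>Im z\<bar> < w}"
    using l(2)[OF v(1)] by auto
  show thesis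
  proof (rule that[OF \<open>open W\<close> _ closure_W])
    have "of_real x \<notin> cnj ` path_image l"
      using x by (auto simp: image_iff) (metis complex_cnj_cnj complex_cnj_complex_of_real)
    then show "of_real x \<in> W"
      using x h l(2)[OF v(1)] by (simp add: W_def R_def E_def)
    show "frontier W \<subseteq> path_image l \<union> cnj ` path_image l \<union> {z. \<bar>Re z - x\<bar> = h}"
    proof
      fix z assume "z \<in> frontier W"
      then have "z \<notin> R - E" "\<bar>Re z - x\<bar> \<le> h" "\<bar>Im z\<bar> < w"
        using \<open>frontier W \<inter> (R - E) = {}\<close> closure_W by (auto simp: frontier_def)
      then show "z \<in> path_image l \<union> cnj ` path_image l \<union> {z. \<bar>Re z - x\<bar> = h}"
        by (auto simp: R_def E_def)
    qed
  qed
qed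

lemma strip_barrier_le:
  fixes \<epsilon> w u v g :: real
  assumes \<epsilon>: "0 < \<epsilon>" "\<epsilon> \<le> 1" and v: "\<bar>v\<bar> < w"
    and g: "0 \<le> g" "g \<le> \<epsilon> \<or> g \<le> 1 \<and> \<bar>u\<bar> = 2 * w"
  shows "g * exp (ln \<epsilon> / (4 * w\<^sup>2) * (u\<^sup>2 - v\<^sup>2)) \<le> \<epsilon> powr (3/4)"
proof -
  define c where "c = - ln \<epsilon> / (4 * w\<^sup>2)"
  have w: "w > 0" using v by linarith
  have c: "c \<ge> 0" "c * w\<^sup>2 = - ln \<epsilon> / 4" using \<epsilon> w by (auto simp: c_def divide_nonpos_pos)
  have "v\<^sup>2 \<le> w\<^sup>2" using v by (simp add: abs_le_square_iff[symmetric])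
  then have cv: "c * v\<^sup>2 \<le> - ln \<epsilon> / 4" using mult_left_mono[OF _ c(1)] c(2) by metis
  have "g * exp (- c * (u\<^sup>2 - v\<^sup>2)) \<le> \<epsilon> powr (3/4)"
    using g(2)
  proof
    assume "g \<le> \<epsilon>"
    moreover have "- c * (u\<^sup>2 - v\<^sup>2) \<le> - ln \<epsilon> / 4"
      using cv mult_nonneg_nonneg[OF c(1) zero_le_power2[of u]] unfolding right_diff_distrib by linarith
    ultimately have "g * exp (- c * (u\<^sup>2 - v\<^sup>2)) \<le> \<epsilon> * exp (- ln \<epsilon> / 4)"
      using \<epsilon>(1) by (intro mult_mono) auto
    also have "\<dots> = exp (ln \<epsilon>) * exp (- ln \<epsilon> / 4)" using \<epsilon>(1) by simp
    also have "\<dots> = \<epsilon> powr (3/4)" using \<epsilon>(1) unfolding mult_exp_exp by (simp add: powr_def)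
    finally show ?thesis .
  next
    assume "g \<le> 1 \<and> \<bar>u\<bar> = 2 * w"
    then have "u\<^sup>2 = 4 * w\<^sup>2" by (metis power2_abs power_mult_distrib four_x_squared)
    then have "- c * (u\<^sup>2 - v\<^sup>2) \<le> 3 / 4 * ln \<epsilon>"
      using cv c(2) by (simp add: algebra_simps)
    then have "g * exp (- c * (u\<^sup>2 - v\<^sup>2)) \<le> 1 * exp (3 / 4 * ln \<epsilon>)"
      using g \<open>g \<le> 1 \<and> _\<close> by (intro mult_mono) auto
    then show ?thesis using \<epsilon>(1) by (simp add: powr_def)
  qed
  then show ?thesis by (simp add: c_def)
qed

text \<open>
  The reflected product \<^term>\<open>F z * cnj (F (cnj z))\<close> is small on the path and on its mirror image, which
  cut the centre off from the edges of the strip; the harmonic function \<^term>\<open>Re ((z - of_real x)\<^sup>2)\<close>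
  controls the two remaining sides of the rectangle.
\<close>

lemma two_constants_strip:
  fixes F :: "complex \<Rightarrow> complex" and w x :: real
  assumes F: "F holomorphic_on {z. \<bar>Im z\<bar> < w}" "\<And>z. \<bar>Im z\<bar> < w \<Longrightarrow> norm (F z) \<le> 1"
    and l: "path l" "\<And>z. z \<in> path_image l \<Longrightarrow> \<bar>Im z\<bar> < w"
      "Re (pathstart l) \<le> x - 2 * w" "x + 2 * w \<le> Re (pathfinish l)"
    and \<epsilon>: "0 < \<epsilon>" "\<epsilon> \<le> 1" "\<And>z. z \<in> path_image l \<Longrightarrow> norm (F z) \<le> \<epsilon>"
  shows "norm (F (of_real x)) \<le> \<epsilon> powr (3/8)"
proof (cases "of_real x \<in> path_image l")
  case True
  have "\<epsilon> \<le> \<epsilon> powr (3/8)" using \<epsilon> powr_mono'[of "3/8" 1 \<epsilon>] by simp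
  then show ?thesis using \<epsilon>(3)[OF True] by linarith
next
  case False
  define S where "S = {z. \<bar>Im z\<bar> < w}"
  define K where "K z = F z * cnj (F (cnj z)) * exp (of_real (ln \<epsilon> / (4 * w\<^sup>2)) * (z - of_real x)\<^sup>2)" for z
  have "w > 0" using l(2)[OF pathstart_in_path_image] by linarith
  have "open S" unfolding S_def by (intro open_Collect_less continuous_intros)
  moreover have "cnj ` S = S"
    by (auto simp: S_def image_iff) (metis abs_minus_cancel cnj.sel(2) complex_cnj_cnj)
  ultimately have "(\<lambda>z. cnj (F (cnj z))) holomorphic_on S"
    using holomorphic_on_compose_cnj_cnj[of F S] F(1) by (simp add: S_def o_def)
  then have hol_K: "K holomorphic_on S"
    unfolding K_def using F(1) by (intro holomorphic_intros) (auto simp: S_def)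
  have norm_K: "norm (K z) = norm (F z) * norm (F (cnj z)) *
      exp (ln \<epsilon> / (4 * w\<^sup>2) * ((Re z - x)\<^sup>2 - (Im z)\<^sup>2))" for z
    by (simp add: K_def norm_mult power2_eq_square)
  obtain W where W: "open W" "of_real x \<in> W" "closure W \<subseteq> {z. \<bar>Re z - x\<bar> \<le> 2 * w \<and> \<bar>Im z\<bar> < w}"
    "frontier W \<subseteq> path_image l \<union> cnj ` path_image l \<union> {z. \<bar>Re z - x\<bar> = 2 * w}"
    using symmetric_component_exists[of "2 * w" l w x] \<open>w > 0\<close> l False by auto
  have "norm (K (of_real x)) \<le> \<epsilon> powr (3/4)"
  proof (rule maximum_modulus_frontier[of K W])
    show "K holomorphic_on interior W" "continuous_on (closure W) K"
      using holomorphic_on_subset[OF hol_K] holomorphic_on_imp_continuous_on[OF hol_K] W(3) closure_subset[of W]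
        interior_subset[of W] by (auto simp: S_def intro: continuous_on_subset)
    have "closure W \<subseteq> cbox (Complex (x - 2 * w) (- w)) (Complex (x + 2 * w) w)"
      using W(3) by (auto simp: in_cbox_complex_iff abs_le_iff abs_less_iff)
    then show "bounded W" by (meson bounded_cbox bounded_subset closure_subset)
    fix z assume z: "z \<in> frontier W"
    then have Im_z: "\<bar>Im z\<bar> < w" using W(3) by (auto simp: frontier_def)
    then have F_le_1: "norm (F z) \<le> 1" "norm (F (cnj z)) \<le> 1" using F(2) by auto
    have "norm (F z) \<le> \<epsilon> \<or> norm (F (cnj z)) \<le> \<epsilon> \<or> \<bar>Re z - x\<bar> = 2 * w"
      using z W(4) \<epsilon>(3) by auto
    then have "norm (F z) * norm (F (cnj z)) \<le> \<epsilon> \<or>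
        norm (F z) * norm (F (cnj z)) \<le> 1 \<and> \<bar>Re z - x\<bar> = 2 * w"
      using F_le_1 \<epsilon>(1) mult_mono[of "norm (F z)" \<epsilon> "norm (F (cnj z))" 1]
        mult_mono[of "norm (F z)" 1 "norm (F (cnj z))" \<epsilon>] by (auto simp: mult_le_one)
    then show "norm (K z) \<le> \<epsilon> powr (3/4)"
      unfolding norm_K using \<epsilon> Im_z by (intro strip_barrier_le) auto
  qed (rule W(2))
  then have "(norm (F (of_real x)))\<^sup>2 \<le> (\<epsilon> powr (3/8))\<^sup>2"
    by (simp add: norm_K power2_eq_square flip: powr_add)
  then show ?thesis by (rule power2_le_imp_le) simp
qed

section \<open>Koebe's lemma\<close>

lemma zero_free_circle_exists:
  fixes f :: "complex \<Rightarrow> complex"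
  assumes "f holomorphic_on ball 0 1" "\<not> f constant_on ball 0 1" "r < 1"
  obtains \<rho> where "r < \<rho>" "\<rho> < 1" "\<And>z. norm z = \<rho> \<Longrightarrow> f z \<noteq> 0"
proof -
  define s where "s = (1 + r) / 2"
  have s: "r < s" "s < 1" using assms(3) by (auto simp: s_def)
  have "finite (norm ` {z \<in> cball 0 s. f z = 0})"
    using s(2) by (intro finite_imageI holomorphic_compact_finite_zeros[OF assms(1) _ _ _ _ assms(2)]) auto
  moreover have "infinite {r<..<s}" using s(1) by simp
  ultimately obtain \<rho> where "\<rho> \<in> {r<..<s}" "\<rho> \<notin> norm ` {z \<in> cball 0 s. f z = 0}"
    by (meson finite_subset subsetI)
  then show thesis
    using s(2) by (intro that[of \<rho>]) (auto simp: image_iff)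
qed

lemma bounded_below_on_circle_exists:
  fixes f :: "complex \<Rightarrow> complex"
  assumes f: "f holomorphic_on ball 0 1" "\<not> f constant_on ball 0 1" and r: "0 \<le> r" "r < 1"
  obtains \<rho> \<mu> where "r < \<rho>" "\<rho> < 1" "\<mu> > 0" "\<And>z. norm z = \<rho> \<Longrightarrow> \<mu> < norm (f z)"
proof -
  obtain \<rho> where \<rho>: "r < \<rho>" "\<rho> < 1" "\<And>z. norm z = \<rho> \<Longrightarrow> f z \<noteq> 0"
    by (rule zero_free_circle_exists[OF f r(2)]) blast
  have "sphere 0 \<rho> \<subseteq> ball (0::complex) 1" using \<rho>(2) by auto
  then have "continuous_on (sphere 0 \<rho>) (\<lambda>z. norm (f z))"
    by (intro continuous_on_norm continuous_on_subset[OF holomorphic_on_imp_continuous_on[OF f(1)]])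
  moreover have "sphere (0::complex) \<rho> \<noteq> {}" using \<rho>(1) r(1) by simp
  ultimately obtain z0 where z0: "norm z0 = \<rho>" "\<And>z. norm z = \<rho> \<Longrightarrow> norm (f z0) \<le> norm (f z)"
    using continuous_attains_inf[OF compact_sphere] by (metis mem_sphere_0)
  have "norm (f z0) / 2 < norm (f z)" if "norm z = \<rho>" for z
    using z0(2)[OF that] \<rho>(3)[OF z0(1)] by (smt (verit) field_sum_of_halves zero_less_norm_iff)
  then show thesis using that[OF \<rho>(1,2)] \<rho>(3)[OF z0(1)] by (meson half_gt_zero zero_less_norm_iff)
qed

lemma norm_exp_diff_le:
  fixes u v :: complex
  assumes "Re u \<le> 0" "Re v \<le> 0"
  shows "norm (exp u - exp v) \<le> norm (u - v)"
proof -
  have "norm (exp u - exp v) \<le> 1 * norm (u - v)"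
  proof (rule field_differentiable_bound[where S="{z. Re z \<le> 0}"])
    show "convex {z. Re z \<le> 0}" by (rule convex_halfspace_Re_le)
    show "(exp has_field_derivative exp z) (at z within {z. Re z \<le> 0})" for z
      by (rule DERIV_exp[THEN has_field_derivative_at_within])
  qed (use assms in auto)
  then show ?thesis by simp
qed

lemma log_path_in_annulus:
  fixes w :: real
  assumes C: "path_connected C" "\<And>z. z \<in> C \<Longrightarrow> exp (- w) < norm z \<and> norm z < 1"
    and ab: "a \<in> C" "b \<in> C"
  obtains l where "path l" "exp ` path_image l \<subseteq> C" "\<And>z. z \<in> path_image l \<Longrightarrow> - w < Re z \<and> Re z < 0"
    "dist a b \<le> w + (Im (pathfinish l) - Im (pathstart l))"
proof -
  obtain \<gamma> where \<gamma>: "path \<gamma>" "path_image \<gamma> \<subseteq> C" "pathstart \<gamma> = a" "pathfinish \<gamma> = b"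
    using C(1) ab unfolding path_connected_def by blast
  have "\<gamma> t \<noteq> 0" if "t \<in> {0..1}" for t
    using that \<gamma>(2) C(2)[of "\<gamma> t"] order_less_trans[OF exp_gt_zero] by (force simp: path_image_def)
  then obtain l where l: "path l" "\<And>t. t \<in> {0..1} \<Longrightarrow> \<gamma> t = exp (l t)"
    using continuous_logarithm_on_contractible[of "{0..1}" \<gamma>] \<gamma>(1)
    by (metis convex_imp_contractible convex_real_interval(5) path_def)
  have exp_l: "exp ` path_image l \<subseteq> C"
    using l(2) \<gamma>(2) by (force simp: path_image_def)
  have Re_l: "- w < Re z \<and> Re z < 0" if "z \<in> path_image l" for z
  proof -
    have "exp z \<in> C" using exp_l that by blast
    from C(2)[OF this] show ?thesis by simp
  qed
  have "a = exp (pathstart l)" "b = exp (pathfinish l)"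
    using \<gamma>(3,4) l(2) by (auto simp: pathstart_def pathfinish_def)
  moreover have Re_ends: "- w < Re (pathstart l)" "Re (pathstart l) < 0" "- w < Re (pathfinish l)"
    "Re (pathfinish l) < 0"
    using Re_l[of "pathstart l"] Re_l[of "pathfinish l"] by auto
  ultimately have "dist a b \<le> norm (pathstart l - pathfinish l)"
    using norm_exp_diff_le[of "pathstart l" "pathfinish l"] by (simp add: dist_norm)
  also have "\<dots> \<le> \<bar>Re (pathstart l - pathfinish l)\<bar> + \<bar>Im (pathstart l - pathfinish l)\<bar>"
    by (rule cmod_le)
  also have "\<dots> \<le> w + \<bar>Im (pathfinish l) - Im (pathstart l)\<bar>"
    using Re_ends by simp
  finally have dist: "dist a b \<le> w + \<bar>Im (pathfinish l) - Im (pathstart l)\<bar>" .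
  show thesis
    using that[of l] that[of "reversepath l"] l(1) exp_l Re_l dist
    by (cases "Im (pathstart l) \<le> Im (pathfinish l)") auto
qed

lemma holomorphic_small_along_arc_imp_small_on_circle:
  fixes f :: "complex \<Rightarrow> complex"
  assumes f: "f holomorphic_on ball 0 1" "\<And>z. z \<in> ball 0 1 \<Longrightarrow> norm (f z) \<le> 1"
    and l: "path l" "\<And>z. z \<in> path_image l \<Longrightarrow> - w < Re z \<and> Re z < 0"
      "Im (pathstart l) + 4 * w \<le> Im (pathfinish l)"
    and \<epsilon>: "0 < \<epsilon>" "\<epsilon> \<le> 1" "\<And>z. z \<in> path_image l \<Longrightarrow> norm (f (exp z)) \<le> \<epsilon>"
  obtains z where "norm z = exp (- w)" "norm (f z) \<le> \<epsilon> powr (3/8)"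
proof -
  define \<theta> where "\<theta> = Im (pathstart l) + 2 * w"
  define rot where "rot z = - \<i> * (z + of_real w)" for z
  define F where "F z = f (exp (\<i> * z - of_real w))" for z
  have F_rot: "F (rot z) = f (exp z)" for z by (simp add: F_def rot_def algebra_simps)
  have "norm (F (of_real \<theta>)) \<le> \<epsilon> powr (3/8)"
  proof (rule two_constants_strip)
    show "F holomorphic_on {z. \<bar>Im z\<bar> < w}"
      unfolding F_def by (rule holomorphic_on_compose_gen[OF _ f(1), unfolded o_def])
        (auto intro!: holomorphic_intros)
    show "norm (F z) \<le> 1" if "\<bar>Im z\<bar> < w" for z
      unfolding F_def using that by (intro f(2)) simp
    show "path (rot \<circ> l)"
      unfolding rot_def by (intro path_continuous_image l(1) continuous_intros)
    fix z assume "z \<in> path_image (rot \<circ> l)"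
    then obtain v where v: "v \<in> path_image l" "z = rot v" by (auto simp: path_image_compose)
    show "norm (F z) \<le> \<epsilon>" using v \<epsilon>(3) by (simp add: F_rot)
    show "\<bar>Im z\<bar> < w" using v l(2)[of v] by (simp add: rot_def)
  qed (use l(3) \<epsilon> in \<open>auto simp: pathstart_compose pathfinish_compose rot_def \<theta>_def\<close>)
  then show thesis
    by (intro that[of "exp (\<i> * of_real \<theta> - of_real w)"]) (auto simp: F_def)
qed

text \<open>
  On a connected set of large diameter close to the circle, \<^term>\<open>f\<close> cannot be too small: otherwise it
  would be tiny somewhere on a fixed circle carrying no zero of \<^term>\<open>f\<close>.
\<close>

theorem Koebe_lemma:
  fixes f :: "complex \<Rightarrow> complex"
  assumes f: "f holomorphic_on ball 0 1" "bounded (f ` ball 0 1)" "\<not> f constant_on ball 0 1" and \<delta>: "\<delta> > 0"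
  obtains \<epsilon> \<rho> where "\<epsilon> > 0" "\<rho> < 1"
    "\<And>C. path_connected C \<Longrightarrow> (\<And>z. z \<in> C \<Longrightarrow> \<rho> < norm z \<and> norm z < 1 \<and> norm (f z) < \<epsilon>) \<Longrightarrow> diameter C \<le> \<delta>"
proof -
  obtain M where M: "M > 0" "\<And>z. z \<in> ball 0 1 \<Longrightarrow> norm (f z) \<le> M"
    using f(2) unfolding bounded_pos by blast
  obtain \<rho> \<mu> where \<rho>: "exp (- \<delta> / 5) < \<rho>" "\<rho> < 1" and \<mu>: "\<mu> > 0" "\<And>z. norm z = \<rho> \<Longrightarrow> \<mu> < norm (f z)"
    using bounded_below_on_circle_exists[OF f(1,3), of "exp (- \<delta> / 5)"] \<delta> by auto
  have "\<rho> > 0" using \<rho>(1) order_less_trans[OF exp_gt_zero] by blast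
  define w where "w = - ln \<rho>"
  have w: "exp (- w) = \<rho>" "w > 0" "5 * w < \<delta>"
    using \<rho>(1,2) \<open>\<rho> > 0\<close> ln_less_cancel_iff[of "exp (- \<delta> / 5)" \<rho>] by (auto simp: w_def)
  define g where "g z = f z / M" for z
  have g: "g holomorphic_on ball 0 1" "\<And>z. z \<in> ball 0 1 \<Longrightarrow> norm (g z) \<le> 1"
    unfolding g_def using f(1) M by (auto intro!: holomorphic_intros simp: norm_divide)
  define \<epsilon> where "\<epsilon> = min 1 ((\<mu> / M) powr (8/3))"
  have \<epsilon>: "0 < \<epsilon>" "\<epsilon> \<le> 1" "\<epsilon> powr (3/8) \<le> \<mu> / M"
    using \<mu>(1) M(1) powr_mono2[of "3/8" \<epsilon> "(\<mu> / M) powr (8/3)"] by (auto simp: \<epsilon>_def powr_powr)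
  show thesis
  proof (rule that[of "\<epsilon> * M" \<rho>])
    fix C assume C: "path_connected C" "\<And>z. z \<in> C \<Longrightarrow> \<rho> < norm z \<and> norm z < 1 \<and> norm (f z) < \<epsilon> * M"
    have g_small: "norm (g z) \<le> \<epsilon>" if "z \<in> C" for z
      using C(2)[OF that] M(1) by (simp add: g_def norm_divide divide_le_eq)
    have "dist a b \<le> \<delta>" if ab: "a \<in> C" "b \<in> C" for a b
    proof (rule ccontr)
      assume "\<not> dist a b \<le> \<delta>"
      moreover obtain l where l: "path l" "exp ` path_image l \<subseteq> C"
        "\<And>z. z \<in> path_image l \<Longrightarrow> - w < Re z \<and> Re z < 0"
        "dist a b \<le> w + (Im (pathfinish l) - Im (pathstart l))"
        using log_path_in_annulus[OF C(1) _ ab, of w] C(2) w(1) by metis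
      ultimately have "Im (pathstart l) + 4 * w \<le> Im (pathfinish l)" using w(3) by linarith
      then obtain z where "norm z = \<rho>" "norm (g z) \<le> \<epsilon> powr (3/8)"
        using holomorphic_small_along_arc_imp_small_on_circle[OF g l(1,3) _ \<epsilon>(1,2)] g_small l(2) w(1) by blast
      moreover from this have "\<mu> / M < norm (g z)"
        using \<mu>(2) M(1) by (simp add: g_def norm_divide divide_strict_right_mono)
      ultimately show False using \<epsilon>(3) by linarith
    qed
    then show "diameter C \<le> \<delta>" using \<delta> by (intro diameter_le) (auto simp: dist_norm)
  qed (use \<epsilon> M \<rho> in auto)
qed

section \<open>Lindelof's theorem inside a loop\<close>

lemma continuous_on_mult_diff_except_point:
  fixes f :: "complex \<Rightarrow> complex"
  assumes "continuous_on (S - {\<beta>}) f" "\<And>z. z \<in> S \<Longrightarrow> z \<noteq> \<beta> \<Longrightarrow> norm (f z) \<le> B"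
  shows "continuous_on S (\<lambda>z. f z * (z - \<beta>))"
  unfolding continuous_on_def
proof
  fix z assume "z \<in> S"
  show "((\<lambda>z. f z * (z - \<beta>)) \<longlongrightarrow> f z * (z - \<beta>)) (at z within S)"
  proof (cases "z = \<beta>")
    case True
    have "((\<lambda>z. B * norm (z - \<beta>)) \<longlongrightarrow> B * norm (\<beta> - \<beta>)) (at \<beta> within S)" by (intro tendsto_intros)
    then have "((\<lambda>z. B * norm (z - \<beta>)) \<longlongrightarrow> 0) (at \<beta> within S)" by simp
    moreover have "\<forall>\<^sub>F z in at \<beta> within S. norm (f z * (z - \<beta>)) \<le> B * norm (z - \<beta>)"
      using assms(2) by (auto simp: eventually_at_filter norm_mult intro!: always_eventually mult_right_mono)
    ultimately show ?thesis
      using True Lim_null_comparison by fastforce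
  next
    case False
    have "at z within S = at z within (S - {\<beta>})"
      by (rule at_within_nhd[of z "- {\<beta>}"]) (use False in auto)
    then have "(f \<longlongrightarrow> f z) (at z within S)"
      using assms(1) \<open>z \<in> S\<close> False by (simp add: continuous_on_def)
    then show ?thesis by (intro tendsto_intros)
  qed
qed

text \<open>Multiplying a high power of \<^term>\<open>f\<close> by \<^term>\<open>z - \<beta>\<close> restores continuity at the exceptional point.\<close>

lemma maximum_modulus_except_point:
  fixes f :: "complex \<Rightarrow> complex"
  assumes W: "open W" "bounded W" "\<beta> \<notin> W" "w \<in> W"
    and f: "f holomorphic_on W" "continuous_on (closure W - {\<beta>}) f"
      "\<And>z. z \<in> closure W \<Longrightarrow> z \<noteq> \<beta> \<Longrightarrow> norm (f z) \<le> B"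
      "\<And>z. z \<in> frontier W \<Longrightarrow> z \<noteq> \<beta> \<Longrightarrow> norm (f z) \<le> 1"
  shows "norm (f w) \<le> 1"
proof (rule ccontr)
  assume "\<not> norm (f w) \<le> 1"
  have "bounded ((\<lambda>z. z - \<beta>) ` closure W)"
    using W(2) by (intro bounded_translation_minus bounded_closure)
  then obtain R where R: "R > 0" "\<And>z. z \<in> closure W \<Longrightarrow> norm (z - \<beta>) \<le> R"
    unfolding bounded_pos by auto
  have "norm (f w) ^ n * norm (w - \<beta>) \<le> R" for n
  proof -
    define K where "K z = f z ^ n * (z - \<beta>)" for z
    have "norm (K w) \<le> R"
    proof (rule maximum_modulus_frontier[of K W])
      show "K holomorphic_on interior W"
        unfolding K_def using f(1) W(1) by (auto simp: interior_open intro!: holomorphic_intros)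
      show "continuous_on (closure W) K" unfolding K_def
      proof (rule continuous_on_mult_diff_except_point)
        show "continuous_on (closure W - {\<beta>}) (\<lambda>z. f z ^ n)" by (intro continuous_intros f(2))
        show "norm (f z ^ n) \<le> B ^ n" if "z \<in> closure W" "z \<noteq> \<beta>" for z
          using f(3)[OF that] by (simp add: norm_power power_mono)
      qed
      fix z assume z: "z \<in> frontier W"
      have "norm (f z) ^ n * norm (z - \<beta>) \<le> 1 * R" if "z \<noteq> \<beta>"
        using f(4)[OF z that] R(2)[of z] z by (intro mult_mono power_le_one) (auto simp: frontier_def)
      then show "norm (K z) \<le> R" using R(1) by (cases "z = \<beta>") (auto simp: K_def norm_mult norm_power)
    qed (use W in auto)
    then show ?thesis by (simp add: K_def norm_mult norm_power)
  qed
  moreover obtain n where "R / norm (w - \<beta>) < norm (f w) ^ n"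
    using real_arch_pow[of "norm (f w)"] \<open>\<not> norm (f w) \<le> 1\<close> by auto
  moreover have "norm (w - \<beta>) > 0" using W(3,4) by auto
  ultimately show False by (metis pos_divide_less_eq not_less)
qed

lemma Re_one_minus_cnj_mult:
  assumes "norm \<beta> = 1"
  shows "2 * Re (1 - cnj \<beta> * z) = (dist z \<beta>)\<^sup>2 + (1 - (norm z)\<^sup>2)"
proof -
  have "(dist z \<beta>)\<^sup>2 = (norm z)\<^sup>2 + (norm \<beta>)\<^sup>2 - 2 * Re (cnj \<beta> * z)"
    unfolding dist_norm cmod_power2 by (simp add: power2_eq_square algebra_simps)
  then show ?thesis using assms by simp
qed

lemma norm_one_minus_cnj_mult:
  assumes "norm \<beta> = 1"
  shows "norm (1 - cnj \<beta> * z) = dist z \<beta>"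
proof -
  have "1 - cnj \<beta> * z = cnj \<beta> * (\<beta> - z)"
    using assms complex_norm_square[of \<beta>] by (simp add: algebra_simps)
  then show ?thesis using assms by (simp add: norm_mult dist_norm norm_minus_commute)
qed

text \<open>
  The linear function \<^term>\<open>2 * Re (1 - cnj \<beta> * z) / \<delta>\<^sup>2\<close> takes the place of the harmonic measure of the part
  of the disc at distance \<^term>\<open>\<delta>\<close> from \<^term>\<open>\<beta>\<close>.
\<close>

lemma Lindelof_barrier:
  fixes \<beta> z :: complex and \<delta> \<epsilon> :: real
  assumes \<beta>: "norm \<beta> = 1" and \<epsilon>: "0 < \<epsilon>" "\<epsilon> \<le> 1" and z: "z \<in> ball 0 1"
  defines "v \<equiv> 2 * Re (1 - cnj \<beta> * z) / \<delta>\<^sup>2"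
  shows "exp (- ln \<epsilon> * (1 - v)) \<le> exp (- ln \<epsilon>)"
    and "\<delta> > 0 \<Longrightarrow> dist z \<beta> = \<delta> \<Longrightarrow> exp (- ln \<epsilon> * (1 - v)) \<le> 1"
proof -
  have "0 \<le> v"
    using z unfolding v_def Re_one_minus_cnj_mult[OF \<beta>] by (simp add: power_le_one)
  then have "v * ln \<epsilon> \<le> 0" using \<epsilon> by (simp add: mult_nonneg_nonpos)
  then show "exp (- ln \<epsilon> * (1 - v)) \<le> exp (- ln \<epsilon>)" by (simp add: algebra_simps)
  show "exp (- ln \<epsilon> * (1 - v)) \<le> 1" if "\<delta> > 0" "dist z \<beta> = \<delta>"
  proof -
    have "v \<ge> 1" using z that unfolding v_def Re_one_minus_cnj_mult[OF \<beta>] by (simp add: power_le_one)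
    then show ?thesis using \<epsilon> by (simp add: mult_nonneg_nonpos mult_nonpos_nonpos)
  qed
qed

lemma le_sqrt_of_mult_exp_le:
  fixes \<epsilon> g v :: real
  assumes \<epsilon>: "0 < \<epsilon>" "\<epsilon> \<le> 1" and g: "0 \<le> g" "g * exp (- ln \<epsilon> * (1 - v)) \<le> 1" and v: "v \<le> 1/2"
  shows "g \<le> sqrt \<epsilon>"
proof -
  have "exp (- ln \<epsilon> / 2) \<le> exp (- ln \<epsilon> * (1 - v))"
    using \<epsilon> v mult_left_mono[of "1/2" "1 - v" "- ln \<epsilon>"] by simp
  then have "g * exp (- ln \<epsilon> / 2) \<le> 1"
    using g by (meson mult_left_mono order_trans)
  moreover have "sqrt \<epsilon> = exp (ln \<epsilon> / 2)"
    using powr_half_sqrt[of \<epsilon>] \<epsilon>(1) by (simp add: powr_def)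
  ultimately show ?thesis by (simp add: exp_minus field_simps)
qed

lemma Lindelof_estimate:
  fixes h :: "complex \<Rightarrow> complex"
  assumes W: "open W" "W \<subseteq> ball 0 1" "closure W \<subseteq> insert \<beta> (ball 0 1)" "x \<in> W" "dist x \<beta> \<le> \<delta>\<^sup>2 / 4"
    and \<beta>: "norm \<beta> = 1" and \<delta>: "\<delta> > 0" and \<epsilon>: "0 < \<epsilon>" "\<epsilon> \<le> 1"
    and h: "h holomorphic_on ball 0 1" "\<And>z. z \<in> ball 0 1 \<Longrightarrow> norm (h z) \<le> 1"
      "\<And>z. z \<in> frontier W \<Longrightarrow> z \<noteq> \<beta> \<Longrightarrow> dist z \<beta> = \<delta> \<or> norm (h z) \<le> \<epsilon>"
  shows "norm (h x) \<le> sqrt \<epsilon>"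
proof -
  define v where "v z = 2 * Re (1 - cnj \<beta> * z) / \<delta>\<^sup>2" for z
  define k where "k z = h z * exp (- of_real (ln \<epsilon>) * (1 - of_real (2 / \<delta>\<^sup>2) * (1 - cnj \<beta> * z)))" for z
  have norm_k: "norm (k z) = norm (h z) * exp (- ln \<epsilon> * (1 - v z))" for z
    by (simp add: k_def v_def norm_mult algebra_simps)
  note barrier = Lindelof_barrier[OF \<beta> \<epsilon>, of _ \<delta>, folded v_def]
  have "norm (k x) \<le> 1"
  proof (rule maximum_modulus_except_point[of W \<beta> x k "exp (- ln \<epsilon>)"])
    have hol_k: "k holomorphic_on ball 0 1" unfolding k_def by (intro holomorphic_intros h(1))
    then show "k holomorphic_on W" using W(2) holomorphic_on_subset by blast
    show "continuous_on (closure W - {\<beta>}) k"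
      using W(3) by (intro continuous_on_subset[OF holomorphic_on_imp_continuous_on[OF hol_k]]) auto
    show "norm (k z) \<le> exp (- ln \<epsilon>)" if "z \<in> closure W" "z \<noteq> \<beta>" for z
    proof -
      have "z \<in> ball 0 1" using that W(3) by blast
      then have "norm (k z) \<le> 1 * exp (- ln \<epsilon>)"
        unfolding norm_k using h(2) barrier(1) by (intro mult_mono) auto
      then show ?thesis by simp
    qed
    show "norm (k z) \<le> 1" if z: "z \<in> frontier W" "z \<noteq> \<beta>" for z
    proof -
      have z_ball: "z \<in> ball 0 1" using z W(3) by (auto simp: frontier_def)
      from h(3)[OF z] show ?thesis
      proof
        assume "dist z \<beta> = \<delta>"
        then show ?thesis
          unfolding norm_k using h(2)[OF z_ball] barrier(2)[OF z_ball \<delta>] by (intro mult_le_one) auto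
      next
        assume "norm (h z) \<le> \<epsilon>"
        then have "norm (k z) \<le> \<epsilon> * exp (- ln \<epsilon>)"
          unfolding norm_k using barrier(1)[OF z_ball] \<epsilon> by (intro mult_mono) auto
        then show ?thesis using \<epsilon> by (simp add: exp_minus)
      qed
    qed
    show "bounded W" using W(2) bounded_ball bounded_subset by blast
  qed (use W \<beta> in auto)
  moreover have "v x \<le> 1/2"
    using complex_Re_le_cmod[of "1 - cnj \<beta> * x"] W(5) \<delta> unfolding v_def norm_one_minus_cnj_mult[OF \<beta>]
    by (simp add: field_simps)
  ultimately show ?thesis
    unfolding norm_k by (intro le_sqrt_of_mult_exp_le[OF \<epsilon>]) auto
qed

lemma Lindelof_inside_estimate:
  fixes h :: "complex \<Rightarrow> complex"
  assumes c: "simple_path c" "pathfinish c = pathstart c" "path_image c \<subseteq> insert \<beta> (ball 0 1)"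
    and \<beta>: "norm \<beta> = 1"
    and \<epsilon>: "0 < \<epsilon>" "\<epsilon> \<le> 1" and \<delta>: "\<delta> > 0"
    and h: "h holomorphic_on ball 0 1" "\<And>z. z \<in> ball 0 1 \<Longrightarrow> norm (h z) \<le> 1"
      "\<And>z. z \<in> path_image c \<Longrightarrow> z \<noteq> \<beta> \<Longrightarrow> dist z \<beta> < \<delta> \<Longrightarrow> norm (h z) \<le> \<epsilon>"
    and x: "x \<in> inside (path_image c)" "dist x \<beta> < \<delta>" "dist x \<beta> \<le> \<delta>\<^sup>2 / 4"
  shows "norm (h x) \<le> sqrt \<epsilon>"
proof -
  define V where "V = inside (path_image c)"
  define W where "W = V \<inter> ball \<beta> \<delta>"
  have V_ball: "V \<subseteq> ball 0 1"
    unfolding V_def using c(3) \<beta> by (intro simple_loop_inside_subset_ball[OF c(1)]) (auto simp: subset_iff)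
  have "W \<subseteq> V" "W \<subseteq> cball \<beta> \<delta>" by (auto simp: W_def)
  then have "closure W \<subseteq> closure V" "closure W \<subseteq> cball \<beta> \<delta>"
    by (simp_all add: closure_mono closure_minimal)
  then have W: "open W" "closure W \<subseteq> (V \<union> path_image c) \<inter> cball \<beta> \<delta>"
    using Jordan_inside_outside[OF c(1,2)] closure_inside_simple_loop[OF c(1,2)] by (auto simp: W_def V_def)
  show ?thesis
  proof (rule Lindelof_estimate[where h = h and W = W and \<beta> = \<beta> and \<delta> = \<delta>])
    fix z assume z: "z \<in> frontier W" "z \<noteq> \<beta>"
    then have "z \<in> closure W" "z \<notin> W" using W(1) by (auto simp: frontier_def interior_open)
    then have "z \<in> V \<union> path_image c" "dist z \<beta> \<le> \<delta>" "z \<notin> V \<or> \<not> dist z \<beta> < \<delta>"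
      using W(2) by (auto simp: W_def dist_commute)
    then show "dist z \<beta> = \<delta> \<or> norm (h z) \<le> \<epsilon>"
      using h(3)[of z] z(2) by (cases "dist z \<beta> < \<delta>") auto
  qed (use V_ball W c(3) x \<beta> \<delta> \<epsilon> h(1,2) in \<open>auto simp: W_def V_def dist_commute\<close>)
qed

theorem Lindelof_inside:
  fixes h :: "complex \<Rightarrow> complex"
  assumes c: "simple_path c" "pathfinish c = pathstart c" "path_image c \<subseteq> insert \<beta> (ball 0 1)"
    and \<beta>: "norm \<beta> = 1"
    and h: "h holomorphic_on ball 0 1" "bounded (h ` ball 0 1)" "(h \<longlongrightarrow> q) (at \<beta> within path_image c)"
  shows "(h \<longlongrightarrow> q) (at \<beta> within inside (path_image c))"
  unfolding Lim_within
proof (intro allI impI)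
  fix e :: real assume "e > 0"
  have "bounded ((\<lambda>z. z - q) ` h ` ball 0 1)" by (intro bounded_translation_minus h(2))
  then obtain N where N: "N > 0" "\<And>z. z \<in> ball 0 1 \<Longrightarrow> norm (h z - q) \<le> N"
    unfolding bounded_pos by auto
  define \<epsilon> where "\<epsilon> = min 1 ((e / (2 * N))\<^sup>2)"
  have \<epsilon>: "0 < \<epsilon>" "\<epsilon> \<le> 1" using \<open>e > 0\<close> N(1) by (auto simp: \<epsilon>_def)
  have "sqrt \<epsilon> \<le> e / (2 * N)"
    using \<open>e > 0\<close> N(1) by (intro real_le_lsqrt) (auto simp: \<epsilon>_def)
  then have sqrt_less: "sqrt \<epsilon> * N < e" using \<open>e > 0\<close> N(1) by (simp add: field_simps)
  obtain \<delta> where \<delta>: "\<delta> > 0" "\<And>z. z \<in> path_image c \<Longrightarrow> z \<noteq> \<beta> \<Longrightarrow> dist z \<beta> < \<delta> \<Longrightarrow> norm (h z - q) \<le> \<epsilon> * N"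
    using h(3)[unfolded Lim_within, rule_format, of "\<epsilon> * N"] \<epsilon>(1) N(1) by (force simp: dist_norm)
  have "dist (h x) q < e" if x: "x \<in> inside (path_image c)" "dist x \<beta> < min \<delta> (\<delta>\<^sup>2 / 4)" for x
  proof -
    have "norm ((h x - q) / N) \<le> sqrt \<epsilon>"
    proof (rule Lindelof_inside_estimate[where h = "\<lambda>z. (h z - q) / N", OF c \<beta> \<epsilon> \<delta>(1)])
      show "(\<lambda>z. (h z - q) / N) holomorphic_on ball 0 1"
        using N(1) by (intro holomorphic_intros h(1)) auto
    qed (use N \<delta>(2) x in \<open>auto simp: norm_divide divide_le_eq\<close>)
    then have "norm (h x - q) \<le> sqrt \<epsilon> * N" using N(1) by (simp add: norm_divide divide_le_eq)
    then show ?thesis using sqrt_less by (simp add: dist_norm)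
  qed
  then show "\<exists>d>0. \<forall>x\<in>inside (path_image c). 0 < dist x \<beta> \<and> dist x \<beta> < d \<longrightarrow> dist (h x) q < e"
    using \<delta>(1) by (intro exI[of _ "min \<delta> (\<delta>\<^sup>2 / 4)"]) auto
qed

section \<open>The Cayley transform and radial limits\<close>

abbreviation right_half_plane :: "complex set" where
  "right_half_plane \<equiv> {y. 0 < Re y}"

definition cayley :: "complex \<Rightarrow> complex \<Rightarrow> complex" where
  "cayley \<beta> z = (\<beta> + z) / (\<beta> - z)"

definition inverse_cayley :: "complex \<Rightarrow> complex \<Rightarrow> complex" where
  "inverse_cayley \<beta> y = \<beta> * (y - 1) / (y + 1)"

lemma inverse_cayley_cayley:
  assumes "\<beta> \<noteq> 0" "z \<noteq> \<beta>"
  shows "inverse_cayley \<beta> (cayley \<beta> z) = z"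
proof -
  have "\<beta> - z \<noteq> 0" using assms by auto
  then have "cayley \<beta> z - 1 = 2 * z / (\<beta> - z)" "cayley \<beta> z + 1 = 2 * \<beta> / (\<beta> - z)"
    by (auto simp: cayley_def field_simps)
  then show ?thesis using assms \<open>\<beta> - z \<noteq> 0\<close> by (simp add: inverse_cayley_def)
qed

lemma cayley_inverse_cayley:
  assumes "\<beta> \<noteq> 0" "y \<noteq> - 1"
  shows "cayley \<beta> (inverse_cayley \<beta> y) = y"
proof -
  have "y + 1 \<noteq> 0" using assms by (simp add: add_eq_0_iff2)
  then have "\<beta> + inverse_cayley \<beta> y = 2 * \<beta> * y / (y + 1)" "\<beta> - inverse_cayley \<beta> y = 2 * \<beta> / (y + 1)"
    by (auto simp: inverse_cayley_def field_simps)
  then show ?thesis using assms \<open>y + 1 \<noteq> 0\<close> by (simp add: cayley_def)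
qed

lemma Re_cayley:
  assumes "norm \<beta> = 1"
  shows "Re (cayley \<beta> z) = (1 - (norm z)\<^sup>2) / (dist z \<beta>)\<^sup>2"
proof -
  have "cayley \<beta> z = (\<beta> + z) * cnj (\<beta> - z) / of_real ((dist z \<beta>)\<^sup>2)"
    unfolding cayley_def dist_norm norm_minus_commute[of z] by (metis complex_div_cnj of_real_power)
  then have "Re (cayley \<beta> z) = Re ((\<beta> + z) * cnj (\<beta> - z)) / (dist z \<beta>)\<^sup>2"
    by (simp only: Re_divide_of_real)
  also have "Re ((\<beta> + z) * cnj (\<beta> - z)) = (norm \<beta>)\<^sup>2 - (norm z)\<^sup>2"
    unfolding cmod_power2 by (simp add: power2_eq_square algebra_simps)
  finally show ?thesis using assms by simp
qed

lemma Re_cayley_pos: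
  assumes "norm \<beta> = 1" "z \<in> ball 0 1"
  shows "Re (cayley \<beta> z) > 0"
  using assms unfolding Re_cayley[OF assms(1)] by (intro divide_pos_pos) (auto simp: power_less_one_iff)

lemma inverse_cayley_in_ball:
  assumes "norm \<beta> = 1" "Re y > 0"
  shows "inverse_cayley \<beta> y \<in> ball 0 1"
proof -
  have "(norm (y - 1))\<^sup>2 < (norm (y + 1))\<^sup>2"
    using assms(2) unfolding cmod_power2 by (simp add: power2_eq_square algebra_simps)
  then have "norm (y - 1) < norm (y + 1)" by (rule power2_less_imp_less) simp
  moreover from this have "0 < norm (y + 1)" by (rule order_le_less_trans[OF norm_ge_zero])
  ultimately show ?thesis
    using assms(1) by (simp add: inverse_cayley_def norm_divide norm_mult)
qed

lemma holomorphic_on_cayley: "\<beta> \<notin> S \<Longrightarrow> cayley \<beta> holomorphic_on S"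
  unfolding cayley_def by (intro holomorphic_intros) auto

lemma holomorphic_on_inverse_cayley: "- 1 \<notin> S \<Longrightarrow> inverse_cayley \<beta> holomorphic_on S"
  unfolding inverse_cayley_def by (intro holomorphic_intros) (auto simp: add_eq_0_iff2)

lemma cayley_tendsto_infinity:
  assumes "\<beta> \<noteq> 0"
  shows "filterlim (cayley \<beta>) at_infinity (at \<beta>)"
  unfolding cayley_def[abs_def]
proof (rule filterlim_divide_at_infinity)
  show "((\<lambda>z. \<beta> + z) \<longlongrightarrow> \<beta> + \<beta>) (at \<beta>)" by (intro tendsto_intros)
  have "((\<lambda>z. \<beta> - z) \<longlongrightarrow> \<beta> - \<beta>) (at \<beta>)" by (intro tendsto_intros)
  then show "filterlim (\<lambda>z. \<beta> - z) (at 0) (at \<beta>)"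
    by (auto simp: filterlim_at eventually_at_filter)
qed (use assms in simp)

lemma inverse_cayley_tendsto_infinity: "(inverse_cayley \<beta> \<longlongrightarrow> \<beta>) at_infinity"
proof -
  have "((\<lambda>y. \<beta> - 2 * \<beta> / (y + 1)) \<longlongrightarrow> \<beta> - 0) at_infinity"
    by (intro tendsto_intros tendsto_divide_0[OF tendsto_const]
        tendsto_add_filterlim_at_infinity'[OF _ tendsto_const] filterlim_ident)
  moreover have "\<forall>\<^sub>F y in at_infinity. \<beta> - 2 * \<beta> / (y + 1) = inverse_cayley \<beta> y"
  proof -
    have "\<beta> - 2 * \<beta> / (y + 1) = inverse_cayley \<beta> y" if "y \<noteq> - 1" for y
    proof -
      have "y + 1 \<noteq> 0" using that by (simp add: add_eq_0_iff2)
      then show ?thesis by (simp add: inverse_cayley_def field_simps)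
    qed
    then show ?thesis
      by (rule eventually_mono[OF eventually_not_equal_at_infinity])
  qed
  ultimately show ?thesis using Lim_transform_eventually by fastforce
qed

lemma Lindelof_strip:
  fixes F :: "complex \<Rightarrow> complex" and l :: "real \<Rightarrow> complex"
  assumes F: "F holomorphic_on {z. \<bar>Im z\<bar> < w}" "bounded (F ` {z. \<bar>Im z\<bar> < w})"
    and l: "continuous_on {a<..<b} l" "a < b" "\<And>t. a < t \<Longrightarrow> t < b \<Longrightarrow> \<bar>Im (l t)\<bar> < w"
      "filterlim (\<lambda>t. Re (l t)) at_top (at_left b)" "((\<lambda>t. F (l t)) \<longlongrightarrow> q) (at_left b)"
  shows "((\<lambda>x::real. F (of_real x)) \<longlongrightarrow> q) at_top"
proof (rule tendstoI)
  fix \<eta> :: real assume "\<eta> > 0"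
  have "bounded ((\<lambda>z. z - q) ` F ` {z. \<bar>Im z\<bar> < w})" by (intro bounded_translation_minus F(2))
  then obtain N where N: "N > 0" "\<And>z. \<bar>Im z\<bar> < w \<Longrightarrow> norm (F z - q) \<le> N"
    unfolding bounded_pos by auto
  define \<epsilon> where "\<epsilon> = min 1 ((\<eta> / (2 * N)) powr (8/3))"
  have \<epsilon>: "0 < \<epsilon>" "\<epsilon> \<le> 1" "\<epsilon> powr (3/8) \<le> \<eta> / (2 * N)"
    using \<open>\<eta> > 0\<close> N(1) powr_mono2[of "3/8" \<epsilon> "(\<eta> / (2 * N)) powr (8/3)"] by (auto simp: \<epsilon>_def powr_powr)
  obtain t0 where t0: "t0 < b" "\<And>t. t0 < t \<Longrightarrow> t < b \<Longrightarrow> norm (F (l t) - q) < \<epsilon> * N"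
    using tendstoD[OF l(5), of "\<epsilon> * N"] \<epsilon>(1) N(1) unfolding eventually_at_left_field dist_norm by auto
  obtain t1 where t1: "max a t0 < t1" "t1 < b" using dense[of "max a t0" b] l(2) t0(1) by auto
  have "dist (F (of_real x)) q < \<eta>" if x: "Re (l t1) + 2 * w \<le> x" for x
  proof -
    obtain t2 where t2: "t1 < t2" "t2 < b" "x + 2 * w \<le> Re (l t2)"
    proof -
      obtain t3 where "t3 < b" "\<And>t. t3 < t \<Longrightarrow> t < b \<Longrightarrow> x + 2 * w \<le> Re (l t)"
        using l(4) unfolding filterlim_at_top eventually_at_left_field by blast
      moreover obtain t2 where "max t1 t3 < t2" "t2 < b" using dense[of "max t1 t3" b] \<open>t3 < b\<close> t1 by auto
      ultimately show thesis using that by auto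
    qed
    have "norm ((F (of_real x) - q) / N) \<le> \<epsilon> powr (3/8)"
    proof (rule two_constants_strip[of "\<lambda>z. (F z - q) / N" w "l \<circ> linepath t1 t2"])
      show "(\<lambda>z. (F z - q) / N) holomorphic_on {z. \<bar>Im z\<bar> < w}"
        using N(1) by (intro holomorphic_intros F(1)) auto
      show "path (l \<circ> linepath t1 t2)"
        using t1 t2(1,2) by (intro path_continuous_image continuous_on_subset[OF l(1)])
          (auto simp: closed_segment_eq_real_ivl)
    qed (use t0 t1 t2 N x \<epsilon> l(3) in \<open>auto simp: path_image_compose pathstart_compose pathfinish_compose
        closed_segment_eq_real_ivl norm_divide divide_le_eq less_imp_le\<close>)
    also note \<epsilon>(3)
    finally have "2 * norm (F (of_real x) - q) \<le> \<eta>" using N(1) by (simp add: norm_divide field_simps)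
    then show ?thesis using \<open>\<eta> > 0\<close> by (simp add: dist_norm)
  qed
  then show "\<forall>\<^sub>F x in at_top. dist (F (of_real x)) q < \<eta>"
    by (rule eventually_mono[OF eventually_ge_at_top])
qed

definition strip_to_disc :: "complex \<Rightarrow> complex \<Rightarrow> complex" where
  "strip_to_disc \<alpha> z = inverse_cayley \<alpha> (exp z)"

lemma Re_exp_pos: "\<bar>Im z\<bar> < pi / 2 \<Longrightarrow> 0 < Re (exp z)"
  by (simp add: Re_exp cos_gt_zero_pi abs_less_iff)

lemma strip_to_disc_in_ball:
  assumes "norm \<alpha> = 1" "\<bar>Im z\<bar> < pi / 2"
  shows "strip_to_disc \<alpha> z \<in> ball 0 1"
  unfolding strip_to_disc_def by (intro inverse_cayley_in_ball Re_exp_pos assms)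

lemma holomorphic_on_strip_to_disc: "strip_to_disc \<alpha> holomorphic_on {z. \<bar>Im z\<bar> < pi / 2}"
proof -
  have "inverse_cayley \<alpha> holomorphic_on right_half_plane"
    by (rule holomorphic_on_inverse_cayley) simp
  then show ?thesis
    unfolding strip_to_disc_def[abs_def]
    by (rule holomorphic_on_compose_gen[OF holomorphic_on_exp, unfolded o_def]) (auto simp: Re_exp_pos)
qed

lemma strip_to_disc_Ln_cayley:
  assumes "norm \<alpha> = 1" "z \<in> ball 0 1"
  shows "strip_to_disc \<alpha> (Ln (cayley \<alpha> z)) = z"
proof -
  have "cayley \<alpha> z \<noteq> 0" using Re_cayley_pos[OF assms] by auto
  moreover have "\<alpha> \<noteq> 0" "z \<noteq> \<alpha>" using assms by auto
  ultimately show ?thesis by (simp add: strip_to_disc_def inverse_cayley_cayley)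
qed

lemma cayley_radius:
  assumes "\<alpha> \<noteq> 0"
  shows "cayley \<alpha> (of_real r * \<alpha>) = of_real ((1 + r) / (1 - r))"
proof -
  have "cayley \<alpha> (of_real r * \<alpha>) = (\<alpha> * (1 + of_real r)) / (\<alpha> * (1 - of_real r))"
    by (simp add: cayley_def algebra_simps)
  then show ?thesis using assms by simp
qed

lemma strip_to_disc_radius:
  assumes \<alpha>: "norm \<alpha> = 1" and r: "\<bar>r\<bar> < 1"
  shows "strip_to_disc \<alpha> (of_real (ln ((1 + r) / (1 - r)))) = of_real r * \<alpha>"
proof -
  have "\<alpha> \<noteq> 0" using \<alpha> by auto
  have "of_real r * \<alpha> \<in> ball 0 1" using \<alpha> r by (simp add: norm_mult)
  moreover have "Ln (cayley \<alpha> (of_real r * \<alpha>)) = of_real (ln ((1 + r) / (1 - r)))"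
    unfolding cayley_radius[OF \<open>\<alpha> \<noteq> 0\<close>] using r by (intro Ln_of_real divide_pos_pos) auto
  ultimately show ?thesis using strip_to_disc_Ln_cayley[OF \<alpha>] by metis
qed

lemma filterlim_Re_Ln_cayley:
  assumes "norm \<alpha> = 1"
  shows "filterlim (\<lambda>z. Re (Ln (cayley \<alpha> z))) at_top (at \<alpha> within ball (0::complex) 1)"
proof -
  have "\<alpha> \<noteq> 0" using assms by auto
  then have "filterlim (\<lambda>z. norm (cayley \<alpha> z)) at_top (at \<alpha> within ball (0::complex) 1)"
    using filterlim_mono[OF cayley_tendsto_infinity order_refl at_le[OF subset_UNIV]]
      filterlim_at_infinity_imp_norm_at_top by blast
  then have "filterlim (\<lambda>z. ln (norm (cayley \<alpha> z))) at_top (at \<alpha> within ball 0 1)"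
    by (rule filterlim_compose[OF ln_at_top])
  moreover have "\<forall>\<^sub>F z in at \<alpha> within ball 0 1. ln (norm (cayley \<alpha> z)) = Re (Ln (cayley \<alpha> z))"
    unfolding eventually_at_filter
  proof (intro always_eventually allI impI)
    fix z :: complex assume "z \<in> ball 0 1"
    then have "cayley \<alpha> z \<noteq> 0" using Re_cayley_pos[OF assms] by force
    then show "ln (norm (cayley \<alpha> z)) = Re (Ln (cayley \<alpha> z))" by simp
  qed
  ultimately show ?thesis by (simp add: filterlim_cong)
qed

theorem Lindelof_radial:
  fixes f :: "complex \<Rightarrow> complex" and c :: "real \<Rightarrow> complex"
  assumes f: "f holomorphic_on ball 0 1" "bounded (f ` ball 0 1)" and \<alpha>: "norm \<alpha> = 1"
    and c: "continuous_on {a<..<b} c" "a < b" "\<And>t. a < t \<Longrightarrow> t < b \<Longrightarrow> c t \<in> ball 0 1"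
      "(c \<longlongrightarrow> \<alpha>) (at_left b)" "((\<lambda>t. f (c t)) \<longlongrightarrow> q) (at_left b)"
  shows "((\<lambda>r::real. f (of_real r * \<alpha>)) \<longlongrightarrow> q) (at_left 1)"
proof -
  define l where "l t = Ln (cayley \<alpha> (c t))" for t
  have \<alpha>_notin: "\<alpha> \<notin> ball 0 1" using \<alpha> by auto
  have Re_pos: "0 < Re (cayley \<alpha> (c t))" if "a < t" "t < b" for t
    using Re_cayley_pos[OF \<alpha> c(3)] that by simp
  have near_b: "\<forall>\<^sub>F t in at_left b. a < t \<and> t < b"
    unfolding eventually_at_left_field using c(2) by blast
  have "((\<lambda>x::real. f (strip_to_disc \<alpha> (of_real x))) \<longlongrightarrow> q) at_top"
  proof (rule Lindelof_strip[of _ "pi / 2" a b l])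
    show "(\<lambda>z. f (strip_to_disc \<alpha> z)) holomorphic_on {z. \<bar>Im z\<bar> < pi / 2}"
      by (rule holomorphic_on_compose_gen[OF holomorphic_on_strip_to_disc f(1), unfolded o_def])
        (use strip_to_disc_in_ball[OF \<alpha>] in auto)
    show "bounded ((\<lambda>z. f (strip_to_disc \<alpha> z)) ` {z. \<bar>Im z\<bar> < pi / 2})"
      by (rule bounded_subset[OF f(2)]) (use strip_to_disc_in_ball[OF \<alpha>] in auto)
    have "continuous_on (ball 0 1) (cayley \<alpha>)"
      using \<alpha>_notin by (intro holomorphic_on_imp_continuous_on holomorphic_on_cayley)
    then have "continuous_on {a<..<b} (\<lambda>t. cayley \<alpha> (c t))"
      by (rule continuous_on_compose2[OF _ c(1)]) (use c(3) in auto)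
    then show "continuous_on {a<..<b} l"
      unfolding l_def using Re_pos by (intro continuous_intros) (simp_all add: complex_nonpos_Reals_iff not_le)
    show "\<bar>Im (l t)\<bar> < pi / 2" if "a < t" "t < b" for t
      unfolding l_def using Re_pos[OF that] by (subst Re_Ln_pos_lt) auto
    have "filterlim c (at \<alpha> within ball 0 1) (at_left b)"
      unfolding filterlim_at using c(4) near_b by (auto elim!: eventually_mono) (use c(3) \<alpha> in force)+
    then show "filterlim (\<lambda>t. Re (l t)) at_top (at_left b)"
      unfolding l_def by (rule filterlim_compose[OF filterlim_Re_Ln_cayley[OF \<alpha>]])
    show "((\<lambda>t. f (strip_to_disc \<alpha> (l t))) \<longlongrightarrow> q) (at_left b)"
      by (rule Lim_transform_eventually[OF c(5) eventually_mono[OF near_b]])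
        (use c(3) strip_to_disc_Ln_cayley[OF \<alpha>] in \<open>simp add: l_def\<close>)
  qed (rule c(2))
  moreover have "filterlim (\<lambda>r::real. ln ((1 + r) / (1 - r))) at_top (at_left 1)" by real_asymp
  ultimately have "((\<lambda>r. f (strip_to_disc \<alpha> (of_real (ln ((1 + r) / (1 - r)))))) \<longlongrightarrow> q) (at_left 1)"
    by (rule filterlim_compose)
  moreover have "\<forall>\<^sub>F r in at_left (1::real). f (strip_to_disc \<alpha> (of_real (ln ((1 + r) / (1 - r))))) = f (of_real r * \<alpha>)"
    unfolding eventually_at_left_field using strip_to_disc_radius[OF \<alpha>] by (intro exI[of _ 0]) auto
  ultimately show ?thesis by (rule Lim_transform_eventually)
qed

lemma Lindelof_radial_at_right:
  fixes f :: "complex \<Rightarrow> complex" and c :: "real \<Rightarrow> complex"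
  assumes f: "f holomorphic_on ball 0 1" "bounded (f ` ball 0 1)" and \<alpha>: "norm \<alpha> = 1"
    and c: "continuous_on {a<..<b} c" "a < b" "\<And>t. a < t \<Longrightarrow> t < b \<Longrightarrow> c t \<in> ball 0 1"
      "(c \<longlongrightarrow> \<alpha>) (at_right a)" "((\<lambda>t. f (c t)) \<longlongrightarrow> q) (at_right a)"
  shows "((\<lambda>r::real. f (of_real r * \<alpha>)) \<longlongrightarrow> q) (at_left 1)"
proof (rule Lindelof_radial[OF f \<alpha>, of "- b" "- a" "\<lambda>t. c (- t)"])
  show "continuous_on {- b<..<- a} (\<lambda>t. c (- t))"
    by (rule continuous_on_compose2[OF c(1)]) (auto intro!: continuous_intros)
qed (use c in \<open>auto simp: filterlim_at_left_to_right\<close>)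

section \<open>Simple closed curves and completions of open arcs\<close>

definition periodic_simple_curve :: "(real \<Rightarrow> 'a::topological_space) \<Rightarrow> bool" where
  "periodic_simple_curve e \<longleftrightarrow> continuous_on UNIV e \<and> (\<forall>s t. e s = e t \<longleftrightarrow> s - t \<in> \<int>)"

lemma circlepath_eq_iff: "circlepath 0 1 s = circlepath 0 1 t \<longleftrightarrow> s - t \<in> \<int>"
proof -
  have "circlepath 0 1 s = circlepath 0 1 t \<longleftrightarrow> (\<exists>n::int. 2 * pi * s = 2 * pi * t + 2 * (of_int n * pi))"
    unfolding circlepath add_left_cancel of_real_1 mult_1 exp_eq by (simp add: complex_eq_iff mult.assoc)
  also have "\<dots> \<longleftrightarrow> (\<exists>n::int. (2 * pi) * s = (2 * pi) * (t + of_int n))" by (simp add: algebra_simps)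
  also have "\<dots> \<longleftrightarrow> (\<exists>n::int. s = t + of_int n)" by (subst mult_cancel_left) simp
  also have "\<dots> \<longleftrightarrow> s - t \<in> \<int>" by (auto elim!: Ints_cases simp: algebra_simps)
  finally show ?thesis .
qed

lemma simple_loop_periodic_parametrization:
  fixes g :: "real \<Rightarrow> complex"
  assumes "simple_path g" "pathfinish g = pathstart g"
  obtains e where "periodic_simple_curve e" "range e = path_image g"
proof -
  obtain f k where hom: "homeomorphism (path_image g) (sphere (0::complex) 1) f k"
    using homeomorphic_simple_path_image_circle[OF assms, of 1 0] unfolding homeomorphic_def by auto
  define u where "u = circlepath 0 1"
  have cont_u: "continuous_on UNIV u"
    unfolding u_def circlepath by (intro continuous_intros)
  have u_sphere: "u t \<in> sphere 0 1" for t by (simp add: u_def circlepath)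
  have "u ` {0..1} = sphere 0 1" unfolding u_def by (simp flip: path_image_def)
  with u_sphere have range_u: "range u = sphere 0 1" by blast
  show thesis
  proof (rule that[of "k \<circ> u"])
    have "k (u s) = k (u t) \<longleftrightarrow> u s = u t" for s t
      using hom u_sphere unfolding homeomorphism_def by metis
    moreover have "continuous_on UNIV (k \<circ> u)"
      using hom range_u cont_u by (intro continuous_on_compose) (auto simp: homeomorphism_def)
    ultimately show "periodic_simple_curve (k \<circ> u)"
      unfolding periodic_simple_curve_def using circlepath_eq_iff by (simp add: u_def)
    show "range (k \<circ> u) = path_image g"
      using hom range_u by (metis homeomorphism_def image_comp)
  qed
qed

context
  fixes e :: "real \<Rightarrow> 'a::t2_space"
  assumes e: "periodic_simple_curve e"
begin

lemma periodic_simple_curve_continuous: "continuous_on A e"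
  using e by (meson periodic_simple_curve_def continuous_on_subset subset_UNIV)

lemma periodic_simple_curve_eq_iff: "e s = e t \<longleftrightarrow> s - t \<in> \<int>"
  using e by (simp add: periodic_simple_curve_def)

lemma periodic_simple_curve_shift: "e (t + of_int n) = e t"
  by (simp add: periodic_simple_curve_eq_iff)

lemma periodic_simple_curve_factor:
  fixes J :: "real \<Rightarrow> 'b::topological_space"
  assumes J: "continuous_on UNIV J" "\<And>t. J (t + 1) = J t" "\<And>t. F (J t) = e t"
  shows "periodic_simple_curve J"
proof -
  interpret J: periodic_fun_simple' J by standard (rule J(2))
  have "J s = J t \<longleftrightarrow> s - t \<in> \<int>" for s t
  proof
    show "J s = J t \<Longrightarrow> s - t \<in> \<int>" using J(3) periodic_simple_curve_eq_iff by metis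
    assume "s - t \<in> \<int>"
    then obtain n where "s - t = of_int n" by (rule Ints_cases)
    then have "s = t + of_int n" by simp
    then show "J s = J t" by (simp add: J.plus_of_int)
  qed
  then show ?thesis using J(1) by (simp add: periodic_simple_curve_def)
qed

lemma image_periodic_simple_curve: "e ` {0..1} = range e"
proof -
  have "e t = e (frac t)" for t by (simp add: periodic_simple_curve_eq_iff frac_def)
  moreover have "frac t \<in> {0..1}" for t :: real by (simp add: less_imp_le frac_lt_1)
  ultimately show ?thesis by blast
qed

lemma path_image_periodic_simple_curve: "path_image e = range e"
  unfolding path_image_def by (rule image_periodic_simple_curve)

lemma simple_path_periodic_simple_curve: "simple_path e" "pathfinish e = pathstart e"
proof -
  have "x = y \<or> x = 0 \<and> y = 1 \<or> x = 1 \<and> y = 0"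
    if xy: "x \<in> {0..1}" "y \<in> {0..1}" "e x = e y" for x y :: real
  proof -
    obtain n where "x - y = of_int n"
      using xy(3) by (auto simp: periodic_simple_curve_eq_iff elim: Ints_cases)
    moreover from this have "\<bar>of_int n\<bar> \<le> (1::real)" using xy(1,2) by auto
    then have "n = 0 \<or> n = 1 \<or> n = -1" by linarith
    ultimately show ?thesis using xy(1,2) by auto
  qed
  then show "simple_path e"
    unfolding simple_path_def loop_free_def path_def using periodic_simple_curve_continuous by blast
  show "pathfinish e = pathstart e"
    by (simp add: pathfinish_def pathstart_def periodic_simple_curve_eq_iff)
qed

text \<open>
  The complement of the image of an open set is the image of a compact set, namely of the part of one
  period that avoids all translates of the open set.
\<close>

lemma open_map_periodic_simple_curve:
  assumes "open U"
  shows "openin (top_of_set (range e)) (e ` U)"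
proof -
  define V where "V = (\<Union>n::int. (+) (of_int n) ` U)"
  have "open V" unfolding V_def using assms by (intro open_UN ballI open_translation)
  have eU: "e t \<in> e ` U \<longleftrightarrow> t \<in> V" for t
  proof -
    have "e t \<in> e ` U \<longleftrightarrow> (\<exists>u\<in>U. \<exists>n::int. t - u = of_int n)"
      by (auto simp: image_iff periodic_simple_curve_eq_iff Ints_def)
    then show ?thesis by (auto simp: V_def image_iff diff_eq_eq)
  qed
  have "e ` {0..1} - e ` U = e ` ({0..1} - V)"
    by (safe; use eU in blast)
  then have "range e - e ` U = e ` ({0..1} - V)"
    by (simp only: image_periodic_simple_curve)
  moreover have "compact (e ` ({0..1} - V))"
    using \<open>open V\<close> by (intro compact_continuous_image periodic_simple_curve_continuous compact_diff) auto
  ultimately have "closedin (top_of_set (range e)) (range e - e ` U)"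
    by (intro closed_subset) (auto dest: compact_imp_closed)
  then show ?thesis
    by (simp add: openin_closedin_eq image_mono)
qed

end

lemma tendsto_at_within_open_curve:
  fixes s :: "real \<Rightarrow> 'a::heine_borel" and f :: "'a \<Rightarrow> 'b::metric_space"
  assumes s: "continuous_on {a<..<b} s" "\<beta> \<notin> s ` {a<..<b}"
    and lim: "((\<lambda>t. f (s t)) \<longlongrightarrow> q) (at_right a)" "((\<lambda>t. f (s t)) \<longlongrightarrow> q) (at_left b)" and "a < b"
  shows "(f \<longlongrightarrow> q) (at \<beta> within s ` {a<..<b})"
  unfolding Lim_within
proof (intro allI impI)
  fix \<epsilon> :: real assume "\<epsilon> > 0"
  obtain a' where a': "a < a'" "\<And>t. a < t \<Longrightarrow> t < a' \<Longrightarrow> dist (f (s t)) q < \<epsilon>"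
    using tendstoD[OF lim(1) \<open>\<epsilon> > 0\<close>] unfolding eventually_at_right_field by blast
  obtain b' where b': "b' < b" "\<And>t. b' < t \<Longrightarrow> t < b \<Longrightarrow> dist (f (s t)) q < \<epsilon>"
    using tendstoD[OF lim(2) \<open>\<epsilon> > 0\<close>] unfolding eventually_at_left_field by blast
  have "compact (s ` {a'..b'})"
    using a'(1) b'(1) by (intro compact_continuous_image continuous_on_subset[OF s(1)]) auto
  moreover have "\<beta> \<notin> s ` {a'..b'}" using s(2) a'(1) b'(1) by auto
  ultimately obtain d where d: "d > 0" "\<And>x. x \<in> s ` {a'..b'} \<Longrightarrow> d \<le> dist \<beta> x"
    using separate_point_closed compact_imp_closed by metis
  have "dist (f x) q < \<epsilon>" if x: "x \<in> s ` {a<..<b}" "dist x \<beta> < d" for x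
  proof -
    obtain t where t: "a < t" "t < b" "x = s t" using x(1) by auto
    have "t \<notin> {a'..b'}" using d(2)[of x] x(2) t(3) by (auto simp: dist_commute)
    then show ?thesis using a'(2)[of t] b'(2)[of t] t by auto
  qed
  then show "\<exists>d>0. \<forall>x\<in>s ` {a<..<b}. 0 < dist x \<beta> \<and> dist x \<beta> < d \<longrightarrow> dist (f x) q < \<epsilon>"
    using d(1) by blast
qed

lemma continuous_on_Icc_extension:
  fixes s :: "real \<Rightarrow> 'a::topological_space"
  assumes s: "continuous_on {a<..<b} s" and lim: "(s \<longlongrightarrow> \<beta>0) (at_right a)" "(s \<longlongrightarrow> \<beta>1) (at_left b)" and "a < b"
  shows "continuous_on {a..b} (\<lambda>t. if t \<le> a then \<beta>0 else if t \<ge> b then \<beta>1 else s t)" (is "continuous_on _ ?s")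
proof (rule continuous_on_IccI)
  have "continuous_on {a<..<b} ?s" using s by (rule continuous_on_eq) simp
  then show "?s \<midarrow>t\<rightarrow> ?s t" if "a < t" "t < b" for t
    using that by (simp add: continuous_on_eq_continuous_at isCont_def)
  have "\<forall>\<^sub>F t in at_right a. s t = ?s t"
    unfolding eventually_at_right_field using \<open>a < b\<close> by (intro exI[of _ b]) auto
  then show "(?s \<longlongrightarrow> ?s a) (at_right a)" using Lim_transform_eventually[OF lim(1)] by simp
  have "\<forall>\<^sub>F t in at_left b. s t = ?s t"
    unfolding eventually_at_left_field using \<open>a < b\<close> by (intro exI[of _ a]) auto
  then show "(?s \<longlongrightarrow> ?s b) (at_left b)" using Lim_transform_eventually[OF lim(2)] \<open>a < b\<close> by simp
qed (rule \<open>a < b\<close>)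

lemma open_unit_interval_completion:
  fixes s :: "real \<Rightarrow> 'a::real_normed_vector"
  assumes s: "continuous_on {0<..<1} s" "inj_on s {0<..<1}"
    and lim: "(s \<longlongrightarrow> \<beta>0) (at_right 0)" "(s \<longlongrightarrow> \<beta>1) (at_left 1)"
    and out: "\<beta>0 \<notin> s ` {0<..<1}" "\<beta>1 \<notin> s ` {0<..<1}"
  obtains \<gamma> where "path_image \<gamma> = closure (s ` {0<..<1})" "path_image \<gamma> = insert \<beta>0 (insert \<beta>1 (s ` {0<..<1}))"
    "simple_path \<gamma>" "pathstart \<gamma> = \<beta>0" "pathfinish \<gamma> = \<beta>1"
proof -
  define \<gamma> where "\<gamma> t = (if t \<le> 0 then \<beta>0 else if t \<ge> 1 then \<beta>1 else s t)" for t
  have \<gamma>_simps: "\<gamma> 0 = \<beta>0" "\<gamma> 1 = \<beta>1" "\<And>t. t \<in> {0<..<1} \<Longrightarrow> \<gamma> t = s t"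
    by (auto simp: \<gamma>_def)
  have "continuous_on {0..1} \<gamma>"
    unfolding \<gamma>_def by (rule continuous_on_Icc_extension[OF s(1) lim]) simp
  then have path: "path \<gamma>" by (simp add: path_def)
  have interval: "{0..1::real} = insert 0 (insert 1 {0<..<1})" by auto
  have image: "\<gamma> ` {0<..<1} = s ` {0<..<1}" by (auto simp: \<gamma>_simps image_iff)
  then have path_image: "path_image \<gamma> = insert \<beta>0 (insert \<beta>1 (s ` {0<..<1}))"
    unfolding path_image_def interval by (simp add: \<gamma>_simps)
  moreover have "path_image \<gamma> = closure (s ` {0<..<1})"
  proof
    show "closure (s ` {0<..<1}) \<subseteq> path_image \<gamma>"
      using closed_path_image[OF path] path_image by (intro closure_minimal) auto
    have "\<gamma> ` closure {0<..<1} \<subseteq> closure (\<gamma> ` {0<..<1})"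
      using path by (intro image_closure_subset closure_subset) (simp_all add: path_def)
    then show "path_image \<gamma> \<subseteq> closure (s ` {0<..<1})"
      unfolding image by (simp add: path_image_def)
  qed
  moreover have "simple_path \<gamma>"
    unfolding simple_path_def loop_free_def interval
  proof (intro conjI path ballI impI)
    fix x y :: real
    assume "x \<in> insert 0 (insert 1 {0<..<1})" "y \<in> insert 0 (insert 1 {0<..<1})" "\<gamma> x = \<gamma> y"
    moreover have "\<gamma> t \<noteq> \<beta>0" "\<gamma> t \<noteq> \<beta>1" if "t \<in> {0<..<1}" for t
      using out that by (auto simp: \<gamma>_simps)
    moreover have "x = y" if "x \<in> {0<..<1}" "y \<in> {0<..<1}"
      using inj_onD[OF s(2) _ that] \<open>\<gamma> x = \<gamma> y\<close> that by (simp add: \<gamma>_simps)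
    ultimately show "x = y \<or> x = 0 \<and> y = 1 \<or> x = 1 \<and> y = 0"
      using \<gamma>_simps(1,2) by (metis insertE singletonD)
  qed
  ultimately show thesis
    using that[of \<gamma>] \<gamma>_simps by (simp add: pathstart_def pathfinish_def)
qed

lemma open_curve_completion_reparam:
  fixes s :: "real \<Rightarrow> 'a::real_normed_vector" and h :: "real \<Rightarrow> real"
  assumes s: "continuous_on I s" "inj_on s I" "(s \<longlongrightarrow> \<beta>0) F" "(s \<longlongrightarrow> \<beta>1) G" "\<beta>0 \<notin> s ` I" "\<beta>1 \<notin> s ` I"
    and h: "continuous_on {0<..<1} h" "inj_on h {0<..<1}" "h ` {0<..<1} = I"
      "filterlim h F (at_right 0)" "filterlim h G (at_left 1)"
  obtains \<gamma> where "path_image \<gamma> = closure (s ` I)" "path_image \<gamma> = insert \<beta>0 (insert \<beta>1 (s ` I))"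
    "simple_path \<gamma>" "pathstart \<gamma> = \<beta>0" "pathfinish \<gamma> = \<beta>1"
proof -
  have image: "(s \<circ> h) ` {0<..<1} = s ` I" unfolding h(3)[symmetric] by (rule image_comp[symmetric])
  show thesis
  proof (rule open_unit_interval_completion[of "s \<circ> h" \<beta>0 \<beta>1, unfolded image])
    show "continuous_on {0<..<1} (s \<circ> h)" "inj_on (s \<circ> h) {0<..<1}"
      using continuous_on_compose[OF h(1)] comp_inj_on[OF h(2)] s(1,2) by (simp_all add: h(3))
    show "((s \<circ> h) \<longlongrightarrow> \<beta>0) (at_right 0)" "((s \<circ> h) \<longlongrightarrow> \<beta>1) (at_left 1)"
      using filterlim_compose[OF s(3) h(4)] filterlim_compose[OF s(4) h(5)] by (simp_all add: comp_def)
  qed (fact s(5), fact s(6), rule that)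
qed

lemma open_interval_completion:
  fixes s :: "real \<Rightarrow> 'a::real_normed_vector"
  assumes "a < b" and s: "continuous_on {a<..<b} s" "inj_on s {a<..<b}"
    "(s \<longlongrightarrow> \<beta>0) (at_right a)" "(s \<longlongrightarrow> \<beta>1) (at_left b)" "\<beta>0 \<notin> s ` {a<..<b}" "\<beta>1 \<notin> s ` {a<..<b}"
  obtains \<gamma> where "path_image \<gamma> = closure (s ` {a<..<b})" "path_image \<gamma> = insert \<beta>0 (insert \<beta>1 (s ` {a<..<b}))"
    "simple_path \<gamma>" "pathstart \<gamma> = \<beta>0" "pathfinish \<gamma> = \<beta>1"
proof (rule open_curve_completion_reparam[OF s])
  define h where "h t = a + (b - a) * t" for t
  have "b - h t = (b - a) * (1 - t)" for t by (simp add: h_def algebra_simps)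
  then have h_less: "h t < b" if "t < 1" for t
    using that \<open>a < b\<close> by (metis diff_gt_0_iff_gt mult_pos_pos)
  have h_gt: "a < h t" if "0 < t" for t using that \<open>a < b\<close> by (simp add: h_def)
  show "continuous_on {0<..<1} h" unfolding h_def by (intro continuous_intros)
  show "inj_on h {0<..<1}" using \<open>a < b\<close> by (auto simp: inj_on_def h_def)
  have "y \<in> h ` {0<..<1}" if "y \<in> {a<..<b}" for y
    using that \<open>a < b\<close> by (intro image_eqI[of _ _ "(y - a) / (b - a)"]) (auto simp: h_def divide_simps)
  then show "h ` {0<..<1} = {a<..<b}" using h_less h_gt by auto
  have "(h \<longlongrightarrow> a) (at_right 0)" unfolding h_def by (auto intro!: tendsto_eq_intros)
  then show "filterlim h (at_right a) (at_right 0)"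
    using h_gt by (auto simp: filterlim_at eventually_at_right_field less_imp_neq[symmetric]
        intro!: exI[of _ 1])
  have "(h \<longlongrightarrow> b) (at_left 1)" unfolding h_def by (auto intro!: tendsto_eq_intros)
  then show "filterlim h (at_left b) (at_left 1)"
    using h_less by (auto simp: filterlim_at eventually_at_left_field less_imp_neq intro!: exI[of _ 0])
qed (rule that)

lemma line_completion:
  fixes s :: "real \<Rightarrow> 'a::real_normed_vector"
  assumes s: "continuous_on UNIV s" "inj s" "(s \<longlongrightarrow> \<beta>0) at_bot" "(s \<longlongrightarrow> \<beta>1) at_top" "\<beta>0 \<notin> range s" "\<beta>1 \<notin> range s"
  obtains \<gamma> where "path_image \<gamma> = closure (range s)" "path_image \<gamma> = insert \<beta>0 (insert \<beta>1 (range s))"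
    "simple_path \<gamma>" "pathstart \<gamma> = \<beta>0" "pathfinish \<gamma> = \<beta>1"
proof (rule open_curve_completion_reparam[OF s])
  define h where "h t = ln t - ln (1 - t)" for t :: real
  show "continuous_on {0<..<1} h" unfolding h_def by (intro continuous_intros) auto
  have "strict_mono_on {0<..<1} h"
    by (rule strict_mono_onI) (auto simp: h_def intro!: diff_strict_mono)
  then show "inj_on h {0<..<1}" by (rule strict_mono_on_imp_inj_on)
  have "h (1 / (1 + exp (- x))) = x" for x :: real
  proof -
    have "1 + exp (- x) > 0" by (simp add: add_pos_pos)
    moreover from this have "1 - 1 / (1 + exp (- x)) = exp (- x) / (1 + exp (- x))" by (simp add: field_simps)
    ultimately show ?thesis unfolding h_def by (simp add: ln_div)
  qed
  moreover have "1 / (1 + exp (- x)) \<in> {0<..<1}" for x :: real by (simp add: add_pos_pos)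
  ultimately show "h ` {0<..<1} = UNIV" by (metis UNIV_eq_I imageI)
  show "filterlim h at_bot (at_right 0)" "filterlim h at_top (at_left 1)" unfolding h_def by real_asymp+
qed (rule that)

section \<open>Disc automorphisms with a boundary fixed point\<close>

definition disc_automorphism :: "(complex \<Rightarrow> complex) \<Rightarrow> (complex \<Rightarrow> complex) \<Rightarrow> bool" where
  "disc_automorphism T T' \<longleftrightarrow> T holomorphic_on ball 0 1 \<and> T' holomorphic_on ball 0 1 \<and>
     T ` ball 0 1 \<subseteq> ball 0 1 \<and> T' ` ball 0 1 \<subseteq> ball 0 1 \<and>
     (\<forall>z\<in>ball 0 1. T' (T z) = z) \<and> (\<forall>z\<in>ball 0 1. T (T' z) = z)"

lemma disc_automorphism_compose:
  assumes "disc_automorphism S S'" "disc_automorphism T T'"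
  shows "disc_automorphism (S \<circ> T) (T' \<circ> S')"
proof -
  have "(S \<circ> T) holomorphic_on ball 0 1" "(T' \<circ> S') holomorphic_on ball 0 1"
    using holomorphic_on_compose_gen[of T "ball 0 1" S "ball 0 1"]
      holomorphic_on_compose_gen[of S' "ball 0 1" T' "ball 0 1"]
      assms by (simp_all add: disc_automorphism_def)
  then show ?thesis
    using assms by (simp add: disc_automorphism_def image_subset_iff)
qed

lemma disc_automorphism_Moebius:
  assumes "norm w < 1"
  shows "disc_automorphism (Moebius_function 0 w) (Moebius_function 0 (- w))"
  using assms Moebius_function_compose[of "- w" w] Moebius_function_compose[of w "- w"]
    Moebius_function_norm_lt_1[of w] Moebius_function_norm_lt_1[of "- w"]
  by (auto simp: disc_automorphism_def intro: Moebius_function_holomorphic)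

lemma disc_automorphism_fixing_zero:
  assumes T: "disc_automorphism T T'" and "T 0 = 0"
  obtains \<theta> :: real where "\<And>z. z \<in> ball 0 1 \<Longrightarrow> T z = exp (\<i> * of_real \<theta>) * z"
proof -
  have hol: "T holomorphic_on ball 0 1" "T' holomorphic_on ball 0 1" and T'T: "\<And>z. norm z < 1 \<Longrightarrow> T' (T z) = z"
    and less: "\<And>z. norm z < 1 \<Longrightarrow> norm (T z) < 1" "\<And>z. norm z < 1 \<Longrightarrow> norm (T' z) < 1"
    using T by (auto simp: disc_automorphism_def image_subset_iff)
  have "T' 0 = 0" using T'T[of 0] \<open>T 0 = 0\<close> by simp
  have "norm (T (1/2)) = norm (1/2 :: complex)"
  proof (rule antisym)
    show "norm (T (1/2)) \<le> norm (1/2 :: complex)"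
      by (rule Schwarz_Lemma(1)[OF hol(1) \<open>T 0 = 0\<close> less(1)]) auto
    have "norm (T' (T (1/2))) \<le> norm (T (1/2))"
      by (rule Schwarz_Lemma(1)[OF hol(2) \<open>T' 0 = 0\<close> less(2)]) (use less(1) in auto)
    then show "norm (1/2 :: complex) \<le> norm (T (1/2))" using T'T[of "1/2"] by simp
  qed
  then have "\<exists>z. norm z < 1 \<and> z \<noteq> 0 \<and> norm (T z) = norm z" by (intro exI[of _ "1/2"]) auto
  then obtain c where "\<And>z. norm z < 1 \<Longrightarrow> T z = c * z" "norm c = 1"
    using Schwarz_Lemma(3)[OF hol(1) \<open>T 0 = 0\<close> less(1), of 0] by auto
  then show thesis
    using that[of "Arg2pi c"] complex_norm_eq_1_exp[of c] by simp
qed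

lemma disc_automorphism_imp_Moebius:
  assumes T: "disc_automorphism T T'"
  obtains t w where "norm w < 1" "\<And>z. z \<in> ball 0 1 \<Longrightarrow> T z = Moebius_function t w z"
proof -
  define w where "w = T' 0"
  have w: "norm w < 1" "T w = 0"
    using T by (auto simp: disc_automorphism_def w_def image_subset_iff)
  have "disc_automorphism (T \<circ> Moebius_function 0 (- w)) (Moebius_function 0 w \<circ> T')"
    using disc_automorphism_compose[OF T] disc_automorphism_Moebius[of "- w"] w(1) by simp
  moreover have "(T \<circ> Moebius_function 0 (- w)) 0 = 0"
    using w(2) by (simp add: Moebius_function_of_zero)
  ultimately obtain \<theta> where \<theta>: "\<And>z. z \<in> ball 0 1 \<Longrightarrow> (T \<circ> Moebius_function 0 (- w)) z = exp (\<i> * of_real \<theta>) * z"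
    using disc_automorphism_fixing_zero by blast
  have "T z = Moebius_function \<theta> w z" if "z \<in> ball 0 1" for z
  proof -
    have "Moebius_function 0 w z \<in> ball 0 1" "Moebius_function 0 (- w) (Moebius_function 0 w z) = z"
      using Moebius_function_norm_lt_1[OF w(1)] Moebius_function_compose[of "- w" w z] w(1) that by auto
    then have "T z = exp (\<i> * of_real \<theta>) * Moebius_function 0 w z" using \<theta> by (metis comp_apply)
    then show ?thesis by (simp add: Moebius_function_def)
  qed
  then show thesis using that w(1) by blast
qed

lemma one_minus_cnj_mult_nonzero:
  assumes "norm w < 1" "norm z \<le> 1"
  shows "1 - cnj w * z \<noteq> 0"
proof -
  have "norm (cnj w * z) \<le> norm w * 1" unfolding norm_mult using assms by (intro mult_mono) auto
  then show ?thesis using assms by auto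
qed

lemma one_minus_norm_Moebius_function_squared:
  assumes "norm w < 1" "norm z \<le> 1"
  shows "1 - (norm (Moebius_function t w z))\<^sup>2 = (1 - (norm w)\<^sup>2) * (1 - (norm z)\<^sup>2) / (norm (1 - cnj w * z))\<^sup>2"
proof -
  have "(norm (1 - cnj w * z))\<^sup>2 - (norm (z - w))\<^sup>2 = (1 - (norm w)\<^sup>2) * (1 - (norm z)\<^sup>2)"
    unfolding cmod_power2 by (simp add: power2_eq_square) (simp add: algebra_simps)
  moreover have "norm (Moebius_function t w z) = norm (z - w) / norm (1 - cnj w * z)"
    by (simp add: Moebius_function_def norm_divide norm_mult)
  moreover have "norm (1 - cnj w * z) \<noteq> 0" using one_minus_cnj_mult_nonzero[OF assms] by simp
  ultimately show ?thesis
    by (metis (no_types, lifting) diff_divide_distrib divide_self power_divide power_not_zero)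
qed

lemma continuous_on_Moebius_function:
  assumes "norm w < 1"
  shows "continuous_on (cball 0 1) (Moebius_function t w)"
  unfolding Moebius_function_def
  by (intro continuous_intros) (use one_minus_cnj_mult_nonzero assms in auto)

lemma Moebius_function_boundary_fixpoint:
  assumes w: "norm w < 1" and no_fixpoint: "\<And>z. z \<in> ball 0 1 \<Longrightarrow> Moebius_function t w z \<noteq> z"
  obtains \<beta> where "norm \<beta> = 1" "Moebius_function t w \<beta> = \<beta>"
proof -
  have "norm (Moebius_function t w z) \<le> 1" if "norm z \<le> 1" for z
  proof -
    have "0 \<le> 1 - (norm (Moebius_function t w z))\<^sup>2"
      unfolding one_minus_norm_Moebius_function_squared[OF w that] using w that by (simp add: power_le_one)
    then show ?thesis by (simp add: abs_square_le_1)
  qed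
  then obtain \<beta> where "\<beta> \<in> cball 0 1" "Moebius_function t w \<beta> = \<beta>"
    using brouwer_ball[of 1 "0::complex" "Moebius_function t w"] continuous_on_Moebius_function[OF w] by auto
  moreover from this have "\<beta> \<notin> ball 0 1" using no_fixpoint by blast
  ultimately show thesis using that[of \<beta>] by simp
qed

lemma norm_Moebius_function_diff:
  assumes "norm w < 1" "norm z \<le> 1" "norm \<beta> \<le> 1"
  shows "norm (Moebius_function t w z - Moebius_function t w \<beta>) =
    norm (z - \<beta>) * (1 - (norm w)\<^sup>2) / (norm (1 - cnj w * z) * norm (1 - cnj w * \<beta>))"
proof -
  have nz: "1 - cnj w * z \<noteq> 0" "1 - cnj w * \<beta> \<noteq> 0" using one_minus_cnj_mult_nonzero assms by auto
  have norm_w: "of_real (1 - (norm w)\<^sup>2) = 1 - w * cnj w" by (simp add: complex_norm_square[symmetric])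
  have "Moebius_function t w z - Moebius_function t w \<beta> =
      exp (\<i> * of_real t) * ((z - \<beta>) * of_real (1 - (norm w)\<^sup>2)) / ((1 - cnj w * z) * (1 - cnj w * \<beta>))"
    unfolding Moebius_function_def diff_frac_eq[OF nz] norm_w by (simp add: algebra_simps)
  moreover have "norm (complex_of_real (1 - (norm w)\<^sup>2)) = 1 - (norm w)\<^sup>2"
    unfolding norm_of_real using assms(1) by (simp add: power_le_one)
  ultimately show ?thesis by (simp add: norm_mult norm_divide del: of_real_diff)
qed

lemma holomorphic_Re_zero_imp_constant_on:
  assumes "f holomorphic_on S" "open S" "connected S" "\<And>z. z \<in> S \<Longrightarrow> Re (f z) = 0"
  shows "f constant_on S"
proof (rule ccontr)
  assume "\<not> f constant_on S"
  then have "open (f ` S)"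
    using open_mapping_thm[OF assms(1-3,2) order_refl] by blast
  moreover obtain z where "z \<in> S" using \<open>\<not> f constant_on S\<close> by (auto simp: constant_on_def)
  ultimately obtain \<epsilon> where "\<epsilon> > 0" "ball (f z) \<epsilon> \<subseteq> f ` S" by (meson imageI openE)
  moreover have "f z + of_real (\<epsilon> / 2) \<in> ball (f z) \<epsilon>" using \<open>\<epsilon> > 0\<close> by (simp add: dist_norm)
  ultimately obtain z' where "z' \<in> S" "f z' = f z + of_real (\<epsilon> / 2)" by (metis imageE subsetD)
  then show False using assms(4)[of z] assms(4)[of z'] \<open>z \<in> S\<close> \<open>\<epsilon> > 0\<close> by simp
qed

definition half_plane_affine :: "(complex \<Rightarrow> complex) \<Rightarrow> complex \<Rightarrow> real \<Rightarrow> real \<Rightarrow> bool" where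
  "half_plane_affine T \<beta> a b \<longleftrightarrow> norm \<beta> = 1 \<and> a > 0 \<and>
     (\<forall>z\<in>ball 0 1. T z \<in> ball 0 1 \<and> cayley \<beta> (T z) = of_real a * cayley \<beta> z + \<i> * of_real b)"

text \<open>The Poisson kernel at a boundary fixed point is multiplied by a constant.\<close>

lemma Moebius_function_half_plane_affine:
  assumes w: "norm w < 1" and \<beta>: "norm \<beta> = 1" "Moebius_function t w \<beta> = \<beta>"
  obtains a b where "half_plane_affine (Moebius_function t w) \<beta> a b"
proof -
  define T where "T = Moebius_function t w"
  define a where "a = (norm (1 - cnj w * \<beta>))\<^sup>2 / (1 - (norm w)\<^sup>2)"
  define D where "D z = cayley \<beta> (T z) - of_real a * cayley \<beta> z" for z
  have w2: "1 - (norm w)\<^sup>2 > 0" using w by (simp add: power_less_one_iff)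
  have "norm (1 - cnj w * \<beta>) > 0" using one_minus_cnj_mult_nonzero[OF w] \<beta>(1) by simp
  then have "a > 0" using w2 by (simp add: a_def)
  have T_ball: "T z \<in> ball 0 1" if "z \<in> ball 0 1" for z
    using Moebius_function_norm_lt_1[OF w] that by (simp add: T_def)
  have \<beta>_notin: "\<beta> \<notin> ball 0 1" using \<beta>(1) by simp
  have "Re (D z) = 0" if z: "z \<in> ball 0 1" for z
  proof -
    have "dist (T z) \<beta> = dist z \<beta> * (1 - (norm w)\<^sup>2) / (norm (1 - cnj w * z) * norm (1 - cnj w * \<beta>))"
      using norm_Moebius_function_diff[OF w, of z \<beta> t] z \<beta> by (simp add: T_def dist_norm)
    moreover have "1 - cnj w * z \<noteq> 0" "dist z \<beta> \<noteq> 0"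
      using one_minus_cnj_mult_nonzero[OF w, of z] z \<beta>(1) by auto
    moreover have "1 - (norm (T z))\<^sup>2 = (1 - (norm w)\<^sup>2) * (1 - (norm z)\<^sup>2) / (norm (1 - cnj w * z))\<^sup>2"
      using one_minus_norm_Moebius_function_squared[OF w, of z t] z by (simp add: T_def)
    moreover have "n * N / P\<^sup>2 / (d * n / (P * E))\<^sup>2 = E\<^sup>2 / n * (N / d\<^sup>2)"
      if "P \<noteq> 0" "n \<noteq> 0" for n N P d E :: real
      using that by (simp add: field_simps power2_eq_square)
    ultimately show ?thesis
      using w2 by (simp add: D_def Re_cayley[OF \<beta>(1)] a_def)
  qed
  moreover have "(\<lambda>z. cayley \<beta> (T z)) holomorphic_on ball 0 1"
    by (rule holomorphic_on_compose_gen[OF _ holomorphic_on_cayley[OF \<beta>_notin], unfolded o_def])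
      (use T_ball Moebius_function_holomorphic[OF w] in \<open>auto simp: T_def\<close>)
  then have "D holomorphic_on ball 0 1"
    unfolding D_def by (intro holomorphic_intros holomorphic_on_cayley \<beta>_notin)
  ultimately have "D constant_on ball 0 1"
    by (intro holomorphic_Re_zero_imp_constant_on) auto
  then obtain d where d: "\<And>z. z \<in> ball 0 1 \<Longrightarrow> D z = d" by (auto simp: constant_on_def)
  then have "Re d = 0" using \<open>\<And>z. z \<in> ball 0 1 \<Longrightarrow> Re (D z) = 0\<close>[of 0] by auto
  then have "cayley \<beta> (T z) = of_real a * cayley \<beta> z + \<i> * of_real (Im d)" if "z \<in> ball 0 1" for z
    using d[OF that] by (simp add: D_def complex_eq_iff)
  then show thesis
    using that \<beta>(1) \<open>a > 0\<close> T_ball unfolding half_plane_affine_def T_def by blast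
qed

lemma half_plane_affine_nontrivial:
  assumes T: "half_plane_affine T \<beta> a b" and z: "z \<in> ball 0 1" "T z \<noteq> z"
  shows "a \<noteq> 1 \<or> b \<noteq> 0"
proof (rule ccontr)
  assume "\<not> (a \<noteq> 1 \<or> b \<noteq> 0)"
  then have "T z \<in> ball 0 1" "cayley \<beta> (T z) = cayley \<beta> z" and \<beta>: "norm \<beta> = 1"
    using T z(1) by (auto simp: half_plane_affine_def)
  moreover from this z(1) have "z \<noteq> \<beta>" "T z \<noteq> \<beta>" "\<beta> \<noteq> 0" by auto
  ultimately show False using inverse_cayley_cayley z(2) by metis
qed

lemma fixpoint_free_Moebius_function_half_plane_affine:
  assumes w: "norm w < 1" and no_fixpoint: "\<And>z. z \<in> ball 0 1 \<Longrightarrow> Moebius_function t w z \<noteq> z"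
  obtains \<beta> a b where "half_plane_affine (Moebius_function t w) \<beta> a b" "a \<noteq> 1 \<or> b \<noteq> 0"
proof -
  obtain \<beta> where "norm \<beta> = 1" "Moebius_function t w \<beta> = \<beta>"
    using Moebius_function_boundary_fixpoint[OF w no_fixpoint] by blast
  then obtain a b where affine: "half_plane_affine (Moebius_function t w) \<beta> a b"
    by (rule Moebius_function_half_plane_affine[OF w])
  then show thesis using half_plane_affine_nontrivial[OF affine, of 0] no_fixpoint[of 0] that by auto
qed

section \<open>Orbits and invariant functions of half plane automorphisms\<close>

lemma periodic_attains_bounds:
  fixes f :: "real \<Rightarrow> real"
  assumes f: "continuous_on UNIV f" "\<And>t. f (t + 1) = f t"
  obtains u v where "\<And>t. f u \<le> f t" "\<And>t. f t \<le> f v"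
proof -
  have shift: "f (t + of_nat n) = f t" for t n
  proof (induction n)
    case (Suc n)
    then show ?case using f(2)[of "t + of_nat n"] by (simp add: algebra_simps)
  qed simp
  have "f (frac t) = f t" for t
  proof (cases "t \<ge> 0")
    case True
    then have "t = frac t + of_nat (nat \<lfloor>t\<rfloor>)" by (simp add: frac_def)
    then show ?thesis using shift by metis
  next
    case False
    then have "frac t = t + of_nat (nat (- \<lfloor>t\<rfloor>))" by (simp add: frac_def)
    then show ?thesis using shift by metis
  qed
  moreover have "frac t \<in> {0..1}" for t :: real by (simp add: less_imp_le frac_lt_1)
  moreover have "continuous_on {0..1} f" using f(1) by (rule continuous_on_subset) simp
  then obtain u v where "\<And>t. t \<in> {0..1} \<Longrightarrow> f u \<le> f t" "\<And>t. t \<in> {0..1} \<Longrightarrow> f t \<le> f v"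
    using continuous_attains_inf[of "{0..1}" f] continuous_attains_sup[of "{0..1}" f] by fastforce
  ultimately show thesis using that by metis
qed

lemma translation_orbit_limits:
  fixes y :: "real \<Rightarrow> complex"
  assumes y: "continuous_on UNIV y" "\<And>t. y (t + 1) = y t + \<i> * of_real b" and b: "b \<noteq> 0"
  shows "filterlim y at_infinity at_bot" "filterlim y at_infinity at_top"
proof -
  define f where "f t = norm (y t - \<i> * of_real (b * t))" for t
  have "continuous_on UNIV f" unfolding f_def by (intro continuous_intros y)
  moreover have "f (t + 1) = f t" for t unfolding f_def y(2) by (simp add: algebra_simps)
  ultimately obtain v where v: "\<And>t. f t \<le> f v" using periodic_attains_bounds by metis
  have lower: "\<bar>b\<bar> * \<bar>t\<bar> - f v \<le> norm (y t)" for t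
    using v[of t] norm_triangle_ineq2[of "\<i> * of_real (b * t)" "y t"] unfolding f_def
    by (simp add: norm_mult abs_mult norm_minus_commute)
  have "filterlim (\<lambda>t. \<bar>b\<bar> * \<bar>t\<bar> - f v) at_top at_bot" "filterlim (\<lambda>t. \<bar>b\<bar> * \<bar>t\<bar> - f v) at_top at_top"
    using b by real_asymp+
  then show "filterlim y at_infinity at_bot" "filterlim y at_infinity at_top"
    using lower by (auto simp: filterlim_at_infinity_conv_norm_at_top intro: filterlim_at_top_mono)
qed

lemma scaling_orbit_limits:
  fixes y :: "real \<Rightarrow> complex"
  assumes y: "continuous_on UNIV y" "\<And>t. y (t + 1) = of_real a * y t" "\<And>t. y t \<noteq> 0" and a: "a > 0"
  shows "a > 1 \<Longrightarrow> (y \<longlongrightarrow> 0) at_bot \<and> filterlim y at_infinity at_top"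
    and "a < 1 \<Longrightarrow> filterlim y at_infinity at_bot \<and> (y \<longlongrightarrow> 0) at_top"
proof -
  define f where "f t = norm (y t) * a powr (- t)" for t
  have "continuous_on UNIV f" unfolding f_def using a by (intro continuous_intros y) auto
  moreover have "f (t + 1) = f t" for t
    unfolding f_def y(2) using a by (simp add: norm_mult powr_diff powr_minus field_simps powr_add)
  ultimately obtain u v where uv: "\<And>t. f u \<le> f t" "\<And>t. f t \<le> f v" using periodic_attains_bounds by metis
  have "f u > 0" using a y(3) by (simp add: f_def)
  have "norm (y t) = f t * a powr t" for t using a by (simp add: f_def powr_minus field_simps)
  then have lower: "f u * a powr t \<le> norm (y t)" and upper: "norm (y t) \<le> f v * a powr t" for t
    using uv by (auto intro: mult_right_mono)
  have to_infinity: "filterlim y at_infinity F" if "filterlim (\<lambda>t. f u * a powr t) at_top F" for F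
    using filterlim_at_top_mono[OF that] lower by (auto simp: filterlim_at_infinity_conv_norm_at_top)
  have to_zero: "(y \<longlongrightarrow> 0) F" if "((\<lambda>t. f v * a powr t) \<longlongrightarrow> 0) F" for F
    by (rule Lim_null_comparison[OF _ that]) (use upper in auto)
  show "(y \<longlongrightarrow> 0) at_bot \<and> filterlim y at_infinity at_top" if "a > 1"
    using that \<open>f u > 0\<close> by (intro conjI to_zero to_infinity) real_asymp+
  show "filterlim y at_infinity at_bot \<and> (y \<longlongrightarrow> 0) at_top" if "a < 1"
    using that a \<open>f u > 0\<close> by (intro conjI to_zero to_infinity) real_asymp+
qed

definition orbit_curve :: "('a \<Rightarrow> 'a) \<Rightarrow> (real \<Rightarrow> 'a::topological_space) \<Rightarrow> bool" where
  "orbit_curve T s \<longleftrightarrow> continuous_on UNIV s \<and> (\<forall>t. s (t + 1) = T (s t))"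

lemma orbit_limit_fixed:
  fixes s :: "real \<Rightarrow> 'a::t2_space"
  assumes s: "orbit_curve T s" "range s \<subseteq> A" and T: "continuous_on A T" "\<beta> \<in> A"
    and lim: "(s \<longlongrightarrow> \<beta>) at_bot \<or> (s \<longlongrightarrow> \<beta>) at_top"
  shows "T \<beta> = \<beta>"
proof -
  have fixed: "T \<beta> = \<beta>" if F: "F \<noteq> bot" "(s \<longlongrightarrow> \<beta>) F" "filterlim (\<lambda>t::real. t + 1) F F" for F
  proof (rule tendsto_unique[OF F(1)])
    have "((\<lambda>t. s (t + 1)) \<longlongrightarrow> \<beta>) F" by (rule filterlim_compose[OF F(2,3)])
    then show "((\<lambda>t. T (s t)) \<longlongrightarrow> \<beta>) F" using s(1) by (simp add: orbit_curve_def)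
    show "((\<lambda>t. T (s t)) \<longlongrightarrow> T \<beta>) F"
      by (rule continuous_on_tendsto_compose[OF T(1) F(2) T(2)]) (use s(2) in \<open>simp add: image_subset_iff\<close>)
  qed
  have "filterlim (\<lambda>t::real. t + 1) at_bot at_bot" "filterlim (\<lambda>t::real. t + 1) at_top at_top"
    by real_asymp+
  then show ?thesis
    using lim fixed[of at_bot] fixed[of at_top] by auto
qed

lemma half_plane_orbit:
  assumes T: "half_plane_affine T \<beta> a b" and s: "orbit_curve T s" "range s \<subseteq> ball 0 1"
  shows "continuous_on UNIV (\<lambda>t. cayley \<beta> (s t))" "Re (cayley \<beta> (s t)) > 0"
    "cayley \<beta> (s (t + 1)) = of_real a * cayley \<beta> (s t) + \<i> * of_real b"
    "inverse_cayley \<beta> (cayley \<beta> (s t)) = s t"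
proof -
  have \<beta>: "norm \<beta> = 1" "\<beta> \<notin> ball 0 1" using T by (auto simp: half_plane_affine_def)
  have s_ball: "s t \<in> ball 0 1" for t using s(2) by blast
  have "continuous_on UNIV s" using s(1) by (simp add: orbit_curve_def)
  then show "continuous_on UNIV (\<lambda>t. cayley \<beta> (s t))"
    by (rule continuous_on_compose2[OF
        holomorphic_on_imp_continuous_on[OF holomorphic_on_cayley[OF \<beta>(2)]] _ s(2)])
  show "Re (cayley \<beta> (s t)) > 0" by (rule Re_cayley_pos[OF \<beta>(1) s_ball])
  show "cayley \<beta> (s (t + 1)) = of_real a * cayley \<beta> (s t) + \<i> * of_real b"
    using T s(1) s_ball by (simp add: half_plane_affine_def orbit_curve_def)
  show "inverse_cayley \<beta> (cayley \<beta> (s t)) = s t"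
    using \<beta> s_ball[of t] by (intro inverse_cayley_cayley) auto
qed

lemma parabolic_orbit_limits:
  assumes T: "half_plane_affine T \<beta> 1 b" "b \<noteq> 0" and s: "orbit_curve T s" "range s \<subseteq> ball 0 1"
  shows "(s \<longlongrightarrow> \<beta>) at_bot" "(s \<longlongrightarrow> \<beta>) at_top"
proof -
  note orbit = half_plane_orbit[OF T(1) s]
  have "filterlim (\<lambda>t. cayley \<beta> (s t)) at_infinity at_bot" "filterlim (\<lambda>t. cayley \<beta> (s t)) at_infinity at_top"
    using translation_orbit_limits[OF orbit(1) _ T(2)] orbit(3) by simp_all
  then show "(s \<longlongrightarrow> \<beta>) at_bot" "(s \<longlongrightarrow> \<beta>) at_top"
    using filterlim_compose[OF inverse_cayley_tendsto_infinity[of \<beta>]] by (fastforce simp: orbit(4))+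
qed

lemma affine_fixpoint:
  assumes "a \<noteq> (1::real)"
  shows "a * (b / (1 - a)) + b = b / (1 - a)"
  using assms by (simp add: field_simps)

lemma hyperbolic_orbit_limits:
  assumes T: "half_plane_affine T \<beta> a b" "a \<noteq> 1" and s: "orbit_curve T s" "range s \<subseteq> ball 0 1"
  defines "\<beta>' \<equiv> inverse_cayley \<beta> (\<i> * of_real (b / (1 - a)))"
  shows "a > 1 \<Longrightarrow> (s \<longlongrightarrow> \<beta>') at_bot \<and> (s \<longlongrightarrow> \<beta>) at_top"
    and "a < 1 \<Longrightarrow> (s \<longlongrightarrow> \<beta>) at_bot \<and> (s \<longlongrightarrow> \<beta>') at_top"
proof -
  note orbit = half_plane_orbit[OF T(1) s]
  define y0 where "y0 = b / (1 - a)"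
  define y where "y t = cayley \<beta> (s t) - \<i> * of_real y0" for t
  have a: "a > 0" using T(1) by (simp add: half_plane_affine_def)
  have "continuous_on UNIV y" unfolding y_def by (intro continuous_intros orbit(1))
  moreover have "y (t + 1) = of_real a * y t" for t
  proof -
    have "y (t + 1) = of_real a * cayley \<beta> (s t) + \<i> * of_real b - \<i> * of_real (a * y0 + b)"
      unfolding y_def orbit(3) using affine_fixpoint[OF T(2)] by (simp add: y0_def)
    then show ?thesis by (simp add: y_def algebra_simps)
  qed
  moreover have "y t \<noteq> 0" for t
  proof -
    have "Re (y t) > 0" using orbit(2)[of t] by (simp add: y_def)
    then show ?thesis by auto
  qed
  ultimately have limits: "a > 1 \<Longrightarrow> (y \<longlongrightarrow> 0) at_bot \<and> filterlim y at_infinity at_top"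
    "a < 1 \<Longrightarrow> filterlim y at_infinity at_bot \<and> (y \<longlongrightarrow> 0) at_top"
    using scaling_orbit_limits[OF _ _ _ a] by blast+
  have to_\<beta>: "(s \<longlongrightarrow> \<beta>) F" if "filterlim y at_infinity F" for F
  proof -
    have "filterlim (\<lambda>t. y t + \<i> * of_real y0) at_infinity F"
      by (rule tendsto_add_filterlim_at_infinity'[OF that tendsto_const])
    from filterlim_compose[OF inverse_cayley_tendsto_infinity[of \<beta>] this] show ?thesis
      by (simp add: y_def orbit(4))
  qed
  have to_\<beta>': "(s \<longlongrightarrow> \<beta>') F" if "(y \<longlongrightarrow> 0) F" for F
  proof -
    have "((\<lambda>t. y t + \<i> * of_real y0) \<longlongrightarrow> 0 + \<i> * of_real y0) F" by (intro tendsto_intros that)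
    then have "((\<lambda>t. y t + \<i> * of_real y0) \<longlongrightarrow> \<i> * of_real y0) F" by simp
    moreover have "\<i> * of_real y0 + 1 \<noteq> 0" by (simp add: complex_eq_iff)
    ultimately have "((\<lambda>t. inverse_cayley \<beta> (y t + \<i> * of_real y0)) \<longlongrightarrow> \<beta>') F"
      unfolding \<beta>'_def inverse_cayley_def y0_def[symmetric] by (auto intro!: tendsto_intros)
    then show ?thesis by (simp add: y_def orbit(4))
  qed
  show "a > 1 \<Longrightarrow> (s \<longlongrightarrow> \<beta>') at_bot \<and> (s \<longlongrightarrow> \<beta>) at_top" "a < 1 \<Longrightarrow> (s \<longlongrightarrow> \<beta>) at_bot \<and> (s \<longlongrightarrow> \<beta>') at_top"
    using limits to_\<beta> to_\<beta>' by auto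
qed

lemma half_plane_affine_orbit_ends:
  assumes T: "half_plane_affine T \<beta> a b" "a \<noteq> 1 \<or> b \<noteq> 0"
  obtains \<beta>0 \<beta>1 where "norm \<beta>0 = 1" "norm \<beta>1 = 1" "\<beta>0 = \<beta>1 \<longleftrightarrow> a = 1"
    "\<And>s. orbit_curve T s \<Longrightarrow> range s \<subseteq> ball 0 1 \<Longrightarrow> (s \<longlongrightarrow> \<beta>0) at_bot \<and> (s \<longlongrightarrow> \<beta>1) at_top"
proof (cases "a = 1")
  case True
  then show thesis
    using that[of \<beta> \<beta>] T parabolic_orbit_limits[of T \<beta> b] by (auto simp: half_plane_affine_def)
next
  case False
  define y0 where "y0 = b / (1 - a)"
  define \<beta>' where "\<beta>' = inverse_cayley \<beta> (\<i> * of_real y0)"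
  have \<beta>: "norm \<beta> = 1" using T(1) by (simp add: half_plane_affine_def)
  have nz: "\<i> * of_real y0 + 1 \<noteq> 0" by (simp add: complex_eq_iff)
  have "norm (\<i> * of_real y0 - 1) = norm (\<i> * of_real y0 + 1)" by (simp add: cmod_def)
  then have "norm \<beta>' = 1" using nz \<beta> by (simp add: \<beta>'_def inverse_cayley_def norm_divide norm_mult)
  moreover have "\<beta>' \<noteq> \<beta>"
  proof
    assume "\<beta>' = \<beta>"
    then have "\<beta> * (\<i> * of_real y0 - 1) = \<beta> * (\<i> * of_real y0 + 1)"
      using nz unfolding \<beta>'_def inverse_cayley_def by (simp only: divide_eq_eq split: if_splits)
    then show False using \<beta> by auto
  qed
  ultimately show thesis
    using that[of \<beta>' \<beta>] that[of \<beta> \<beta>'] \<beta> False hyperbolic_orbit_limits[OF T(1) False]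
    unfolding \<beta>'_def y0_def by (cases "a > 1") auto
qed

text \<open>
  The points at height \<^term>\<open>A ^ n\<close> are images, under the \<^term>\<open>n\<close>-th power of the scaling, of points that
  converge in the half plane.
\<close>

lemma scaling_invariant_limit:
  fixes f :: "complex \<Rightarrow> 'a::t2_space"
  assumes f: "continuous_on right_half_plane f" "\<And>y. Re y > 0 \<Longrightarrow> f (of_real A * y) = f y" and "A > 1"
    and lim: "((\<lambda>x::real. f (of_real x + \<i> * of_real v)) \<longlongrightarrow> p) at_top"
  shows "p = f 1"
proof -
  have scale: "f (of_real (A ^ n) * y) = f y" if "Re y > 0" for y n
  proof (induction n)
    case (Suc n)
    then show ?case using f(2)[of "of_real (A ^ n) * y"] that \<open>A > 1\<close> by (simp add: mult.assoc)
  qed simp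
  define y where "y n = 1 + \<i> * of_real (v / A ^ n)" for n :: nat
  have "filterlim (\<lambda>n. A ^ n) at_top sequentially"
    using \<open>A > 1\<close> by real_asymp
  from filterlim_compose[OF lim this] have "(\<lambda>n. f (of_real (A ^ n) + \<i> * of_real v)) \<longlonglongrightarrow> p" .
  moreover have "f (of_real (A ^ n) + \<i> * of_real v) = f (y n)" for n
  proof -
    have "of_real (A ^ n) + \<i> * of_real v = of_real (A ^ n) * y n"
      using \<open>A > 1\<close> by (simp add: y_def algebra_simps)
    then show ?thesis using scale[of "y n" n] by (simp add: y_def)
  qed
  moreover have "y \<longlonglongrightarrow> 1"
  proof -
    have "(\<lambda>n. v / A ^ n) \<longlonglongrightarrow> 0" using \<open>A > 1\<close> by real_asymp
    then have "(\<lambda>n. 1 + \<i> * of_real (v / A ^ n)) \<longlonglongrightarrow> 1 + \<i> * of_real 0" by (intro tendsto_intros)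
    then show ?thesis by (simp add: y_def[abs_def])
  qed
  then have "(\<lambda>n. f (y n)) \<longlonglongrightarrow> f 1"
    by (rule continuous_on_tendsto_compose[OF f(1)]) (auto simp: y_def)
  ultimately show ?thesis using LIMSEQ_unique by simp
qed

lemma affine_invariant_limit:
  fixes f :: "complex \<Rightarrow> 'a::t2_space"
  assumes f: "continuous_on right_half_plane f" "\<And>y. Re y > 0 \<Longrightarrow> f (of_real a * y + \<i> * of_real b) = f y"
    and a: "a > 0" "a \<noteq> 1" and lim: "((\<lambda>x::real. f (of_real x)) \<longlongrightarrow> p) at_top"
  shows "p \<in> f ` right_half_plane"
proof -
  define y0 where "y0 = b / (1 - a)"
  define g where "g y = f (y + \<i> * of_real y0)" for y
  have cont: "continuous_on right_half_plane g" unfolding g_def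
    by (rule continuous_on_compose2[OF f(1)]) (auto intro!: continuous_intros)
  have g_a: "g (of_real a * y) = g y" if "Re y > 0" for y
  proof -
    have "of_real a * (y + \<i> * of_real y0) + \<i> * of_real b = of_real a * y + \<i> * of_real (a * y0 + b)"
      by (simp add: algebra_simps)
    also have "a * y0 + b = y0" unfolding y0_def by (rule affine_fixpoint[OF a(2)])
    finally show ?thesis using f(2)[of "y + \<i> * of_real y0"] that by (simp add: g_def)
  qed
  have g_inverse: "g (of_real (1 / a) * y) = g y" if "Re y > 0" for y
    using g_a[of "of_real (1 / a) * y"] that a(1) by simp
  have g_lim: "((\<lambda>x::real. g (of_real x + \<i> * of_real (- y0))) \<longlongrightarrow> p) at_top" using lim by (simp add: g_def)
  have "p = g 1"
  proof (cases "a > 1")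
    case True
    then show ?thesis using scaling_invariant_limit[OF cont g_a _ g_lim] by blast
  next
    case False
    then show ?thesis using scaling_invariant_limit[OF cont g_inverse _ g_lim] a by simp
  qed
  then show ?thesis by (simp add: g_def)
qed

lemma vertical_period_int:
  assumes "\<And>y. Re y > 0 \<Longrightarrow> f (y + \<i> * of_real b) = f y" "Re y > 0"
  shows "f (y + \<i> * of_real (of_int n * b)) = f y"
proof (induction n rule: int_induct[where k = 0])
  case (step1 i)
  then show ?case
    using assms(1)[of "y + \<i> * of_real (of_int i * b)"] assms(2) by (simp add: algebra_simps)
next
  case (step2 i)
  then show ?case
    using assms(1)[of "y + \<i> * of_real (of_int (i - 1) * b)"] assms(2) by (simp add: algebra_simps)
qed simp

lemma holomorphic_on_factor_through_exp:
  fixes f :: "complex \<Rightarrow> complex" and k :: real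
  assumes f: "f holomorphic_on right_half_plane" and k: "k > 0"
    and eq: "\<And>y y'. \<lbrakk>Re y > 0; Re y' > 0; exp (- of_real k * y) = exp (- of_real k * y')\<rbrakk> \<Longrightarrow> f y = f y'"
  shows "(\<lambda>\<zeta>. f (- Ln \<zeta> / of_real k)) holomorphic_on ball 0 1 - {0}"
proof -
  have Re_log_pos: "Re y > 0" if "exp (- of_real k * y) = \<zeta>" "\<zeta> \<in> ball 0 1" for y \<zeta>
  proof -
    have "exp (- k * Re y) = norm (exp (- of_real k * y))" by simp
    also have "\<dots> < 1" using that by simp
    finally show ?thesis using k by (simp add: zero_less_mult_iff)
  qed
  define F where "F \<zeta> = f (- Ln \<zeta> / of_real k)" for \<zeta>
  have F_eq: "F \<zeta> = f y" if "exp (- of_real k * y) = \<zeta>" "\<zeta> \<in> ball 0 1 - {0}" for y \<zeta>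
  proof -
    have "exp (- of_real k * (- Ln \<zeta> / of_real k)) = \<zeta>" using that(2) k by simp
    then show ?thesis unfolding F_def using that Re_log_pos by (intro eq) auto
  qed
  have "F field_differentiable (at \<zeta>0)" if \<zeta>0: "\<zeta>0 \<in> ball 0 1 - {0}" for \<zeta>0
  proof -
    define N where "N = (ball 0 1 - {0}) \<inter> {\<zeta>. \<zeta> / \<zeta>0 \<notin> \<real>\<^sub>\<le>\<^sub>0}"
    define y where "y \<zeta> = - (Ln \<zeta>0 + Ln (\<zeta> / \<zeta>0)) / of_real k" for \<zeta>
    have exp_y: "exp (- of_real k * y \<zeta>) = \<zeta>" if "\<zeta> \<in> N" for \<zeta>
      using that \<zeta>0 k by (simp add: y_def N_def exp_add)
    have "open ((\<lambda>\<zeta>. \<zeta> / \<zeta>0) -` (- \<real>\<^sub>\<le>\<^sub>0))"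
      using \<zeta>0 by (intro open_vimage continuous_intros) auto
    then have "open N" by (auto simp: N_def vimage_def Compl_eq intro!: open_Int open_Diff)
    have "y holomorphic_on N" unfolding y_def
      using \<zeta>0 k by (intro holomorphic_intros) (auto simp: N_def)
    then have "(f \<circ> y) holomorphic_on N"
      by (rule holomorphic_on_compose_gen[OF _ f]) (use Re_log_pos[OF exp_y] in \<open>auto simp: N_def\<close>)
    then have "F holomorphic_on N"
      by (rule holomorphic_transform) (use F_eq[OF exp_y] in \<open>simp add: N_def\<close>)
    moreover have "\<zeta>0 \<in> N" using \<zeta>0 by (simp add: N_def)
    ultimately show ?thesis using \<open>open N\<close> holomorphic_on_imp_differentiable_at by blast
  qed
  then show ?thesis
    unfolding F_def[abs_def] by (auto simp: holomorphic_on_def intro: field_differentiable_at_within)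
qed

lemma vertical_periodic_factor:
  fixes f :: "complex \<Rightarrow> complex"
  assumes f: "f holomorphic_on right_half_plane" "bounded (f ` right_half_plane)"
    and b: "b > 0" "\<And>y. Re y > 0 \<Longrightarrow> f (y + \<i> * of_real b) = f y"
  obtains F where "F holomorphic_on ball 0 1" "\<And>y. Re y > 0 \<Longrightarrow> f y = F (exp (- of_real (2 * pi / b) * y))"
proof -
  define k where "k = 2 * pi / b"
  have k: "k > 0" "2 * pi / k = b" using b(1) by (simp_all add: k_def)
  define F0 where "F0 \<zeta> = f (- Ln \<zeta> / of_real k)" for \<zeta>
  have Re_log_pos: "Re (- Ln \<zeta> / of_real k) > 0" if "\<zeta> \<in> ball 0 1 - {0}" for \<zeta>
    using that k(1) by (simp add: divide_neg_pos)
  have f_eq: "f y = f y'" if y: "Re y > 0" "Re y' > 0" "exp (- of_real k * y) = exp (- of_real k * y')" for y y'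
  proof -
    obtain n :: int where "- of_real k * y = - of_real k * y' + of_int (2 * n) * pi * \<i>"
      using y(3) by (auto simp: exp_eq)
    then have "y = y' + \<i> * of_real (of_int (- n) * (2 * pi / k))"
      using k(1) by (simp add: field_simps)
    then show ?thesis using vertical_period_int[of f b y' "- n"] b(2) y(2) unfolding k(2) by simp
  qed
  have "F0 holomorphic_on ball 0 1 - {0}"
    unfolding F0_def by (rule holomorphic_on_factor_through_exp[OF f(1) k(1) f_eq])
  moreover obtain M where M: "\<And>y. Re y > 0 \<Longrightarrow> norm (f y) \<le> M" using f(2) unfolding bounded_iff by auto
  have "\<forall>\<^sub>F \<zeta> in at 0. norm (F0 \<zeta>) \<le> M"
    unfolding eventually_at using M[OF Re_log_pos] by (auto simp: F0_def intro!: exI[of _ 1])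
  ultimately obtain F where F: "F holomorphic_on ball 0 1" "\<And>\<zeta>. \<zeta> \<in> ball 0 1 - {0} \<Longrightarrow> F \<zeta> = F0 \<zeta>"
    using holomorphic_on_extend_bounded[of F0 "ball 0 1" 0] by auto
  have "f y = F (exp (- of_real k * y))" if y: "Re y > 0" for y
  proof -
    have \<zeta>: "exp (- of_real k * y) \<in> ball 0 1 - {0}" using y k(1) by simp
    have "f y = F0 (exp (- of_real k * y))"
      unfolding F0_def by (rule f_eq[OF y Re_log_pos[OF \<zeta>]]) (use k(1) in simp)
    then show ?thesis using F(2)[OF \<zeta>] by simp
  qed
  then show thesis using that[of F] F(1) unfolding k_def by blast
qed

section \<open>Lifts and deck transformations\<close>

locale disc_covering =
  fixes \<Omega> :: "complex set" and \<phi> :: "complex \<Rightarrow> complex"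
  assumes bounded_domain: "bounded \<Omega>" and open_domain: "open \<Omega>"
    and hol: "\<phi> holomorphic_on ball 0 1" and cov: "covering_space (ball 0 1) \<phi> \<Omega>"
begin

lemma cont: "continuous_on (ball 0 1) \<phi>"
  using hol by (rule holomorphic_on_imp_continuous_on)

lemma isCont: "z \<in> ball 0 1 \<Longrightarrow> isCont \<phi> z"
  using cont by (simp add: continuous_on_eq_continuous_at)

lemma image: "\<phi> ` ball 0 1 = \<Omega>"
  using cov by (rule covering_space_imp_surjective)

lemma in_domain: "z \<in> ball 0 1 \<Longrightarrow> \<phi> z \<in> \<Omega>"
  using image by blast

lemma bounded_image: "bounded (\<phi> ` ball 0 1)"
  unfolding image by (rule bounded_domain)

lemma locally_injective:
  assumes "z \<in> ball 0 1"
  obtains N where "open N" "z \<in> N" "N \<subseteq> ball 0 1" "inj_on \<phi> N"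
proof -
  obtain N u q where N: "z \<in> N" "openin (top_of_set (ball 0 1)) N" "homeomorphism N u \<phi> q"
    using covering_space_local_homeomorphism[OF cov assms] by metis
  show thesis
  proof (rule that[of N])
    show "open N" "N \<subseteq> ball 0 1" using N(2) by (auto simp: openin_open_eq)
    show "inj_on \<phi> N" using N(3) by (metis homeomorphism_apply1 inj_onI)
  qed (rule N)
qed

lemma nonconstant: "\<not> \<phi> constant_on ball 0 1"
proof
  assume "\<phi> constant_on ball 0 1"
  then obtain y where y: "\<And>z. z \<in> ball 0 1 \<Longrightarrow> \<phi> z = y" by (auto simp: constant_on_def)
  obtain N where N: "open N" "0 \<in> N" "N \<subseteq> ball 0 1" "inj_on \<phi> N"
    using locally_injective[of 0] by auto
  have "z = 0" if "z \<in> N" for z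
    using inj_onD[OF N(4), of z 0] y N(2,3) that by (simp add: subset_iff)
  then have "N = {0}" using N(2) by blast
  then show False using N(1) not_open_singleton[of "0::complex"] by simp
qed

lemma lift:
  fixes f :: "'a::real_normed_vector \<Rightarrow> complex"
  assumes "convex U" "z \<in> U" "a \<in> ball 0 1" "continuous_on U f" "f ` U \<subseteq> \<Omega>" "f z = \<phi> a"
  obtains g where "continuous_on U g" "g ` U \<subseteq> ball 0 1" "g z = a" "\<And>x. x \<in> U \<Longrightarrow> \<phi> (g x) = f x"
proof (rule covering_space_lift_strong[OF cov assms(3,2) _ _ assms(4) _ assms(6)])
  show "simply_connected U" using assms(1) by (rule convex_imp_simply_connected)
  show "locally path_connected U" using assms(1) by (rule convex_imp_locally_path_connected)
qed (use assms(5) that in \<open>auto simp: image_subset_iff_funcset\<close>)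

lemma lift_unique:
  fixes g1 g2 :: "'a::topological_space \<Rightarrow> complex"
  assumes "connected U" "a \<in> U" "g1 a = g2 a" "continuous_on U g1" "g1 ` U \<subseteq> ball 0 1"
    "continuous_on U g2" "g2 ` U \<subseteq> ball 0 1" "\<And>x. x \<in> U \<Longrightarrow> \<phi> (g1 x) = \<phi> (g2 x)" "x \<in> U"
  shows "g1 x = g2 x"
proof (rule covering_space_lift_unique[where ?g1.0 = g1 and ?g2.0 = g2 and a = a and T = U
    and f = "\<lambda>x. \<phi> (g1 x)", OF cov])
  show "continuous_on U (\<lambda>x. \<phi> (g1 x))"
    by (rule continuous_on_compose2[OF cont assms(4,5)])
qed (use assms in_domain in auto)

lemma near_omitted_value_imp_norm_gt:
  assumes "q \<notin> \<Omega>" "\<rho> < 1"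
  obtains d where "d > 0" "\<And>z. z \<in> ball 0 1 \<Longrightarrow> dist (\<phi> z) q < d \<Longrightarrow> \<rho> < norm z"
proof -
  have sub: "cball 0 \<rho> \<subseteq> ball (0::complex) 1" using assms by auto
  have "compact (\<phi> ` cball 0 \<rho>)"
    by (intro compact_continuous_image continuous_on_subset[OF cont sub] compact_cball)
  moreover have "q \<notin> \<phi> ` cball 0 \<rho>" using sub assms in_domain by blast
  ultimately obtain d where d: "d > 0" "\<And>x. x \<in> \<phi> ` cball 0 \<rho> \<Longrightarrow> d \<le> dist q x"
    using separate_point_closed compact_imp_closed by metis
  then show thesis by (intro that[of d]) (force simp: dist_commute not_less)+
qed

lemma small_image_imp_small_diameter:
  assumes q: "q \<notin> \<Omega>" and \<delta>: "\<delta> > 0"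
  obtains \<epsilon> where "\<epsilon> > 0"
    "\<And>C. path_connected C \<Longrightarrow> C \<subseteq> ball 0 1 \<Longrightarrow> \<phi> ` C \<subseteq> ball q \<epsilon> \<Longrightarrow> diameter C \<le> \<delta>"
proof -
  have "(\<lambda>z. \<phi> z - q) holomorphic_on ball 0 1" by (intro holomorphic_intros hol)
  moreover have "bounded ((\<lambda>z. \<phi> z - q) ` ball 0 1)"
    using bounded_translation_minus[OF bounded_image, of q] by (simp add: image_image)
  moreover have "\<not> (\<lambda>z. \<phi> z - q) constant_on ball 0 1"
    using nonconstant unfolding constant_on_def by (metis diff_add_cancel)
  ultimately obtain \<epsilon> \<rho> where \<epsilon>: "\<epsilon> > 0" "\<rho> < 1"
    "\<And>C. path_connected C \<Longrightarrow> (\<And>z. z \<in> C \<Longrightarrow> \<rho> < norm z \<and> norm z < 1 \<and> norm (\<phi> z - q) < \<epsilon>) \<Longrightarrow> diameter C \<le> \<delta>"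
    using Koebe_lemma[of "\<lambda>z. \<phi> z - q" \<delta>] \<delta> by metis
  obtain d where d: "d > 0" "\<And>z. z \<in> ball 0 1 \<Longrightarrow> dist (\<phi> z) q < d \<Longrightarrow> \<rho> < norm z"
    using near_omitted_value_imp_norm_gt[OF q \<epsilon>(2)] by metis
  show thesis
  proof (rule that[of "min d \<epsilon>"])
    fix C assume C: "path_connected C" "C \<subseteq> ball 0 1" "\<phi> ` C \<subseteq> ball q (min d \<epsilon>)"
    have "\<rho> < norm z \<and> norm z < 1 \<and> norm (\<phi> z - q) < \<epsilon>" if "z \<in> C" for z
    proof -
      have "z \<in> ball 0 1" "dist (\<phi> z) q < min d \<epsilon>" using that C(2,3) by (auto simp: dist_commute)
      then show ?thesis using d(2)[of z] by (simp add: dist_norm)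
    qed
    then show "diameter C \<le> \<delta>" by (rule \<epsilon>(3)[OF C(1)])
  qed (use d \<epsilon> in auto)
qed

lemma lift_end_cauchy:
  fixes s :: "real \<Rightarrow> complex"
  assumes s: "continuous_on {a<..<b} s" "a < b" "s ` {a<..<b} \<subseteq> ball 0 1"
    and lim: "((\<lambda>t. \<phi> (s t)) \<longlongrightarrow> q) (at_left b)" and q: "q \<notin> \<Omega>"
  shows "cauchy_filter (filtermap s (at_left b))"
  unfolding cauchy_filter_metric_filtermap
proof (intro allI impI)
  fix \<delta> :: real assume "\<delta> > 0"
  then obtain \<epsilon> where \<epsilon>: "\<epsilon> > 0"
    "\<And>C. path_connected C \<Longrightarrow> C \<subseteq> ball 0 1 \<Longrightarrow> \<phi> ` C \<subseteq> ball q \<epsilon> \<Longrightarrow> diameter C \<le> \<delta> / 2"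
    using small_image_imp_small_diameter[OF q half_gt_zero[OF \<open>\<delta> > 0\<close>]] by blast
  obtain b' where "b' < b" and near_q: "\<And>t. b' < t \<Longrightarrow> t < b \<Longrightarrow> \<phi> (s t) \<in> ball q \<epsilon>"
    using tendstoD[OF lim \<epsilon>(1)] unfolding eventually_at_left_field by (auto simp: dist_commute)
  define C where "C = s ` {max a b'<..<b}"
  have C_ball: "C \<subseteq> ball 0 1" using s(3) by (auto simp: C_def)
  have "\<phi> ` C \<subseteq> ball q \<epsilon>" unfolding C_def image_subset_iff using near_q by simp
  moreover have "path_connected C"
    unfolding C_def by (intro path_connected_continuous_image continuous_on_subset[OF s(1)])
      (auto intro: convex_imp_path_connected)
  ultimately have diameter: "diameter C \<le> \<delta> / 2"
    using \<epsilon>(2)[OF _ C_ball] by blast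
  have "dist (s t) (s t') < \<delta>" if "max a b' < t \<and> t < b" "max a b' < t' \<and> t' < b" for t t'
    using diameter_bounded_bound[of C "s t" "s t'"] bounded_subset[OF bounded_ball C_ball] diameter that \<open>\<delta> > 0\<close>
    by (auto simp: C_def)
  then show "\<exists>P. eventually P (at_left b) \<and> (\<forall>t t'. P t \<and> P t' \<longrightarrow> dist (s t) (s t') < \<delta>)"
    using \<open>b' < b\<close> s(2) unfolding eventually_at_left_field
    by (intro exI[of _ "\<lambda>t. max a b' < t \<and> t < b"]) (auto intro!: exI[of _ "max a b'"])
qed

lemma lift_end_converges:
  fixes s :: "real \<Rightarrow> complex"
  assumes s: "continuous_on {a<..<b} s" "a < b" "s ` {a<..<b} \<subseteq> ball 0 1"
    and lim: "((\<lambda>t. \<phi> (s t)) \<longlongrightarrow> q) (at_left b)" and q: "q \<notin> \<Omega>"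
  obtains \<beta> where "norm \<beta> = 1" "(s \<longlongrightarrow> \<beta>) (at_left b)"
proof -
  obtain \<beta> where \<beta>: "(s \<longlongrightarrow> \<beta>) (at_left b)"
    using cauchy_filter_complete_converges[OF lift_end_cauchy[OF s lim q], of UNIV]
    by (auto simp: filterlim_def complete_UNIV filtermap_bot_iff)
  have "\<forall>\<^sub>F t in at_left b. s t \<in> cball 0 1"
    by (rule eventually_at_leftI[OF _ s(2)]) (use s(3) in \<open>auto simp: image_subset_iff less_imp_le\<close>)
  then have "\<beta> \<in> cball 0 1"
    by (rule Lim_in_closed_set[OF closed_cball _ trivial_limit_at_left_real \<beta>])
  have "\<beta> \<notin> ball 0 1"
  proof
    assume "\<beta> \<in> ball 0 1"
    then have "((\<lambda>t. \<phi> (s t)) \<longlongrightarrow> \<phi> \<beta>) (at_left b)" using isCont_tendsto_compose[OF isCont \<beta>] by simp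
    then have "q = \<phi> \<beta>" using lim tendsto_unique trivial_limit_at_left_real by blast
    then show False using q in_domain[OF \<open>\<beta> \<in> ball 0 1\<close>] by simp
  qed
  then show thesis using that \<beta> \<open>\<beta> \<in> cball 0 1\<close> by simp
qed

lemma lift_start_converges:
  fixes s :: "real \<Rightarrow> complex"
  assumes s: "continuous_on {a<..<b} s" "a < b" "s ` {a<..<b} \<subseteq> ball 0 1"
    and lim: "((\<lambda>t. \<phi> (s t)) \<longlongrightarrow> q) (at_right a)" and q: "q \<notin> \<Omega>"
  obtains \<beta> where "norm \<beta> = 1" "(s \<longlongrightarrow> \<beta>) (at_right a)"
proof (rule lift_end_converges[of "- b" "- a" "\<lambda>t. s (- t)" q])
  show "continuous_on {- b<..<- a} (\<lambda>t. s (- t))"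
    by (rule continuous_on_compose2[OF s(1)]) (auto intro!: continuous_intros)
qed (use s lim q that in \<open>auto simp: filterlim_at_left_to_right\<close>)

lemma lift_limit_value_notin_domain:
  fixes s :: "real \<Rightarrow> complex"
  assumes s: "continuous_on {a<..<b} s" "a < b" "s ` {a<..<b} \<subseteq> ball 0 1"
    and lim: "((\<lambda>t. \<phi> (s t)) \<longlongrightarrow> q) (at_left b)" "(s \<longlongrightarrow> \<beta>) (at_left b)" and \<beta>: "norm \<beta> = 1"
  shows "q \<notin> \<Omega>"
proof
  assume "q \<in> \<Omega>"
  obtain m where m: "a < m" "m < b" using dense[OF s(2)] by blast
  define P where "P t = (if t \<le> m then \<phi> (s m) else if t \<ge> b then q else \<phi> (s t))" for t
  have cont_\<phi>s: "continuous_on {a<..<b} (\<lambda>t. \<phi> (s t))"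
    by (rule continuous_on_compose2[OF cont s(1,3)])
  have "continuous_on {m..b} P"
    unfolding P_def
  proof (rule continuous_on_Icc_extension[OF _ _ lim(1) m(2)])
    show "continuous_on {m<..<b} (\<lambda>t. \<phi> (s t))" using m(1) by (intro continuous_on_subset[OF cont_\<phi>s]) auto
    have "(\<lambda>t. \<phi> (s t)) \<midarrow>m\<rightarrow> \<phi> (s m)"
      using cont_\<phi>s m by (simp add: continuous_on_eq_continuous_at isCont_def)
    then show "((\<lambda>t. \<phi> (s t)) \<longlongrightarrow> \<phi> (s m)) (at_right m)" by (rule tendsto_within_subset) simp
  qed
  moreover have "P ` {m..b} \<subseteq> \<Omega>" using \<open>q \<in> \<Omega>\<close> s(3) m in_domain by (auto simp: P_def image_subset_iff)
  moreover have "s m \<in> ball 0 1" "P m = \<phi> (s m)" "m \<in> {m..b}"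
    using s(3) m by (auto simp: P_def image_subset_iff)
  ultimately obtain h where h: "continuous_on {m..b} h" "h ` {m..b} \<subseteq> ball 0 1" "h m = s m"
    "\<And>t. t \<in> {m..b} \<Longrightarrow> \<phi> (h t) = P t"
    using lift[of "{m..b}" m "s m" P] by auto
  have "h t = s t" if "t \<in> {m..<b}" for t
    by (rule lift_unique[where U = "{m..<b}" and a = m])
      (use that h s m in \<open>auto simp: P_def intro: continuous_on_subset\<close>)
  then have "\<forall>\<^sub>F t in at_left b. h t = s t"
    unfolding eventually_at_left_field using m by (intro exI[of _ m]) auto
  moreover have "(h \<longlongrightarrow> h b) (at_left b)" using continuous_on_Icc_at_leftD[OF h(1) m(2)] .
  ultimately have "(s \<longlongrightarrow> h b) (at_left b)" by (rule Lim_transform_eventually[rotated])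
  then have "h b = \<beta>" using lim(2) tendsto_unique trivial_limit_at_left_real by blast
  moreover have "h b \<in> ball 0 1" using h(2) m by (simp add: image_subset_iff)
  ultimately show False using \<beta> by simp
qed

definition deck :: "(complex \<Rightarrow> complex) \<Rightarrow> bool" where
  "deck T \<longleftrightarrow> T holomorphic_on ball 0 1 \<and> T ` ball 0 1 \<subseteq> ball 0 1 \<and> (\<forall>z\<in>ball 0 1. \<phi> (T z) = \<phi> z)"

lemma deck_exists:
  assumes "u \<in> ball 0 1" "v \<in> ball 0 1" "\<phi> u = \<phi> v"
  obtains T where "deck T" "T u = v"
proof -
  obtain T where T: "continuous_on (ball 0 1) T" "T ` ball 0 1 \<subseteq> ball 0 1" "T u = v"
    "\<And>x. x \<in> ball 0 1 \<Longrightarrow> \<phi> (T x) = \<phi> x"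
    using lift[OF convex_ball assms(1,2) cont _ assms(3)] image by blast
  moreover have "T holomorphic_on ball 0 1"
    by (rule covering_space_lift_is_holomorphic[OF cov open_ball hol hol]) (use T in_domain in auto)
  ultimately show thesis using that[of T] unfolding deck_def by blast
qed

lemma deck_eq:
  assumes "deck S" "deck T" "u \<in> ball 0 1" "S u = T u" "z \<in> ball 0 1"
  shows "S z = T z"
  by (rule lift_unique[where U = "ball 0 1" and a = u])
    (use assms in \<open>auto simp: deck_def holomorphic_on_imp_continuous_on\<close>)

lemma deck_ident: "deck (\<lambda>z. z)"
  by (simp add: deck_def)

lemma deck_compose:
  assumes "deck S" "deck T"
  shows "deck (\<lambda>z. S (T z))"
  using assms holomorphic_on_compose_gen[of T "ball 0 1" S "ball 0 1"]
  by (auto simp: deck_def o_def image_subset_iff)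

lemma deck_imp_disc_automorphism:
  assumes T: "deck T"
  obtains T' where "disc_automorphism T T'"
proof -
  have T0: "T 0 \<in> ball 0 1" "\<phi> (T 0) = \<phi> 0" using T by (auto simp: deck_def image_subset_iff)
  then obtain T' where T': "deck T'" "T' (T 0) = 0" using deck_exists[of "T 0" 0] by auto
  have "T' (T z) = z" "T (T' z) = z" if "z \<in> ball 0 1" for z
    using deck_eq[OF deck_compose[OF T'(1) T] deck_ident, of 0 z]
      deck_eq[OF deck_compose[OF T T'(1)] deck_ident, of "T 0" z] T0 T'(2) that by simp_all
  then show thesis using that[of T'] T T'(1) unfolding disc_automorphism_def deck_def by blast
qed

lemma deck_Moebius_exists:
  assumes "u \<in> ball 0 1" "v \<in> ball 0 1" "\<phi> u = \<phi> v" "u \<noteq> v"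
  obtains t w where "norm w < 1" "deck (Moebius_function t w)" "Moebius_function t w u = v"
    "\<And>z. z \<in> ball 0 1 \<Longrightarrow> Moebius_function t w z \<noteq> z"
proof -
  obtain T where T: "deck T" "T u = v" by (rule deck_exists[OF assms(1-3)])
  obtain T' where "disc_automorphism T T'" by (rule deck_imp_disc_automorphism[OF T(1)])
  then obtain t w where tw: "norm w < 1" "\<And>z. z \<in> ball 0 1 \<Longrightarrow> T z = Moebius_function t w z"
    using disc_automorphism_imp_Moebius by blast
  have "deck (Moebius_function t w)"
    using T(1) tw by (auto simp: deck_def Moebius_function_holomorphic image_subset_iff)
  moreover have "Moebius_function t w z \<noteq> z" if "z \<in> ball 0 1" for z
    using deck_eq[OF T(1) deck_ident that _ assms(1)] T(2) tw(2)[OF that] assms(4) by auto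
  ultimately show thesis using that tw T(2) assms(1) by metis
qed

lemma deck_half_plane_affine_invariant:
  assumes T: "half_plane_affine T \<beta> a b" "deck T" and y: "Re y > 0"
  shows "\<phi> (inverse_cayley \<beta> (of_real a * y + \<i> * of_real b)) = \<phi> (inverse_cayley \<beta> y)"
proof -
  define z where "z = inverse_cayley \<beta> y"
  have \<beta>: "norm \<beta> = 1" "\<beta> \<noteq> 0" using T(1) by (auto simp: half_plane_affine_def)
  have z: "z \<in> ball 0 1" unfolding z_def by (rule inverse_cayley_in_ball[OF \<beta>(1) y])
  have "cayley \<beta> z = y" unfolding z_def using y by (intro cayley_inverse_cayley \<beta>(2)) auto
  then have "T z \<in> ball 0 1" "cayley \<beta> (T z) = of_real a * y + \<i> * of_real b"
    using T(1) z by (auto simp: half_plane_affine_def)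
  moreover from this \<beta>(1) have "T z \<noteq> \<beta>" by auto
  ultimately have "inverse_cayley \<beta> (of_real a * y + \<i> * of_real b) = T z"
    using inverse_cayley_cayley[OF \<beta>(2), of "T z"] by simp
  moreover have "\<phi> (T z) = \<phi> z" using T(2) z by (simp add: deck_def)
  ultimately show ?thesis by (simp add: z_def)
qed

lemma holomorphic_on_inverse_cayley_compose:
  assumes "norm \<beta> = 1"
  shows "(\<lambda>y. \<phi> (inverse_cayley \<beta> y)) holomorphic_on right_half_plane"
proof -
  have "inverse_cayley \<beta> ` right_half_plane \<subseteq> ball 0 1" using inverse_cayley_in_ball[OF assms] by auto
  moreover have "inverse_cayley \<beta> holomorphic_on right_half_plane"
    by (rule holomorphic_on_inverse_cayley) simp
  ultimately show ?thesis using holomorphic_on_compose_gen[OF _ hol] by (simp add: o_def)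
qed

lemma parabolic_deck_factor:
  assumes T: "half_plane_affine T \<beta> 1 b" "b \<noteq> 0" "deck T"
  obtains F k where "F holomorphic_on ball 0 1" "F ` (ball 0 1 - {0}) \<subseteq> \<Omega>" "k > 0"
    "exp (- of_real k * (\<i> * of_real b)) = 1"
    "\<And>y. Re y > 0 \<Longrightarrow> \<phi> (inverse_cayley \<beta> y) = F (exp (- of_real k * y))"
proof -
  have \<beta>: "norm \<beta> = 1" using T(1) by (simp add: half_plane_affine_def)
  define f where "f y = \<phi> (inverse_cayley \<beta> y)" for y
  define k where "k = 2 * pi / \<bar>b\<bar>"
  have "k > 0" using T(2) by (simp add: k_def)
  have f_range: "f y \<in> \<Omega>" if "Re y > 0" for y
    unfolding f_def by (intro in_domain inverse_cayley_in_ball \<beta> that)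
  have f_period: "f (y + \<i> * of_real b) = f y" if "Re y > 0" for y
    using deck_half_plane_affine_invariant[OF T(1,3) that] by (simp add: f_def)
  have "f (y + \<i> * of_real \<bar>b\<bar>) = f y" if "Re y > 0" for y
    using f_period[of y] f_period[of "y + \<i> * of_real \<bar>b\<bar>"] that by (cases "b > 0") auto
  moreover have "bounded (f ` right_half_plane)"
    by (rule bounded_subset[OF bounded_domain]) (use f_range in auto)
  moreover have "f holomorphic_on right_half_plane"
    unfolding f_def by (rule holomorphic_on_inverse_cayley_compose[OF \<beta>])
  ultimately obtain F where F: "F holomorphic_on ball 0 1"
    "\<And>y. Re y > 0 \<Longrightarrow> f y = F (exp (- of_real k * y))"
    using vertical_periodic_factor[of f "\<bar>b\<bar>"] T(2) unfolding k_def by auto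
  have F_range: "F \<zeta> \<in> \<Omega>" if \<zeta>: "\<zeta> \<in> ball 0 1" "\<zeta> \<noteq> 0" for \<zeta>
  proof -
    define y where "y = - Ln \<zeta> / of_real k"
    have "Re y > 0" using \<zeta> \<open>k > 0\<close> by (simp add: y_def divide_neg_pos)
    moreover have "exp (- of_real k * y) = \<zeta>" using \<zeta> \<open>k > 0\<close> by (simp add: y_def)
    ultimately show ?thesis using F(2) f_range by metis
  qed
  have k_period: "exp (- of_real k * (\<i> * of_real b)) = 1"
    using T(2) by (auto simp: k_def abs_if exp_eq_1 intro: exI[of _ "- 1"])
  show thesis
    by (rule that[OF F(1) _ \<open>k > 0\<close> k_period F(2)[unfolded f_def]]) (use F_range in blast)
qed

end

section \<open>Components of the preimage of a simple closed curve\<close>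

locale disc_covering_radius = disc_covering +
  fixes \<alpha> p :: complex
  assumes norm_\<alpha>: "norm \<alpha> = 1"
    and radial_limit: "((\<lambda>r::real. \<phi> (of_real r * \<alpha>)) \<longlongrightarrow> p) (at_left 1)"
begin

lemma radius_in_ball: "0 \<le> r \<Longrightarrow> r < 1 \<Longrightarrow> of_real r * \<alpha> \<in> ball 0 1"
  using norm_\<alpha> by (simp add: norm_mult)

lemma radius_tendsto: "((\<lambda>r::real. of_real r * \<alpha>) \<longlongrightarrow> \<alpha>) (at_left 1)"
proof -
  have "((\<lambda>r::real. of_real r * \<alpha>) \<longlongrightarrow> of_real 1 * \<alpha>) (at_left 1)" by (intro tendsto_intros)
  then show ?thesis by simp
qed

lemma radial_limit_notin_domain: "p \<notin> \<Omega>"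
proof (rule lift_limit_value_notin_domain[of 0 1 "\<lambda>r. of_real r * \<alpha>", OF _ _ _ radial_limit _ norm_\<alpha>])
  show "continuous_on {0<..<1} (\<lambda>r. complex_of_real r * \<alpha>)" by (intro continuous_intros)
  show "((\<lambda>r::real. of_real r * \<alpha>) \<longlongrightarrow> \<alpha>) (at_left 1)" by (rule radius_tendsto)
qed (use radius_in_ball in auto)

end

locale disc_covering_curve = disc_covering_radius +
  fixes e :: "real \<Rightarrow> complex"
  assumes curve: "periodic_simple_curve e" and p_inside: "p \<in> inside (range e)"
begin

lemmas e_cont = periodic_simple_curve_continuous[OF curve]
  and e_eq_iff = periodic_simple_curve_eq_iff[OF curve]
  and e_shift = periodic_simple_curve_shift[OF curve]
  and path_image_e = path_image_periodic_simple_curve[OF curve]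
  and simple_path_e = simple_path_periodic_simple_curve[OF curve]

lemmas Jordan_e = Jordan_inside_outside[OF simple_path_e, unfolded path_image_e]

lemma e_ne_p: "e t \<noteq> p"
  using p_inside inside_no_overlap[of "range e"] by blast

definition preimage :: "complex set" where
  "preimage = ball 0 1 \<inter> \<phi> -` range e"

definition param_interval :: "real \<Rightarrow> real set" where
  "param_interval t = connected_component_set (e -` \<Omega>) t"

definition curve_lift :: "real \<Rightarrow> (real \<Rightarrow> complex) \<Rightarrow> bool" where
  "curve_lift t s \<longleftrightarrow> continuous_on (param_interval t) s \<and> s ` param_interval t \<subseteq> ball 0 1 \<and>
     (\<forall>x\<in>param_interval t. \<phi> (s x) = e x)"

lemma open_param_interval: "open (param_interval t)"
  unfolding param_interval_def using e_cont open_domain by (simp add: open_connected_component open_vimage)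

lemma connected_param_interval: "connected (param_interval t)"
  by (simp add: param_interval_def)

lemma convex_param_interval: "convex (param_interval t)"
  using connected_param_interval by (simp flip: is_interval_convex_1 add: is_interval_connected_1)

lemma param_interval_subset: "param_interval t \<subseteq> e -` \<Omega>"
  unfolding param_interval_def by (rule connected_component_subset)

lemma mem_param_interval_self: "t \<in> param_interval t \<longleftrightarrow> e t \<in> \<Omega>"
  by (simp add: param_interval_def)

lemma param_interval_eq: "x \<in> param_interval t \<Longrightarrow> param_interval x = param_interval t"
  unfolding param_interval_def by (metis connected_component_eq)

lemma param_interval_shift: "x + of_int n \<in> param_interval (t + of_int n) \<longleftrightarrow> x \<in> param_interval t"
proof -
  have shift: "x + of_int n \<in> param_interval (t + of_int n)" if "x \<in> param_interval t" for x t and n :: int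
  proof -
    have "connected ((\<lambda>x. x + of_int n) ` param_interval t)"
      by (intro connected_continuous_image connected_param_interval continuous_intros)
    moreover have "(\<lambda>x. x + of_int n) ` param_interval t \<subseteq> e -` \<Omega>"
      using param_interval_subset[of t] by (auto simp: e_shift)
    moreover have "t \<in> param_interval t"
      using that by (auto simp: param_interval_def connected_component_refl_eq dest: connected_component_in)
    ultimately show ?thesis
      using that unfolding param_interval_def[of "t + of_int n"] connected_component_def by blast
  qed
  show ?thesis
    using shift[of x t n] shift[of "x + of_int n" "t + of_int n" "- n"] by auto
qed

lemma curve_lift_exists:
  assumes "z \<in> ball 0 1" "\<phi> z = e t"
  obtains s where "curve_lift t s" "s t = z"
proof -
  have "t \<in> param_interval t" unfolding mem_param_interval_self assms(2)[symmetric]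
    by (rule in_domain[OF assms(1)])
  moreover have "e ` param_interval t \<subseteq> \<Omega>" using param_interval_subset by blast
  ultimately show thesis
    using lift[OF convex_param_interval _ assms(1) e_cont] assms(2) that unfolding curve_lift_def by metis
qed

lemma curve_lift_cong: "x \<in> param_interval t \<Longrightarrow> curve_lift t s \<longleftrightarrow> curve_lift x s"
  unfolding curve_lift_def using param_interval_eq by metis

lemma curve_lift_unique:
  assumes "curve_lift t s" "curve_lift t s'" "x \<in> param_interval t" "s x = s' x" "y \<in> param_interval t"
  shows "s y = s' y"
  by (rule lift_unique[where U = "param_interval t" and a = x and ?g1.0 = s and ?g2.0 = s'])
    (use assms connected_param_interval in \<open>auto simp: curve_lift_def\<close>)

lemma curve_lift_shift:
  assumes "curve_lift (t + of_int n) s"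
  shows "curve_lift t (\<lambda>x. s (x + of_int n))"
proof -
  have sub: "(\<lambda>x. x + of_int n) ` param_interval t \<subseteq> param_interval (t + of_int n)"
    by (simp add: image_subset_iff param_interval_shift)
  have s: "continuous_on (param_interval (t + of_int n)) s" "s ` param_interval (t + of_int n) \<subseteq> ball 0 1"
    "\<And>x. x \<in> param_interval (t + of_int n) \<Longrightarrow> \<phi> (s x) = e x"
    using assms by (auto simp: curve_lift_def)
  have "continuous_on (param_interval t) (\<lambda>x. s (x + of_int n))"
    by (rule continuous_on_compose2[OF s(1) _ sub]) (intro continuous_intros)
  moreover have "s (x + of_int n) \<in> ball 0 1" "\<phi> (s (x + of_int n)) = e x" if "x \<in> param_interval t" for x
    using s(2) s(3)[of "x + of_int n"] sub that e_shift[of x n] by (simp_all add: image_subset_iff)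
  ultimately show ?thesis by (simp add: curve_lift_def image_subset_iff)
qed

lemma curve_lift_images_eq:
  assumes s: "curve_lift t s" "x \<in> param_interval t" and s': "curve_lift t' s'" "y \<in> param_interval t'"
    and meet: "s x = s' y"
  shows "s ` param_interval t = s' ` param_interval t'"
proof -
  have "e x = e y" using assms by (metis curve_lift_def)
  then obtain n where "y - x = of_int n" by (metis Ints_cases e_eq_iff)
  then have y: "y = x + of_int n" by simp
  have "curve_lift x s" using s curve_lift_cong by blast
  moreover have "curve_lift x (\<lambda>v. s' (v + of_int n))"
    using s' curve_lift_cong[of y t' s'] unfolding y by (intro curve_lift_shift) blast
  moreover have "x \<in> param_interval x" using s(2) param_interval_eq by metis
  ultimately have "s v = s' (v + of_int n)" if "v \<in> param_interval x" for v
    using curve_lift_unique[of x s "\<lambda>v. s' (v + of_int n)" x v] meet y that by simp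
  then have "s ` param_interval x = (\<lambda>v. s' (v + of_int n)) ` param_interval x" by (rule image_cong[OF refl])
  also have "\<dots> = s' ` (\<lambda>v. v + of_int n) ` param_interval x" by (simp add: image_image)
  also have "(\<lambda>v. v + of_int n) ` param_interval x = param_interval y"
  proof (rule set_eqI)
    fix v
    have "v \<in> (\<lambda>v. v + of_int n) ` param_interval x \<longleftrightarrow> v - of_int n \<in> param_interval x"
      by (auto intro!: image_eqI[of _ _ "v - of_int n"])
    then show "v \<in> (\<lambda>v. v + of_int n) ` param_interval x \<longleftrightarrow> v \<in> param_interval y"
      using param_interval_shift[of "v - of_int n" n x] by (simp add: y)
  qed
  finally show ?thesis using param_interval_eq[OF s(2)] param_interval_eq[OF s'(2)] by simp
qed

lemma openin_curve_lift_image: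
  assumes s: "curve_lift t s"
  shows "openin (top_of_set preimage) (s ` param_interval t)"
proof (subst openin_subopen, intro ballI)
  fix z assume "z \<in> s ` param_interval t"
  then obtain x where x: "x \<in> param_interval t" "z = s x" by blast
  then have "z \<in> ball 0 1" "\<phi> z = e x" using s by (auto simp: curve_lift_def)
  then obtain N where N: "open N" "z \<in> N" "N \<subseteq> ball 0 1" "inj_on \<phi> N"
    using locally_injective by metis
  define J where "J = param_interval t \<inter> s -` N"
  have "open J"
    unfolding J_def using s open_param_interval N(1)
    by (intro continuous_open_preimage) (auto simp: curve_lift_def)
  then obtain U where U: "open U" "e ` J = range e \<inter> U"
    using open_map_periodic_simple_curve[OF curve] by (meson openin_open)
  have "open (N \<inter> \<phi> -` U)"
    using continuous_open_preimage[OF continuous_on_subset[OF cont N(3)] N(1) U(1)] .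
  moreover have "z \<in> N \<inter> \<phi> -` U"
    using x N(2) U(2) \<open>\<phi> z = e x\<close> by (auto simp: J_def)
  moreover have "preimage \<inter> (N \<inter> \<phi> -` U) \<subseteq> s ` param_interval t"
  proof
    fix v assume v: "v \<in> preimage \<inter> (N \<inter> \<phi> -` U)"
    then have "\<phi> v \<in> e ` J" using U(2) by (auto simp: preimage_def)
    then obtain y where y: "y \<in> J" "\<phi> v = e y" by blast
    then have "s y \<in> N" "\<phi> (s y) = \<phi> v" using s by (auto simp: J_def curve_lift_def)
    then have "v = s y" using inj_onD[OF N(4), of v "s y"] v by auto
    then show "v \<in> s ` param_interval t" using y(1) by (auto simp: J_def)
  qed
  moreover have "z \<in> preimage" using \<open>z \<in> ball 0 1\<close> \<open>\<phi> z = e x\<close> by (auto simp: preimage_def)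
  ultimately show "\<exists>T. openin (top_of_set preimage) T \<and> z \<in> T \<and> T \<subseteq> s ` param_interval t"
    by (intro exI[of _ "preimage \<inter> (N \<inter> \<phi> -` U)"]) (auto simp: openin_open_Int)
qed

lemma component_curve_lift:
  assumes C: "C \<in> components preimage" "z \<in> C"
  obtains t s where "e t \<in> \<Omega>" "curve_lift t s" "s t = z" "C = s ` param_interval t"
proof -
  have "z \<in> ball 0 1" "\<phi> z \<in> range e" using in_components_subset[OF C(1)] C(2) by (auto simp: preimage_def)
  then obtain t where t: "\<phi> z = e t" by auto
  have et: "e t \<in> \<Omega>" unfolding t[symmetric] by (rule in_domain[OF \<open>z \<in> ball 0 1\<close>])
  obtain s where s: "curve_lift t s" "s t = z" by (rule curve_lift_exists[OF \<open>z \<in> ball 0 1\<close> t])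
  define S where "S = s ` param_interval t"
  have z_S: "z \<in> S" using et s(2) mem_param_interval_self by (auto simp: S_def)
  have S_open: "openin (top_of_set preimage) S"
    unfolding S_def by (rule openin_curve_lift_image[OF s(1)])
  have "openin (top_of_set preimage) (preimage - S)"
  proof (subst openin_subopen, intro ballI)
    fix v assume v: "v \<in> preimage - S"
    then obtain t' where t': "v \<in> ball 0 1" "\<phi> v = e t'" by (auto simp: preimage_def)
    then obtain s' where s': "curve_lift t' s'" "s' t' = v" by (rule curve_lift_exists)
    have "e t' \<in> \<Omega>" unfolding t'(2)[symmetric] by (rule in_domain[OF t'(1)])
    then have v': "v \<in> s' ` param_interval t'" using s'(2) mem_param_interval_self by blast
    have "s' ` param_interval t' \<inter> S = {}"
    proof (rule ccontr)
      assume "s' ` param_interval t' \<inter> S \<noteq> {}"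
      then obtain x y where "x \<in> param_interval t" "y \<in> param_interval t'" "s x = s' y" by (force simp: S_def)
      then have "S = s' ` param_interval t'" unfolding S_def by (rule curve_lift_images_eq[OF s(1) _ s'(1)])
      then show False using v v' by blast
    qed
    moreover have "openin (top_of_set preimage) (s' ` param_interval t')"
      by (rule openin_curve_lift_image[OF s'(1)])
    moreover from this have "s' ` param_interval t' \<subseteq> preimage" by (rule openin_imp_subset)
    ultimately show "\<exists>T. openin (top_of_set preimage) T \<and> v \<in> T \<and> T \<subseteq> preimage - S"
      using v' by (intro exI[of _ "s' ` param_interval t'"]) auto
  qed
  then have S_clopen: "openin (top_of_set preimage) S" "closedin (top_of_set preimage) S"
    using S_open openin_imp_subset by (auto simp: closedin_def)
  have "connected S"
    unfolding S_def using s(1)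
    by (auto simp: curve_lift_def intro: connected_continuous_image connected_param_interval)
  then have "S \<in> components preimage"
    using connected_clopen_imp_component S_clopen z_S by blast
  then have "C = S" using components_eq[OF C(1)] C(2) z_S by blast
  then show thesis using that[OF et s] by (simp add: S_def)
qed

end

section \<open>Curves leaving the domain\<close>

context disc_covering_curve
begin

lemma no_bounding_loop:
  assumes c: "simple_path c" "pathfinish c = pathstart c" "path_image c \<subseteq> cball 0 1"
    and cluster: "\<And>u z y. \<lbrakk>\<And>n::nat. u n \<in> inside (path_image c); u \<longlonglongrightarrow> z; z \<in> path_image c;
        (\<lambda>n. \<phi> (u n)) \<longlonglongrightarrow> y\<rbrakk> \<Longrightarrow> y \<in> range e"
  shows False
proof -
  have inside: "inside (path_image c) \<subseteq> ball 0 1" by (rule simple_loop_inside_subset_ball[OF c(1,3)])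
  have "inside (path_image e) \<subseteq> \<phi> ` inside (path_image c)"
  proof (rule simple_loop_inside_subset_image[OF simple_path_e c(1,2) inside open_ball connected_ball
        hol nonconstant])
    show "bounded (\<phi> ` inside (path_image c))"
      by (rule bounded_subset[OF bounded_image image_mono[OF inside]])
  qed (use cluster path_image_e in blast)
  then have "p \<in> \<phi> ` ball 0 1" using p_inside inside unfolding path_image_e by blast
  then show False using radial_limit_notin_domain image by simp
qed

lemma cluster_value_interior:
  assumes "z \<in> ball 0 1" "u \<longlonglongrightarrow> z" "(\<lambda>n::nat. \<phi> (u n)) \<longlonglongrightarrow> y"
  shows "y = \<phi> z"
  using isCont_tendsto_compose[OF isCont[OF assms(1)] assms(2)] assms(3) LIMSEQ_unique by blast

lemma curve_lift_shortest_coincidence: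
  assumes s: "curve_lift t s" and "\<not> inj_on s (param_interval t)"
  obtains x y where "x < y" "{x..y} \<subseteq> param_interval t" "s x = s y"
    "\<And>u v. \<lbrakk>x \<le> u; u \<le> v; v \<le> y; s u = s v\<rbrakk> \<Longrightarrow> u = v \<or> u = x \<and> v = y"
proof -
  define coincidence where
    "coincidence n \<longleftrightarrow> 0 < n \<and>
      (\<exists>x\<in>param_interval t. x + of_nat n \<in> param_interval t \<and> s (x + of_nat n) = s x)" for n :: nat
  have coincidenceI: "\<exists>n. y = x + of_nat n \<and> (x = y \<or> coincidence n)"
    if xy: "x \<in> param_interval t" "y \<in> param_interval t" "s x = s y" "x \<le> y" for x y
  proof -
    have "e x = e y" using xy s by (metis curve_lift_def)
    then obtain k where "y - x = of_int k" by (metis Ints_cases e_eq_iff)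
    moreover from this have "k \<ge> 0" using xy(4) by linarith
    then obtain n where "k = int n" by (rule nonneg_int_cases)
    ultimately have "y = x + of_nat n" by simp
    then show ?thesis using xy by (intro exI[of _ n]) (auto simp: coincidence_def)
  qed
  obtain x y where "x \<in> param_interval t" "y \<in> param_interval t" "s x = s y" "x < y"
    using assms(2) unfolding inj_on_def by (metis linorder_neqE_linordered_idom)
  then have "\<exists>n. coincidence n" using coincidenceI[of x y] by auto
  define m where "m = (LEAST n. coincidence n)"
  have "coincidence m" and minimal: "\<And>n. coincidence n \<Longrightarrow> m \<le> n"
    unfolding m_def using \<open>\<exists>n. coincidence n\<close> by (auto intro: LeastI Least_le)
  then obtain x where x: "0 < m" "x \<in> param_interval t" "x + of_nat m \<in> param_interval t"
    "s (x + of_nat m) = s x"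
    by (auto simp: coincidence_def)
  have segment: "{x..x + of_nat m} \<subseteq> param_interval t"
    using closed_segment_subset[OF x(2,3) convex_param_interval] by (simp add: closed_segment_eq_real_ivl)
  have "u = v \<or> u = x \<and> v = x + of_nat m"
    if uv: "x \<le> u" "u \<le> v" "v \<le> x + of_nat m" "s u = s v" for u v
  proof -
    have "u \<in> param_interval t" "v \<in> param_interval t" using segment uv by auto
    then obtain n where n: "v = u + of_nat n" "u = v \<or> coincidence n"
      using coincidenceI uv by blast
    then show ?thesis using minimal[of n] uv by auto
  qed
  then show thesis using that[of x "x + of_nat m"] x segment by simp
qed

lemma curve_lift_injective:
  assumes s: "curve_lift t s"
  shows "inj_on s (param_interval t)"
proof (rule ccontr)
  assume "\<not> inj_on s (param_interval t)"
  then obtain x y where "x < y" and segment: "{x..y} \<subseteq> param_interval t" and "s x = s y"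
    and injective: "\<And>u v. \<lbrakk>x \<le> u; u \<le> v; v \<le> y; s u = s v\<rbrakk> \<Longrightarrow> u = v \<or> u = x \<and> v = y"
    using curve_lift_shortest_coincidence[OF s] by metis
  define l where "l = linepath x y"
  have l_eq: "l \<tau> = x + \<tau> * (y - x)" for \<tau>
    by (simp add: l_def linepath_def algebra_simps)
  have l: "l 0 = x" "l 1 = y" "mono l" "inj l"
    using \<open>x < y\<close> by (auto simp: l_eq mono_def inj_def mult_right_mono)
  have l_path: "path l" "path_image l = {x..y}"
    using \<open>x < y\<close> by (simp_all add: l_def closed_segment_eq_real_ivl)
  have "continuous_on {x..y} s"
    using s segment by (auto simp: curve_lift_def intro: continuous_on_subset)
  then have "path (s \<circ> l)" using l_path by (intro path_continuous_image) auto
  have l_inj: "\<sigma> = \<tau> \<or> \<sigma> = 0 \<and> \<tau> = 1"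
    if "\<sigma> \<in> {0..1}" "\<tau> \<in> {0..1}" "(s \<circ> l) \<sigma> = (s \<circ> l) \<tau>" "\<sigma> \<le> \<tau>" for \<sigma> \<tau>
    using injective[of "l \<sigma>" "l \<tau>"] that l(1,2) monoD[OF l(3)] injD[OF l(4)] by fastforce
  have "simple_path (s \<circ> l)"
    unfolding simple_path_def loop_free_def
  proof (intro conjI ballI impI \<open>path (s \<circ> l)\<close>)
    fix \<sigma> \<tau> :: real assume "\<sigma> \<in> {0..1}" "\<tau> \<in> {0..1}" "(s \<circ> l) \<sigma> = (s \<circ> l) \<tau>"
    then show "\<sigma> = \<tau> \<or> \<sigma> = 0 \<and> \<tau> = 1 \<or> \<sigma> = 1 \<and> \<tau> = 0"
      using l_inj[of \<sigma> \<tau>] l_inj[of \<tau> \<sigma>] by (cases "\<sigma> \<le> \<tau>") auto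
  qed
  moreover have "pathfinish (s \<circ> l) = pathstart (s \<circ> l)"
    using \<open>s x = s y\<close> l(1,2) by (simp add: pathfinish_def pathstart_def)
  moreover have c_ball: "path_image (s \<circ> l) \<subseteq> ball 0 1" and c_e: "\<phi> ` path_image (s \<circ> l) \<subseteq> range e"
    using s segment l_path(2) by (auto simp: path_image_compose curve_lift_def image_subset_iff subset_iff)
  then have "path_image (s \<circ> l) \<subseteq> cball 0 1" using ball_subset_cball by blast
  ultimately show False
    by (rule no_bounding_loop) (use cluster_value_interior c_ball c_e in blast)
qed

lemma param_interval_crossing:
  assumes et: "e t \<in> \<Omega>" and crossing: "\<not> range e \<subseteq> \<Omega>"
  obtains a b where "a < b" "param_interval t = {a<..<b}" "e a \<notin> \<Omega>" "e b \<notin> \<Omega>"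
proof -
  obtain u where u: "e u \<notin> \<Omega>" using crossing by blast
  have closed: "closed (- (e -` \<Omega>))"
    using open_vimage[OF open_domain] e_cont[of UNIV] by auto
  define A where "A = - (e -` \<Omega>) \<inter> {..t}"
  define B where "B = - (e -` \<Omega>) \<inter> {t..}"
  have "u + of_int \<lfloor>t - u\<rfloor> \<in> A" "u + of_int \<lceil>t - u\<rceil> \<in> B"
    using u by (simp_all add: A_def B_def e_shift) linarith+
  moreover have "closed A" "closed B" "bdd_above A" "bdd_below B" using closed by (auto simp: A_def B_def)
  ultimately have "Sup A \<in> A" "Inf B \<in> B" by (auto intro: closed_contains_Sup closed_contains_Inf)
  define a b where "a = Sup A" and "b = Inf B"
  have ab: "a < t" "t < b" "e a \<notin> \<Omega>" "e b \<notin> \<Omega>"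
    using \<open>Sup A \<in> A\<close> \<open>Inf B \<in> B\<close> et by (auto simp: a_def b_def A_def B_def less_le)
  have "e x \<in> \<Omega>" if "a < x" "x < b" for x
    using cSup_upper[OF _ \<open>bdd_above A\<close>, of x] cInf_lower[OF _ \<open>bdd_below B\<close>, of x] that
    by (fastforce simp: a_def b_def A_def B_def)
  then have "{a<..<b} \<subseteq> param_interval t"
    unfolding param_interval_def using ab by (intro connected_component_maximal) auto
  moreover have "param_interval t \<subseteq> {a<..<b}"
  proof
    fix x assume "x \<in> param_interval t"
    then have "closed_segment t x \<subseteq> param_interval t"
      using et by (intro closed_segment_subset convex_param_interval) (simp_all add: mem_param_interval_self)
    then have "a \<notin> closed_segment t x" "b \<notin> closed_segment t x"
      using ab param_interval_subset by blast+
    then show "x \<in> {a<..<b}" using ab by (auto simp: closed_segment_eq_real_ivl split: if_splits)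
  qed
  ultimately show thesis using that[of a b] ab by fastforce
qed

lemma crossing_lift_ends:
  assumes crossing: "\<not> range e \<subseteq> \<Omega>" and s: "curve_lift t s" "e t \<in> \<Omega>"
  obtains a b \<beta>0 \<beta>1 where "a < b" "param_interval t = {a<..<b}" "norm \<beta>0 = 1" "norm \<beta>1 = 1"
    "(s \<longlongrightarrow> \<beta>0) (at_right a)" "(s \<longlongrightarrow> \<beta>1) (at_left b)"
    "((\<lambda>t. \<phi> (s t)) \<longlongrightarrow> e a) (at_right a)" "((\<lambda>t. \<phi> (s t)) \<longlongrightarrow> e b) (at_left b)"
proof -
  obtain a b where ab: "a < b" "param_interval t = {a<..<b}" "e a \<notin> \<Omega>" "e b \<notin> \<Omega>"
    by (rule param_interval_crossing[OF s(2) crossing])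
  have s': "continuous_on {a<..<b} s" "s ` {a<..<b} \<subseteq> ball 0 1" "\<And>x. x \<in> {a<..<b} \<Longrightarrow> e x = \<phi> (s x)"
    using s(1) unfolding curve_lift_def ab(2) by auto
  have e_at: "(e \<longlongrightarrow> e x) (at x within A)" for x A
    using e_cont[of UNIV] by (meson UNIV_I continuous_on_def tendsto_within_subset subset_UNIV)
  have lim_a: "((\<lambda>t. \<phi> (s t)) \<longlongrightarrow> e a) (at_right a)"
    by (rule Lim_transform_eventually[OF e_at])
      (use ab(1) s'(3) in \<open>auto simp: eventually_at_right_field intro!: exI[of _ b]\<close>)
  have lim_b: "((\<lambda>t. \<phi> (s t)) \<longlongrightarrow> e b) (at_left b)"
    by (rule Lim_transform_eventually[OF e_at])
      (use ab(1) s'(3) in \<open>auto simp: eventually_at_left_field intro!: exI[of _ a]\<close>)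
  obtain \<beta>0 where \<beta>0: "norm \<beta>0 = 1" "(s \<longlongrightarrow> \<beta>0) (at_right a)"
    by (rule lift_start_converges[OF s'(1) ab(1) s'(2) lim_a ab(3)])
  obtain \<beta>1 where \<beta>1: "norm \<beta>1 = 1" "(s \<longlongrightarrow> \<beta>1) (at_left b)"
    by (rule lift_end_converges[OF s'(1) ab(1) s'(2) lim_b ab(4)])
  show thesis by (rule that[OF ab(1,2) \<beta>0(1) \<beta>1(1) \<beta>0(2) \<beta>1(2) lim_a lim_b])
qed

lemma end_value_product_tendsto_inside:
  fixes s :: "real \<Rightarrow> complex"
  assumes s: "continuous_on {a<..<b} s" "s ` {a<..<b} \<subseteq> ball 0 1" "a < b" and \<beta>: "norm \<beta> = 1"
    and lim: "((\<lambda>t. \<phi> (s t)) \<longlongrightarrow> u) (at_right a)" "((\<lambda>t. \<phi> (s t)) \<longlongrightarrow> v) (at_left b)"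
    and \<gamma>: "simple_path \<gamma>" "pathfinish \<gamma> = pathstart \<gamma>" "path_image \<gamma> = insert \<beta> (s ` {a<..<b})"
  shows "((\<lambda>z. (\<phi> z - u) * (\<phi> z - v)) \<longlongrightarrow> 0) (at \<beta> within inside (path_image \<gamma>))"
proof (rule Lindelof_inside[OF \<gamma>(1,2) _ \<beta>])
  let ?k = "\<lambda>z. (\<phi> z - u) * (\<phi> z - v)"
  show "path_image \<gamma> \<subseteq> insert \<beta> (ball 0 1)" using \<gamma>(3) s(2) by auto
  show "?k holomorphic_on ball 0 1" by (intro holomorphic_intros hol)
  have "compact ((\<lambda>y. (y - u) * (y - v)) ` closure (\<phi> ` ball 0 1))"
    by (intro compact_continuous_image continuous_intros) (simp add: compact_closure bounded_image)
  then show "bounded (?k ` ball 0 1)"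
    by (rule bounded_subset[OF compact_imp_bounded]) (use closure_subset in force)
  have "((\<lambda>t. ?k (s t)) \<longlongrightarrow> 0) (at_right a)" "((\<lambda>t. ?k (s t)) \<longlongrightarrow> 0) (at_left b)"
    using lim by (auto intro!: tendsto_eq_intros)
  moreover have "\<beta> \<notin> s ` {a<..<b}" using s(2) \<beta> by auto
  ultimately have "(?k \<longlongrightarrow> 0) (at \<beta> within s ` {a<..<b})"
    using tendsto_at_within_open_curve[OF s(1) _ _ _ s(3), where f = ?k] by blast
  then show "(?k \<longlongrightarrow> 0) (at \<beta> within path_image \<gamma>)"
    unfolding \<gamma>(3) by (simp add: at_within_def)
qed

text \<open>If both ends agreed, the product would tend to 0 along the loop, hence inside it by Lindelof's theorem.\<close>

lemma crossing_lift_ends_distinct: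
  fixes s :: "real \<Rightarrow> complex"
  assumes s: "continuous_on {a<..<b} s" "inj_on s {a<..<b}" "s ` {a<..<b} \<subseteq> preimage" and "a < b"
    and \<beta>: "norm \<beta>0 = 1" "norm \<beta>1 = 1" "(s \<longlongrightarrow> \<beta>0) (at_right a)" "(s \<longlongrightarrow> \<beta>1) (at_left b)"
    and lim: "((\<lambda>t. \<phi> (s t)) \<longlongrightarrow> e a) (at_right a)" "((\<lambda>t. \<phi> (s t)) \<longlongrightarrow> e b) (at_left b)"
  shows "\<beta>0 \<noteq> \<beta>1"
proof
  assume eq: "\<beta>0 = \<beta>1"
  have s_ball: "s ` {a<..<b} \<subseteq> ball 0 1" using s(3) by (auto simp: preimage_def)
  then have "\<beta>1 \<notin> s ` {a<..<b}" using \<beta>(2) by auto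
  then obtain \<gamma> where "path_image \<gamma> = insert \<beta>0 (insert \<beta>1 (s ` {a<..<b}))" "simple_path \<gamma>"
    "pathstart \<gamma> = \<beta>0" "pathfinish \<gamma> = \<beta>1"
    using open_interval_completion[OF \<open>a < b\<close> s(1,2) \<beta>(3,4)] eq by metis
  then have \<gamma>: "path_image \<gamma> = insert \<beta>1 (s ` {a<..<b})" "simple_path \<gamma>" "pathfinish \<gamma> = pathstart \<gamma>"
    using eq by auto
  note product_lim = end_value_product_tendsto_inside[OF s(1) s_ball \<open>a < b\<close> \<beta>(2) lim \<gamma>(2,3,1)]
  show False
  proof (rule no_bounding_loop[OF \<gamma>(2,3)])
    show "path_image \<gamma> \<subseteq> cball 0 1" using \<gamma>(1) s_ball \<beta>(2) by (auto simp: less_imp_le image_subset_iff)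
    fix u z y
    assume u: "\<And>n::nat. u n \<in> inside (path_image \<gamma>)" "u \<longlonglongrightarrow> z" "z \<in> path_image \<gamma>" "(\<lambda>n. \<phi> (u n)) \<longlonglongrightarrow> y"
    show "y \<in> range e"
    proof (cases "z = \<beta>1")
      case False
      then have "z \<in> preimage" using u(3) \<gamma>(1) s(3) by auto
      then show ?thesis using cluster_value_interior[OF _ u(2,4)] by (auto simp: preimage_def)
    next
      case True
      have "u n \<noteq> \<beta>1" for n using u(1)[of n] inside_no_overlap[of "path_image \<gamma>"] \<gamma>(1) by blast
      then have "filterlim u (at \<beta>1 within inside (path_image \<gamma>)) sequentially"
        using u(1,2) True by (simp add: filterlim_at)
      from filterlim_compose[OF product_lim this] have "(\<lambda>n. (\<phi> (u n) - e a) * (\<phi> (u n) - e b)) \<longlonglongrightarrow> 0" .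
      moreover have "(\<lambda>n. (\<phi> (u n) - e a) * (\<phi> (u n) - e b)) \<longlonglongrightarrow> (y - e a) * (y - e b)"
        using u(4) by (intro tendsto_intros)
      ultimately have "(y - e a) * (y - e b) = 0" using LIMSEQ_unique by blast
      then show ?thesis by auto
    qed
  qed
qed

lemma lift_ends_ne_\<alpha>:
  fixes s :: "real \<Rightarrow> complex"
  assumes s: "continuous_on {a<..<b} s" "a < b" "s ` {a<..<b} \<subseteq> ball 0 1"
  shows "\<lbrakk>((\<lambda>t. \<phi> (s t)) \<longlongrightarrow> e x) (at_right a); (s \<longlongrightarrow> \<beta>) (at_right a)\<rbrakk> \<Longrightarrow> \<beta> \<noteq> \<alpha>"
    and "\<lbrakk>((\<lambda>t. \<phi> (s t)) \<longlongrightarrow> e x) (at_left b); (s \<longlongrightarrow> \<beta>) (at_left b)\<rbrakk> \<Longrightarrow> \<beta> \<noteq> \<alpha>"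
proof -
  have "e x = p" if "((\<lambda>r::real. \<phi> (of_real r * \<alpha>)) \<longlongrightarrow> e x) (at_left 1)"
    using that radial_limit tendsto_unique trivial_limit_at_left_real by blast
  then show "\<lbrakk>((\<lambda>t. \<phi> (s t)) \<longlongrightarrow> e x) (at_right a); (s \<longlongrightarrow> \<beta>) (at_right a)\<rbrakk> \<Longrightarrow> \<beta> \<noteq> \<alpha>"
    "\<lbrakk>((\<lambda>t. \<phi> (s t)) \<longlongrightarrow> e x) (at_left b); (s \<longlongrightarrow> \<beta>) (at_left b)\<rbrakk> \<Longrightarrow> \<beta> \<noteq> \<alpha>"
    using Lindelof_radial_at_right[OF hol bounded_image norm_\<alpha> s(1,2), of "e x"]
      Lindelof_radial[OF hol bounded_image norm_\<alpha> s(1,2), of "e x"] s(3) e_ne_p by (auto simp: image_subset_iff)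
qed

lemma crossing_component_arc:
  assumes crossing: "\<not> range e \<subseteq> \<Omega>" and C: "C \<in> components preimage"
  shows "path_connected C \<and> (\<exists>\<gamma>. arc \<gamma> \<and> path_image \<gamma> = closure C) \<and> \<alpha> \<notin> closure C"
proof -
  obtain z where "z \<in> C" using in_components_nonempty[OF C] by blast
  then obtain t s where s: "e t \<in> \<Omega>" "curve_lift t s" "C = s ` param_interval t"
    using component_curve_lift[OF C] by metis
  obtain a b \<beta>0 \<beta>1 where ab: "a < b" "param_interval t = {a<..<b}"
    and \<beta>: "norm \<beta>0 = 1" "norm \<beta>1 = 1" "(s \<longlongrightarrow> \<beta>0) (at_right a)" "(s \<longlongrightarrow> \<beta>1) (at_left b)"
    and lim: "((\<lambda>t. \<phi> (s t)) \<longlongrightarrow> e a) (at_right a)" "((\<lambda>t. \<phi> (s t)) \<longlongrightarrow> e b) (at_left b)"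
    by (rule crossing_lift_ends[OF crossing s(2,1)])
  have cont_s: "continuous_on {a<..<b} s" and C_eq: "C = s ` {a<..<b}"
    using s(2,3) ab(2) by (auto simp: curve_lift_def)
  have inj_s: "inj_on s {a<..<b}" using curve_lift_injective[OF s(2)] ab(2) by simp
  have C_preimage: "s ` {a<..<b} \<subseteq> preimage" using in_components_subset[OF C] C_eq by simp
  then have C_ball: "s ` {a<..<b} \<subseteq> ball 0 1" by (auto simp: preimage_def)
  have "\<beta>0 \<noteq> \<beta>1"
    by (rule crossing_lift_ends_distinct[OF cont_s inj_s C_preimage ab(1) \<beta> lim])
  have "\<beta>0 \<notin> s ` {a<..<b}" "\<beta>1 \<notin> s ` {a<..<b}" using C_ball \<beta>(1,2) by auto
  then obtain \<gamma> where \<gamma>: "path_image \<gamma> = closure C" "path_image \<gamma> = insert \<beta>0 (insert \<beta>1 C)"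
    "simple_path \<gamma>" "pathstart \<gamma> = \<beta>0" "pathfinish \<gamma> = \<beta>1"
    using open_interval_completion[OF ab(1) cont_s inj_s \<beta>(3,4)] unfolding C_eq by metis
  then have "arc \<gamma>" using \<open>\<beta>0 \<noteq> \<beta>1\<close> by (simp add: arc_simple_path)
  have "\<alpha> \<notin> C" using C_ball norm_\<alpha> C_eq by auto
  moreover have "\<beta>0 \<noteq> \<alpha>" "\<beta>1 \<noteq> \<alpha>"
    using lift_ends_ne_\<alpha>[OF cont_s ab(1) C_ball] lim \<beta>(3,4) by blast+
  moreover have "closure C = insert \<beta>0 (insert \<beta>1 C)" using \<gamma>(1,2) by simp
  ultimately have "\<alpha> \<notin> closure C" by auto
  moreover have "path_connected C"
    unfolding C_eq by (intro path_connected_continuous_image cont_s convex_imp_path_connected) simp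
  ultimately show ?thesis using \<gamma>(1) \<open>arc \<gamma>\<close> by blast
qed

end

section \<open>Curves inside the domain\<close>

lemma (in disc_covering_radius) deck_fixing_\<alpha>_parabolic:
  assumes T: "half_plane_affine T \<alpha> a b" "deck T"
  shows "a = 1"
proof (rule ccontr)
  assume "a \<noteq> 1"
  have "p \<in> (\<lambda>y. \<phi> (inverse_cayley \<alpha> y)) ` right_half_plane"
  proof (rule affine_invariant_limit[OF _ _ _ \<open>a \<noteq> 1\<close>])
    show "continuous_on right_half_plane (\<lambda>y. \<phi> (inverse_cayley \<alpha> y))"
      by (intro holomorphic_on_imp_continuous_on holomorphic_on_inverse_cayley_compose norm_\<alpha>)
    have "filterlim (\<lambda>x::real. (x - 1) / (x + 1)) (at_left 1) at_top" by real_asymp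
    from filterlim_compose[OF radial_limit this]
    show "((\<lambda>x::real. \<phi> (inverse_cayley \<alpha> (of_real x))) \<longlongrightarrow> p) at_top"
      by (simp add: inverse_cayley_def mult.commute)
  qed (use deck_half_plane_affine_invariant[OF T] T(1) in \<open>auto simp: half_plane_affine_def\<close>)
  then have "p \<in> \<Omega>" using inverse_cayley_in_ball[OF norm_\<alpha>] in_domain by auto
  then show False using radial_limit_notin_domain by simp
qed

context disc_covering_curve
begin

lemma interior_param_interval: "range e \<subseteq> \<Omega> \<Longrightarrow> param_interval t = UNIV"
  unfolding param_interval_def by (simp add: image_subset_iff connected_component_UNIV[symmetric] vimage_def)

lemma interior_component_orbit:
  assumes interior: "range e \<subseteq> \<Omega>" and C: "C \<in> components preimage"
  obtains s t w where "norm w < 1" "deck (Moebius_function t w)" "\<And>z. z \<in> ball 0 1 \<Longrightarrow> Moebius_function t w z \<noteq> z"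
    "orbit_curve (Moebius_function t w) s" "curve_lift 0 s" "C = range s"
proof -
  note UNIV = interior_param_interval[OF interior]
  obtain z where "z \<in> C" using in_components_nonempty[OF C] by blast
  then obtain t' s where "curve_lift t' s" and "C = s ` param_interval t'"
    by (rule component_curve_lift[OF C])
  then have lift: "curve_lift 0 s" and "C = range s" by (simp_all add: UNIV curve_lift_def)
  then have s: "continuous_on UNIV s" "\<And>x. s x \<in> ball 0 1" "\<And>x. \<phi> (s x) = e x" "inj s"
    using curve_lift_injective[OF lift] by (auto simp: UNIV curve_lift_def image_subset_iff)
  have period: "e (x + 1) = e x" for x using e_shift[of x 1] by simp
  have "\<phi> (s 0) = \<phi> (s 1)" "s 0 \<noteq> s 1" using period[of 0] s(3) injD[OF s(4), of 0 1] by auto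
  then obtain t w where tw: "norm w < 1" "deck (Moebius_function t w)" "Moebius_function t w (s 0) = s 1"
    "\<And>z. z \<in> ball 0 1 \<Longrightarrow> Moebius_function t w z \<noteq> z"
    using deck_Moebius_exists[OF s(2) s(2)] by metis
  have "s (x + 1) = Moebius_function t w (s x)" for x
  proof (rule lift_unique[where U = UNIV and a = 0 and ?g1.0 = "\<lambda>x. s (x + 1)"
        and ?g2.0 = "\<lambda>x. Moebius_function t w (s x)"])
    show "continuous_on UNIV (\<lambda>x. s (x + 1))"
      by (rule continuous_on_compose2[OF s(1)]) (auto intro!: continuous_intros)
    show "continuous_on UNIV (\<lambda>x. Moebius_function t w (s x))"
      by (rule continuous_on_compose2[OF continuous_on_Moebius_function[OF tw(1)] s(1)])
        (use s(2) in \<open>simp add: image_subset_iff less_imp_le\<close>)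
  qed (use s tw(2,3) period in \<open>auto simp: deck_def image_subset_iff\<close>)
  then have "orbit_curve (Moebius_function t w) s" using s(1) by (simp add: orbit_curve_def)
  then show thesis using that[OF tw(1,2,4)] lift \<open>C = range s\<close> by blast
qed

text \<open>
  The orbit descends to a Jordan curve in the disc of the exponential coordinate, in which
  the quotient of the covering map extends holomorphically over the origin.
\<close>

lemma parabolic_orbit_lift_imp_inside_subset:
  assumes interior: "range e \<subseteq> \<Omega>" and T: "half_plane_affine T \<beta> 1 b" "b \<noteq> 0" "deck T"
    and s: "orbit_curve T s" "curve_lift 0 s"
  shows "inside (range e) - {p} \<subseteq> \<Omega>"
proof -
  have s_ball: "range s \<subseteq> ball 0 1" and \<phi>_s: "\<And>x. \<phi> (s x) = e x"
    using s(2) by (auto simp: interior_param_interval[OF interior] curve_lift_def)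
  note orbit = half_plane_orbit[OF T(1) s(1) s_ball]
  obtain F k where F: "F holomorphic_on ball 0 1" "F ` (ball 0 1 - {0}) \<subseteq> \<Omega>"
    and k: "k > 0" "exp (- of_real k * (\<i> * of_real b)) = 1"
    and factor: "\<And>y. Re y > 0 \<Longrightarrow> \<phi> (inverse_cayley \<beta> y) = F (exp (- of_real k * y))"
    by (rule parabolic_deck_factor[OF T]) blast
  define J where "J x = exp (- of_real k * cayley \<beta> (s x))" for x
  have F_J: "F (J x) = e x" for x
    using factor[OF orbit(2)] orbit(4) \<phi>_s by (simp add: J_def)
  have "J (x + 1) = J x" for x
  proof -
    have "J (x + 1) = J x * exp (- of_real k * (\<i> * of_real b))"
      unfolding J_def orbit(3) by (simp add: ring_distribs flip: exp_add)
    then show ?thesis by (simp only: k(2) mult_1_right)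
  qed
  moreover have "continuous_on UNIV J" unfolding J_def by (intro continuous_intros orbit(1))
  ultimately have J: "periodic_simple_curve J" using periodic_simple_curve_factor[OF curve] F_J by blast
  have J_ball: "range J \<subseteq> ball 0 1" using orbit(2) k(1) by (auto simp: J_def)
  have "frac (1 / 2 :: real) \<noteq> 0" by (simp add: frac_eq[THEN iffD2])
  then have "e (1 / 2) \<noteq> e 0" by (simp add: e_eq_iff flip: frac_eq_0_iff)
  then have "\<not> F constant_on ball 0 1"
    using J_ball F_J unfolding constant_on_def by (metis rangeI subsetD)
  then have "inside (range e) \<subseteq> F ` inside (range J)"
    using simple_loop_inside_subset_holomorphic_image[OF simple_path_e
      simple_path_periodic_simple_curve[OF J] _ F(1)]
      J_ball F_J by (simp add: path_image_e path_image_periodic_simple_curve[OF J] image_subset_iff)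
  moreover have "inside (range J) \<subseteq> ball 0 1"
    using simple_loop_inside_subset_ball[OF simple_path_periodic_simple_curve(1)[OF J],
        unfolded path_image_periodic_simple_curve[OF J]]
      order_trans[OF J_ball ball_subset_cball] by blast
  ultimately have "inside (range e) \<subseteq> insert (F 0) \<Omega>" using F(2) by blast
  moreover from this have "p = F 0" using p_inside radial_limit_notin_domain by blast
  ultimately show ?thesis by blast
qed

lemma interior_deck_hyperbolic:
  assumes interior: "range e \<subseteq> \<Omega>" and p: "p islimpt frontier \<Omega>"
    and T: "half_plane_affine T \<beta> a b" "deck T" "T 0 \<noteq> 0" and s: "orbit_curve T s" "curve_lift 0 s"
  shows "a \<noteq> 1" "\<beta> \<noteq> \<alpha>"
proof -
  show "a \<noteq> 1"
  proof
    assume "a = 1"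
    then have "b \<noteq> 0" using half_plane_affine_nontrivial[OF T(1), of 0] T(3) by simp
    then have "inside (range e) - {p} \<subseteq> \<Omega>"
      using parabolic_orbit_lift_imp_inside_subset[OF interior _ _ T(2) s] T(1) \<open>a = 1\<close> by blast
    then have "inside (range e) \<inter> frontier \<Omega> \<subseteq> {p}"
      using open_domain by (auto simp: frontier_def interior_open)
    moreover have "open (inside (range e))" using open_inside Jordan_e by blast
    ultimately show False using p p_inside unfolding islimpt_def by blast
  qed
  then show "\<beta> \<noteq> \<alpha>" using deck_fixing_\<alpha>_parabolic T(1,2) by blast
qed

lemma interior_component_arc:
  assumes interior: "range e \<subseteq> \<Omega>" and p: "p islimpt frontier \<Omega>" and C: "C \<in> components preimage"
  shows "path_connected C \<and> (\<exists>\<gamma>. arc \<gamma> \<and> path_image \<gamma> = closure C) \<and> \<alpha> \<notin> closure C"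
proof -
  obtain s t w where w: "norm w < 1" and deck: "deck (Moebius_function t w)"
    and no_fixpoint: "\<And>z. z \<in> ball 0 1 \<Longrightarrow> Moebius_function t w z \<noteq> z"
    and s: "orbit_curve (Moebius_function t w) s" "curve_lift 0 s" "C = range s"
    by (rule interior_component_orbit[OF interior C]) blast
  have inj_s: "inj s" and C_ball: "range s \<subseteq> ball 0 1" and cont_s: "continuous_on UNIV s"
    using curve_lift_injective[OF s(2)] s(2) by (auto simp: interior_param_interval[OF interior] curve_lift_def)
  have hyperbolic: "a \<noteq> 1" "\<beta> \<noteq> \<alpha>" if "half_plane_affine (Moebius_function t w) \<beta> a b" for \<beta> a b
    using interior_deck_hyperbolic[OF interior p that deck _ s(1,2)] no_fixpoint[of 0] by auto
  obtain \<beta> a b where affine: "half_plane_affine (Moebius_function t w) \<beta> a b" "a \<noteq> 1 \<or> b \<noteq> 0"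
    using fixpoint_free_Moebius_function_half_plane_affine[OF w no_fixpoint] by blast
  then obtain \<beta>0 \<beta>1 where ends: "norm \<beta>0 = 1" "norm \<beta>1 = 1" "\<beta>0 \<noteq> \<beta>1" "(s \<longlongrightarrow> \<beta>0) at_bot" "(s \<longlongrightarrow> \<beta>1) at_top"
    using half_plane_affine_orbit_ends[OF affine] hyperbolic(1)[OF affine(1)] s(1) C_ball by metis
  have "\<beta>0 \<notin> range s" "\<beta>1 \<notin> range s" using C_ball ends(1,2) by auto
  then obtain \<gamma> where \<gamma>: "path_image \<gamma> = closure C" "path_image \<gamma> = insert \<beta>0 (insert \<beta>1 C)"
    "simple_path \<gamma>" "pathstart \<gamma> = \<beta>0" "pathfinish \<gamma> = \<beta>1"
    using line_completion[OF cont_s inj_s ends(4,5)] unfolding s(3) by metis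
  then have "arc \<gamma>" using ends(3) by (simp add: arc_simple_path)
  have "Moebius_function t w \<alpha> \<noteq> \<alpha>"
    using Moebius_function_half_plane_affine[OF w norm_\<alpha>] hyperbolic(2) by metis
  moreover have "Moebius_function t w \<beta>0 = \<beta>0" "Moebius_function t w \<beta>1 = \<beta>1"
    using orbit_limit_fixed[OF s(1) _ continuous_on_Moebius_function[OF w]] C_ball ends
    by (auto simp: subset_iff less_imp_le)
  moreover have "\<alpha> \<notin> C" using C_ball norm_\<alpha> s(3) by auto
  moreover have "closure C = insert \<beta>0 (insert \<beta>1 C)" using \<gamma>(1,2) by simp
  ultimately have "\<alpha> \<notin> closure C" by auto
  moreover have "path_connected C"
    unfolding s(3) by (intro path_connected_continuous_image cont_s convex_imp_path_connected) simp
  ultimately show ?thesis using \<gamma>(1) \<open>arc \<gamma>\<close> by blast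
qed

end

section \<open>Isolated radial limits\<close>

lemma norm_exp_less_iff:
  fixes x :: complex
  assumes "\<epsilon> > 0"
  shows "norm (exp x) < \<epsilon> \<longleftrightarrow> Re x < ln \<epsilon>"
  using assms by (metis exp_less_cancel_iff exp_ln norm_exp_eq_Re)

context disc_covering_radius
begin

definition puncture_lift :: "real \<Rightarrow> (complex \<Rightarrow> complex) \<Rightarrow> bool" where
  "puncture_lift \<epsilon> \<psi> \<longleftrightarrow> continuous_on {x. Re x < ln \<epsilon>} \<psi> \<and> \<psi> ` {x. Re x < ln \<epsilon>} \<subseteq> ball 0 1 \<and>
     (\<forall>x. Re x < ln \<epsilon> \<longrightarrow> \<phi> (\<psi> x) = p + exp x)"

lemma puncture_lift_unique:
  assumes "puncture_lift \<epsilon> \<psi>" "puncture_lift \<epsilon> \<psi>'" "Re a < ln \<epsilon>" "\<psi> a = \<psi>' a" "Re x < ln \<epsilon>"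
  shows "\<psi> x = \<psi>' x"
  by (rule lift_unique[where U = "{x. Re x < ln \<epsilon>}" and a = a and ?g1.0 = \<psi> and ?g2.0 = \<psi>'])
    (use assms convex_halfspace_Re_lt[THEN convex_connected] in \<open>auto simp: puncture_lift_def\<close>)

lemma puncture_lift_translate:
  assumes "puncture_lift \<epsilon> \<psi>" "exp \<kappa> = 1"
  shows "puncture_lift \<epsilon> (\<lambda>x. \<psi> (x + \<kappa>))"
proof -
  have Re: "Re \<kappa> = 0" using assms(2) by (simp add: exp_eq_1)
  have "continuous_on {x. Re x < ln \<epsilon>} (\<lambda>x. \<psi> (x + \<kappa>))"
    by (rule continuous_on_compose2[of "{x. Re x < ln \<epsilon>}" \<psi>])
      (use assms(1) Re in \<open>auto simp: puncture_lift_def intro!: continuous_intros\<close>)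
  moreover have "\<psi> (x + \<kappa>) \<in> ball 0 1" "\<phi> (\<psi> (x + \<kappa>)) = p + exp x" if "Re x < ln \<epsilon>" for x
  proof -
    have "Re (x + \<kappa>) < ln \<epsilon>" using that Re by simp
    then have "\<psi> (x + \<kappa>) \<in> ball 0 1" "\<phi> (\<psi> (x + \<kappa>)) = p + exp (x + \<kappa>)"
      using assms(1) unfolding puncture_lift_def by blast+
    then show "\<psi> (x + \<kappa>) \<in> ball 0 1" "\<phi> (\<psi> (x + \<kappa>)) = p + exp x"
      by (simp_all add: exp_add assms(2))
  qed
  ultimately show ?thesis by (auto simp: puncture_lift_def)
qed

lemma puncture_lift_deck:
  assumes "puncture_lift \<epsilon> \<psi>" "deck T"
  shows "puncture_lift \<epsilon> (\<lambda>x. T (\<psi> x))"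
proof -
  have "continuous_on (ball 0 1) T" using assms(2) by (simp add: deck_def holomorphic_on_imp_continuous_on)
  then have "continuous_on {x. Re x < ln \<epsilon>} (\<lambda>x. T (\<psi> x))"
    by (rule continuous_on_compose2) (use assms(1) in \<open>auto simp: puncture_lift_def\<close>)
  then show ?thesis using assms by (auto simp: puncture_lift_def deck_def image_subset_iff)
qed

lemma puncture_lift_along_radius:
  assumes puncture: "\<epsilon> > 0" "ball p \<epsilon> - {p} \<subseteq> \<Omega>"
    and r0: "0 \<le> r0" "r0 < 1" "\<And>r::real. r0 < r \<Longrightarrow> r < 1 \<Longrightarrow> \<phi> (of_real r * \<alpha>) \<in> ball p \<epsilon>"
  obtains \<psi> where "puncture_lift \<epsilon> \<psi>"
    "(\<lambda>r::real. of_real r * \<alpha>) ` {r0<..<1} \<subseteq> \<psi> ` {x. Re x < ln \<epsilon>}"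
proof -
  define H where "H = {x. Re x < ln \<epsilon>}"
  define R where "R r = of_real r * \<alpha>" for r :: real
  have H_iff: "x \<in> H \<longleftrightarrow> norm (exp x) < \<epsilon>" for x
    using norm_exp_less_iff[OF puncture(1)] by (simp add: H_def)
  have R: "continuous_on {r0<..<1} R" "R ` {r0<..<1} \<subseteq> ball 0 1"
    using r0(1) radius_in_ball by (auto simp: R_def intro!: continuous_intros)
  have R_ne: "\<phi> (R r) - p \<noteq> 0" if "r \<in> {r0<..<1}" for r
    using in_domain[of "R r"] R(2) radial_limit_notin_domain that by (auto simp: image_subset_iff)
  have "continuous_on {r0<..<1} (\<lambda>r. \<phi> (R r) - p)"
    by (intro continuous_intros continuous_on_compose2[OF cont R])
  moreover have "contractible {r0<..<1}" by (intro convex_imp_contractible convex_real_interval)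
  ultimately obtain l where l: "continuous_on {r0<..<1} l" "\<And>r. r \<in> {r0<..<1} \<Longrightarrow> \<phi> (R r) - p = exp (l r)"
    using continuous_logarithm_on_contractible R_ne by blast
  have "l r \<in> H" if "r \<in> {r0<..<1}" for r
    using r0(3)[of r] that unfolding H_iff l(2)[OF that, symmetric]
    by (simp add: R_def dist_norm norm_minus_commute)
  then have l_H: "l ` {r0<..<1} \<subseteq> H" by blast
  obtain r1 where r1: "r0 < r1" "r1 < 1" using dense[OF r0(2)] by blast
  obtain \<psi> where \<psi>: "continuous_on H \<psi>" "\<psi> ` H \<subseteq> ball 0 1" "\<psi> (l r1) = R r1" "\<And>x. x \<in> H \<Longrightarrow> \<phi> (\<psi> x) = p + exp x"
  proof (rule lift[of H "l r1" "R r1" "\<lambda>x. p + exp x"])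
    show "convex H" unfolding H_def by (rule convex_halfspace_Re_lt)
    show "(\<lambda>x. p + exp x) ` H \<subseteq> \<Omega>" using puncture(2) by (auto simp: H_iff dist_norm)
    show "p + exp (l r1) = \<phi> (R r1)" using l(2)[of r1] r1 by (simp add: algebra_simps)
  qed (use r1 R(2) l_H in \<open>auto simp: image_subset_iff intro!: continuous_intros\<close>)
  have "\<psi> (l r) = R r" if "r \<in> {r0<..<1}" for r
  proof (rule lift_unique[where U = "{r0<..<1}" and a = r1 and ?g1.0 = "\<lambda>r. \<psi> (l r)" and ?g2.0 = R])
    show "continuous_on {r0<..<1} (\<lambda>r. \<psi> (l r))" by (rule continuous_on_compose2[OF \<psi>(1) l(1) l_H])
  qed (use that r1 \<psi> R l l_H in \<open>auto simp: image_subset_iff simp flip: l(2)\<close>)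
  then have "R ` {r0<..<1} \<subseteq> \<psi> ` H" using l_H by (metis image_subset_iff imageI)
  then show thesis using that[of \<psi>] \<psi> by (simp add: puncture_lift_def H_def R_def[abs_def])
qed

lemma puncture_lift_oscillation:
  assumes \<psi>: "puncture_lift \<epsilon> \<psi>" "\<epsilon> > 0" and \<delta>: "\<delta> > 0"
  obtains \<eta> where "0 < \<eta>" "\<eta> \<le> \<epsilon>" "\<And>x y. Re x < ln \<eta> \<Longrightarrow> Re y < ln \<eta> \<Longrightarrow> dist (\<psi> x) (\<psi> y) \<le> \<delta>"
proof -
  obtain \<epsilon>' where \<epsilon>': "\<epsilon>' > 0"
    "\<And>C. path_connected C \<Longrightarrow> C \<subseteq> ball 0 1 \<Longrightarrow> \<phi> ` C \<subseteq> ball p \<epsilon>' \<Longrightarrow> diameter C \<le> \<delta>"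
    using small_image_imp_small_diameter[OF radial_limit_notin_domain \<delta>] by blast
  define \<eta> where "\<eta> = min \<epsilon> \<epsilon>'"
  have \<eta>: "\<eta> > 0" "\<eta> \<le> \<epsilon>" "\<eta> \<le> \<epsilon>'" using \<psi>(2) \<epsilon>'(1) by (auto simp: \<eta>_def)
  define H where "H = {x. Re x < ln \<eta>}"
  have "ln \<eta> \<le> ln \<epsilon>" using \<eta>(1,2) by simp
  then have "H \<subseteq> {x. Re x < ln \<epsilon>}" by (auto simp: H_def)
  then have \<psi>_H: "continuous_on H \<psi>" "\<psi> ` H \<subseteq> ball 0 1" "\<And>x. x \<in> H \<Longrightarrow> \<phi> (\<psi> x) = p + exp x"
    using \<psi>(1) unfolding puncture_lift_def by (auto intro: continuous_on_subset)
  have "diameter (\<psi> ` H) \<le> \<delta>"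
  proof (rule \<epsilon>'(2))
    show "path_connected (\<psi> ` H)"
      using \<psi>_H(1) unfolding H_def
      by (intro path_connected_continuous_image convex_imp_path_connected convex_halfspace_Re_lt)
    have "norm (exp x) < \<epsilon>'" if "x \<in> H" for x
      using that \<eta>(3) norm_exp_less_iff[OF \<eta>(1), of x] by (simp add: H_def)
    then show "\<phi> ` \<psi> ` H \<subseteq> ball p \<epsilon>'" using \<psi>_H(3) by (auto simp: dist_norm)
  qed (rule \<psi>_H)
  then have "dist (\<psi> x) (\<psi> y) \<le> \<delta>" if "x \<in> H" "y \<in> H" for x y
    using diameter_bounded_bound[of "\<psi> ` H"] bounded_subset[OF bounded_ball \<psi>_H(2)] that by fastforce
  then show thesis using that \<eta>(1,2) by (simp add: H_def)
qed

lemma puncture_lift_tendsto: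
  assumes \<psi>: "puncture_lift \<epsilon> \<psi>" "\<epsilon> > 0"
    and radius: "\<forall>\<^sub>F r in at_left (1::real). of_real r * \<alpha> \<in> \<psi> ` {x. Re x < ln \<epsilon>}"
  shows "(\<psi> \<longlongrightarrow> \<alpha>) (filtercomap Re at_bot)"
proof (rule tendstoI)
  fix \<delta> :: real assume "\<delta> > 0"
  then have \<delta>: "\<delta> / 2 > 0" by simp
  obtain \<eta> where \<eta>: "0 < \<eta>" "\<eta> \<le> \<epsilon>"
    and close: "\<And>x y. Re x < ln \<eta> \<Longrightarrow> Re y < ln \<eta> \<Longrightarrow> dist (\<psi> x) (\<psi> y) \<le> \<delta> / 2"
    using puncture_lift_oscillation[OF \<psi> \<delta>] by metis
  have "\<forall>\<^sub>F r in at_left (1::real). dist (of_real r * \<alpha>) \<alpha> < \<delta> / 2"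
    by (rule tendstoD[OF radius_tendsto \<delta>])
  moreover have "\<forall>\<^sub>F r in at_left (1::real). dist (\<phi> (of_real r * \<alpha>)) p < \<eta>"
    by (rule tendstoD[OF radial_limit \<eta>(1)])
  ultimately have "\<forall>\<^sub>F r in at_left (1::real). \<exists>y. Re y < ln \<eta> \<and> dist (\<psi> y) \<alpha> < \<delta> / 2"
    using radius
  proof eventually_elim
    case (elim r)
    then obtain y where y: "Re y < ln \<epsilon>" "of_real r * \<alpha> = \<psi> y" by blast
    then have "\<phi> (of_real r * \<alpha>) = p + exp y" using \<psi>(1) by (simp add: puncture_lift_def)
    then have "norm (exp y) < \<eta>" using elim(2) by (simp add: dist_norm)
    then show ?case using elim(1) y(2) norm_exp_less_iff[OF \<eta>(1)] by auto
  qed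
  then obtain y where y: "Re y < ln \<eta>" "dist (\<psi> y) \<alpha> < \<delta> / 2"
    using eventually_happens[of _ "at_left (1::real)"] by auto
  have "dist (\<psi> x) \<alpha> < \<delta>" if "Re x < ln \<eta>" for x
    using close[OF that y(1)] y(2) dist_triangle[of "\<psi> x" \<alpha> "\<psi> y"] by linarith
  then show "\<forall>\<^sub>F x in filtercomap Re at_bot. dist (\<psi> x) \<alpha> < \<delta>"
    unfolding eventually_filtercomap using eventually_gt_at_bot[of "ln \<eta>"] by blast
qed

text \<open>Orbits contained in arbitrarily small neighbourhoods of \<^term>\<open>\<alpha>\<close> exist, and all orbits have the same ends.\<close>

lemma puncture_orbit_limits:
  assumes \<psi>: "puncture_lift \<epsilon> \<psi>" "(\<psi> \<longlongrightarrow> \<alpha>) (filtercomap Re at_bot)"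
    and T: "half_plane_affine T \<beta> a b" "a \<noteq> 1 \<or> b \<noteq> 0" "\<And>x. Re x < ln \<epsilon> \<Longrightarrow> T (\<psi> x) = \<psi> (x + \<kappa>)" "Re \<kappa> = 0"
    and s: "orbit_curve T s" "range s \<subseteq> ball 0 1"
  shows "(s \<longlongrightarrow> \<alpha>) at_bot" "(s \<longlongrightarrow> \<alpha>) at_top"
proof -
  obtain \<beta>0 \<beta>1 where ends:
    "\<And>s. orbit_curve T s \<Longrightarrow> range s \<subseteq> ball 0 1 \<Longrightarrow> (s \<longlongrightarrow> \<beta>0) at_bot \<and> (s \<longlongrightarrow> \<beta>1) at_top"
    using half_plane_affine_orbit_ends[OF T(1,2)] by metis
  have "dist \<beta>0 \<alpha> \<le> \<delta> \<and> dist \<beta>1 \<alpha> \<le> \<delta>" if \<delta>: "\<delta> > 0" for \<delta>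
  proof -
    obtain M where M: "\<And>x. Re x < M \<Longrightarrow> dist (\<psi> x) \<alpha> < \<delta>"
      using tendstoD[OF \<psi>(2) \<delta>] unfolding eventually_filtercomap eventually_at_bot_dense by blast
    define m where "m = min M (ln \<epsilon>) - 1"
    define \<sigma> where "\<sigma> t = \<psi> (of_real m + of_real t * \<kappa>)" for t :: real
    have Re: "Re (of_real m + of_real t * \<kappa>) < M" "Re (of_real m + of_real t * \<kappa>) < ln \<epsilon>" for t :: real
      using T(4) by (simp_all add: m_def)
    have "continuous_on UNIV \<sigma>"
      unfolding \<sigma>_def
      by (rule continuous_on_compose2[of "{x. Re x < ln \<epsilon>}" \<psi>])
        (use \<psi>(1) Re(2) in \<open>auto simp: puncture_lift_def intro!: continuous_intros\<close>)
    moreover have "\<sigma> (t + 1) = T (\<sigma> t)" for t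
      unfolding \<sigma>_def T(3)[OF Re(2)] by (simp add: algebra_simps)
    ultimately have "orbit_curve T \<sigma>" by (simp add: orbit_curve_def)
    moreover have "range \<sigma> \<subseteq> ball 0 1" using \<psi>(1) Re(2) by (auto simp: \<sigma>_def puncture_lift_def image_subset_iff)
    ultimately have lim: "(\<sigma> \<longlongrightarrow> \<beta>0) at_bot" "(\<sigma> \<longlongrightarrow> \<beta>1) at_top" using ends by blast+
    have "\<sigma> t \<in> cball \<alpha> \<delta>" for t using M[OF Re(1)] by (simp add: \<sigma>_def dist_commute less_imp_le)
    then have "\<beta>0 \<in> cball \<alpha> \<delta>" "\<beta>1 \<in> cball \<alpha> \<delta>"
      by (auto intro!: Lim_in_closed_set[OF closed_cball _ _ lim(1)]
          Lim_in_closed_set[OF closed_cball _ _ lim(2)]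
          simp del: mem_cball)
    then show ?thesis by (simp add: dist_commute)
  qed
  then have "dist \<beta>0 \<alpha> \<le> 0" "dist \<beta>1 \<alpha> \<le> 0" by (simp_all only: field_le_epsilon add_0)
  then show "(s \<longlongrightarrow> \<alpha>) at_bot" "(s \<longlongrightarrow> \<alpha>) at_top" using ends[OF s] by auto
qed

end

context disc_covering_curve
begin

lemma deck_puncture_lift_translation:
  assumes \<psi>: "puncture_lift \<epsilon> \<psi>" "\<epsilon> > 0" and e: "range e \<subseteq> \<Omega>" "range e \<subseteq> ball p \<epsilon>"
    and s: "orbit_curve T s" "curve_lift 0 s" and T: "deck T"
    and meet: "range s \<inter> \<psi> ` {x. Re x < ln \<epsilon>} \<noteq> {}"
  obtains \<kappa> where "Re \<kappa> = 0" "\<And>x. Re x < ln \<epsilon> \<Longrightarrow> T (\<psi> x) = \<psi> (x + \<kappa>)"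
proof -
  have s': "continuous_on UNIV s" "range s \<subseteq> ball 0 1" "\<And>t. \<phi> (s t) = e t"
    using s(2) by (auto simp: interior_param_interval[OF e(1)] curve_lift_def)
  obtain t0 x0 where x0: "s t0 = \<psi> x0" "Re x0 < ln \<epsilon>" using meet by auto
  then have e_x0: "e t0 = p + exp x0" using \<psi>(1) s'(3)[of t0] by (simp add: puncture_lift_def)
  have "continuous_on UNIV (\<lambda>t. e t - p)" by (intro continuous_intros e_cont)
  then obtain l' where l': "continuous_on UNIV l'" "\<And>t. e t - p = exp (l' t)"
    using continuous_logarithm_on_contractible[of UNIV "\<lambda>t. e t - p"] e_ne_p by (auto simp: contractible_UNIV)
  define l where "l t = l' t + (x0 - l' t0)" for t
  have l: "continuous_on UNIV l" "l t0 = x0" unfolding l_def by (auto intro!: continuous_intros l'(1))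
  have l_exp: "e t = p + exp (l t)" for t
  proof -
    have "exp x0 = exp (l' t0)" using e_x0 l'(2)[of t0] by simp
    then have "exp (x0 - l' t0) = 1" by (simp add: exp_diff)
    then have "exp (l t) = exp (l' t)" unfolding l_def exp_add by simp
    then show ?thesis using l'(2)[of t] by (simp add: algebra_simps)
  qed
  have "norm (exp (l t)) < \<epsilon>" for t using subsetD[OF e(2) rangeI[of e t]] by (simp add: l_exp dist_norm)
  then have l_less: "Re (l t) < ln \<epsilon>" for t using norm_exp_less_iff[OF \<psi>(2)] by blast
  have "s t = \<psi> (l t)" for t
  proof (rule lift_unique[where U = UNIV and a = t0 and ?g1.0 = s and ?g2.0 = "\<lambda>t. \<psi> (l t)"])
    show "continuous_on UNIV (\<lambda>t. \<psi> (l t))"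
      by (rule continuous_on_compose2[of "{x. Re x < ln \<epsilon>}" \<psi>])
        (use \<psi>(1) l(1) l_less in \<open>auto simp: puncture_lift_def\<close>)
  qed (use s' x0 l l_exp l_less \<psi>(1) in \<open>auto simp: puncture_lift_def image_subset_iff\<close>)
  then have "T (\<psi> (l 0)) = \<psi> (l 1)" using s(1) unfolding orbit_curve_def by (metis add_0)
  define \<kappa> where "\<kappa> = l 1 - l 0"
  have "e 1 = e 0" using e_shift[of 0 1] by simp
  then have "exp \<kappa> = 1" using l_exp[of 0] l_exp[of 1] by (simp add: \<kappa>_def exp_diff)
  moreover have "T (\<psi> x) = \<psi> (x + \<kappa>)" if "Re x < ln \<epsilon>" for x
    by (rule puncture_lift_unique[OF puncture_lift_deck[OF \<psi>(1) T]
        puncture_lift_translate[OF \<psi>(1) \<open>exp \<kappa> = 1\<close>] l_less[of 0] _ that])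
      (simp add: \<kappa>_def \<open>T (\<psi> (l 0)) = \<psi> (l 1)\<close>)
  ultimately show thesis using that[of \<kappa>] by (simp add: exp_eq_1)
qed

lemma interior_component_loop:
  assumes puncture: "\<epsilon> > 0" "ball p \<epsilon> - {p} \<subseteq> \<Omega>" and e: "range e \<subseteq> ball p \<epsilon>"
    and r0: "0 \<le> r0" "\<And>r::real. r0 < r \<Longrightarrow> r < 1 \<Longrightarrow> \<phi> (of_real r * \<alpha>) \<in> ball p \<epsilon>"
    and C: "C \<in> components preimage" and r1: "r0 < r1" "r1 < 1" "of_real r1 * \<alpha> \<in> C"
  shows "path_connected C \<and> (\<exists>\<gamma>. simple_path \<gamma> \<and> pathfinish \<gamma> = pathstart \<gamma> \<and> path_image \<gamma> = closure C) \<and>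
    closure C \<inter> sphere 0 1 = {\<alpha>}"
proof -
  have interior: "range e \<subseteq> \<Omega>" using e puncture(2) e_ne_p by blast
  have "r0 < 1" using r1 by simp
  obtain \<psi> where \<psi>: "puncture_lift \<epsilon> \<psi>"
    and radius: "(\<lambda>r::real. of_real r * \<alpha>) ` {r0<..<1} \<subseteq> \<psi> ` {x. Re x < ln \<epsilon>}"
    by (rule puncture_lift_along_radius[OF puncture r0(1) \<open>r0 < 1\<close> r0(2)])
  have "\<forall>\<^sub>F r in at_left (1::real). of_real r * \<alpha> \<in> \<psi> ` {x. Re x < ln \<epsilon>}"
    unfolding eventually_at_left_field using radius[unfolded image_subset_iff] \<open>r0 < 1\<close>
    by (intro exI[of _ r0]) simp
  then have \<psi>_lim: "(\<psi> \<longlongrightarrow> \<alpha>) (filtercomap Re at_bot)" by (rule puncture_lift_tendsto[OF \<psi> puncture(1)])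
  obtain s t w where w: "norm w < 1" and deck: "deck (Moebius_function t w)"
    and no_fixpoint: "\<And>z. z \<in> ball 0 1 \<Longrightarrow> Moebius_function t w z \<noteq> z"
    and s: "orbit_curve (Moebius_function t w) s" "curve_lift 0 s" "C = range s"
    by (rule interior_component_orbit[OF interior C]) blast
  have inj_s: "inj s" and C_ball: "range s \<subseteq> ball 0 1" and cont_s: "continuous_on UNIV s"
    using curve_lift_injective[OF s(2)] s(2) by (auto simp: interior_param_interval[OF interior] curve_lift_def)
  obtain \<beta> a b where affine: "half_plane_affine (Moebius_function t w) \<beta> a b" "a \<noteq> 1 \<or> b \<noteq> 0"
    using fixpoint_free_Moebius_function_half_plane_affine[OF w no_fixpoint] by blast
  have "range s \<inter> \<psi> ` {x. Re x < ln \<epsilon>} \<noteq> {}" using subsetD[OF radius imageI[of r1]] r1 s(3) by auto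
  then obtain \<kappa> where \<kappa>: "Re \<kappa> = 0" "\<And>x. Re x < ln \<epsilon> \<Longrightarrow> Moebius_function t w (\<psi> x) = \<psi> (x + \<kappa>)"
    by (rule deck_puncture_lift_translation[OF \<psi> puncture(1) interior e s(1,2) deck]) blast
  have lim: "(s \<longlongrightarrow> \<alpha>) at_bot" "(s \<longlongrightarrow> \<alpha>) at_top"
    using puncture_orbit_limits[OF \<psi> \<psi>_lim affine \<kappa>(2,1) s(1) C_ball] by blast+
  have "\<alpha> \<notin> range s" using C_ball norm_\<alpha> by auto
  then obtain \<gamma> where \<gamma>: "path_image \<gamma> = closure C" "path_image \<gamma> = insert \<alpha> (insert \<alpha> C)"
    "simple_path \<gamma>" "pathstart \<gamma> = \<alpha>" "pathfinish \<gamma> = \<alpha>"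
    using line_completion[OF cont_s inj_s lim] unfolding s(3) by metis
  have "closure C = insert \<alpha> C" using \<gamma>(1,2) by simp
  then have "closure C \<inter> sphere 0 1 = {\<alpha>}" using C_ball norm_\<alpha> s(3) by auto
  moreover have "path_connected C"
    unfolding s(3) by (intro path_connected_continuous_image cont_s convex_imp_path_connected) simp
  moreover have "pathfinish \<gamma> = pathstart \<gamma>" using \<gamma>(4,5) by simp
  ultimately show ?thesis using \<gamma>(1,3) by blast
qed

end

section \<open>The separating component\<close>

context disc_covering_radius
begin

lemma radial_limit_tail:
  assumes "open U" "p \<in> U"
  obtains r0 :: real where "0 \<le> r0" "r0 < 1" "\<And>r. r0 < r \<Longrightarrow> r < 1 \<Longrightarrow> \<phi> (of_real r * \<alpha>) \<in> U"
proof -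
  obtain r0 where r0: "r0 < 1" "\<And>r. r0 < r \<Longrightarrow> r < 1 \<Longrightarrow> \<phi> (of_real r * \<alpha>) \<in> U"
    using topological_tendstoD[OF radial_limit assms] unfolding eventually_at_left_field by blast
  show thesis by (rule that[of "max 0 r0"]) (use r0 in auto)
qed

lemma connected_radius: "connected ((\<lambda>r::real. of_real r * \<alpha>) ` I)" if "connected I"
  by (intro connected_continuous_image continuous_intros that)

lemma isolated_radial_limit_puncture:
  assumes "\<not> p islimpt frontier \<Omega>"
  obtains \<epsilon> where "\<epsilon> > 0" "ball p \<epsilon> - {p} \<subseteq> \<Omega>"
proof -
  obtain \<epsilon> where \<epsilon>: "\<epsilon> > 0" "\<And>y. y \<in> frontier \<Omega> \<Longrightarrow> y \<in> ball p \<epsilon> \<Longrightarrow> y = p"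
    using assms unfolding islimpt_approachable by (auto simp: dist_commute)
  obtain r0 where r0: "0 \<le> r0" "r0 < 1" "\<And>r. r0 < r \<Longrightarrow> r < 1 \<Longrightarrow> \<phi> (of_real r * \<alpha>) \<in> ball p \<epsilon>"
    by (rule radial_limit_tail[of "ball p \<epsilon>"]) (use \<epsilon>(1) in auto)
  obtain r where r: "r0 < r" "r < 1" using dense[OF r0(2)] by blast
  then have "\<phi> (of_real r * \<alpha>) \<in> \<Omega>" using radius_in_ball[of r] r0(1) in_domain by simp
  then have "(ball p \<epsilon> - {p}) \<inter> \<Omega> \<noteq> {}" using r0(3)[OF r] radial_limit_notin_domain by blast
  moreover have "(ball p \<epsilon> - {p}) \<inter> frontier \<Omega> = {}" using \<epsilon>(2) by blast
  moreover have "connected (ball p \<epsilon> - {p})" by (rule connected_punctured_ball) simp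
  ultimately have "ball p \<epsilon> - {p} \<subseteq> \<Omega>" using connected_Int_frontier[of "ball p \<epsilon> - {p}" \<Omega>] by blast
  then show thesis by (rule that[OF \<epsilon>(1)])
qed

definition separating_arc :: "real \<Rightarrow> complex set \<Rightarrow> bool" where
  "separating_arc \<delta> C \<longleftrightarrow> (\<exists>\<gamma>. arc \<gamma> \<and> path_image \<gamma> = closure C) \<and> 0 \<notin> closure C \<and> \<alpha> \<notin> closure C \<and>
     \<not> connected_component (cball 0 1 - closure C) 0 \<alpha> \<and> diameter C < \<delta>"

definition tangent_loop :: "real \<Rightarrow> complex set \<Rightarrow> bool" where
  "tangent_loop \<delta> C \<longleftrightarrow> (\<exists>\<gamma>. simple_path \<gamma> \<and> pathfinish \<gamma> = pathstart \<gamma> \<and> path_image \<gamma> = closure C) \<and>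
     closure C \<inter> sphere 0 1 = {\<alpha>} \<and> diameter C < \<delta>"

definition fine_scale :: "real \<Rightarrow> real \<Rightarrow> real \<Rightarrow> bool" where
  "fine_scale \<delta> \<rho> \<epsilon> \<longleftrightarrow> \<epsilon> > 0 \<and> (\<forall>z\<in>ball 0 1. \<phi> z \<in> ball p \<epsilon> \<longrightarrow> \<rho> < norm z) \<and>
     (\<forall>C. path_connected C \<and> C \<subseteq> ball 0 1 \<and> \<phi> ` C \<subseteq> ball p \<epsilon> \<longrightarrow> diameter C < \<delta>)"

lemma fine_scale_exists:
  assumes "\<delta> > 0" "\<rho> < 1" "\<epsilon>0 > 0"
  obtains \<epsilon> where "fine_scale \<delta> \<rho> \<epsilon>" "\<epsilon> \<le> \<epsilon>0"
proof -
  obtain \<epsilon>1 where \<epsilon>1: "\<epsilon>1 > 0"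
    "\<And>C. path_connected C \<Longrightarrow> C \<subseteq> ball 0 1 \<Longrightarrow> \<phi> ` C \<subseteq> ball p \<epsilon>1 \<Longrightarrow> diameter C \<le> \<delta> / 2"
    using small_image_imp_small_diameter[OF radial_limit_notin_domain half_gt_zero[OF assms(1)]] by blast
  obtain d where d: "d > 0" "\<And>z. z \<in> ball 0 1 \<Longrightarrow> dist (\<phi> z) p < d \<Longrightarrow> \<rho> < norm z"
    using near_omitted_value_imp_norm_gt[OF radial_limit_notin_domain assms(2)] by blast
  define \<epsilon> where "\<epsilon> = min \<epsilon>0 (min \<epsilon>1 d)"
  have "diameter C < \<delta>" if "path_connected C" "C \<subseteq> ball 0 1" "\<phi> ` C \<subseteq> ball p \<epsilon>" for C
  proof -
    have "diameter C \<le> \<delta> / 2" using that by (intro \<epsilon>1(2)) (auto simp: \<epsilon>_def)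
    then show ?thesis using assms(1) by simp
  qed
  then have "fine_scale \<delta> \<rho> \<epsilon>"
    using \<epsilon>1(1) d assms(3) by (auto simp: fine_scale_def \<epsilon>_def dist_commute)
  then show thesis using that by (simp add: \<epsilon>_def)
qed

end

context disc_covering_curve
begin

lemma fine_scale_zero_outside:
  assumes "fine_scale \<delta> \<rho> \<epsilon>" "0 \<le> \<rho>" and e: "range e \<subseteq> ball p \<epsilon>"
  shows "\<phi> 0 \<notin> range e \<union> inside (range e)"
proof -
  have "\<phi> 0 \<notin> ball p \<epsilon>" using assms(1,2) by (force simp: fine_scale_def)
  moreover have "inside (range e) \<subseteq> ball p \<epsilon>"
    using simple_loop_inside_subset_ball[OF simple_path_e(1), unfolded path_image_e]
      order_trans[OF e ball_subset_cball] .
  ultimately show ?thesis using e by blast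
qed

lemma closedin_preimage: "closedin (top_of_set (ball 0 1)) preimage"
proof -
  have "closed (range e)"
    using closed_path_image[OF simple_path_imp_path[OF simple_path_e(1)]] by (simp add: path_image_e)
  then show ?thesis unfolding preimage_def by (rule continuous_closedin_preimage[OF cont])
qed

lemma separating_component_exists:
  assumes zero_outside: "\<phi> 0 \<notin> range e \<union> inside (range e)"
  obtains C where "C \<in> components preimage"
    "\<forall>\<^sub>F r in at_left (1::real). \<not> connected_component (ball 0 1 - C) 0 (of_real r * \<alpha>)"
proof -
  have inside: "open (inside (range e))" "frontier (inside (range e)) = range e" using Jordan_e by auto
  obtain r0 where r0: "0 \<le> r0" "r0 < 1" "\<And>r. r0 < r \<Longrightarrow> r < 1 \<Longrightarrow> \<phi> (of_real r * \<alpha>) \<in> inside (range e)"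
    using radial_limit_tail[OF inside(1) p_inside] by metis
  define tail where "tail = (\<lambda>r::real. of_real r * \<alpha>) ` {r0<..<1}"
  have tail: "connected tail" "tail \<subseteq> ball 0 1" "\<phi> ` tail \<subseteq> inside (range e)"
    using connected_radius[of "{r0<..<1}"] radius_in_ball r0(1,3) by (auto simp: tail_def simp del: mem_ball)
  then have tail_preimage: "tail \<subseteq> ball 0 1 - preimage"
    using inside_no_overlap[of "range e"] unfolding preimage_def by blast
  obtain r2 where r2: "r0 < r2" "r2 < 1" using dense[OF r0(2)] by blast
  then have r2_tail: "of_real r2 * \<alpha> \<in> tail" unfolding tail_def by (intro imageI) simp
  have "\<not> connected_component (ball 0 1 - preimage) 0 (of_real r2 * \<alpha>)"
  proof
    assume "connected_component (ball 0 1 - preimage) 0 (of_real r2 * \<alpha>)"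
    moreover have "\<phi> ` (ball 0 1 - preimage) \<subseteq> - range e" by (auto simp: preimage_def)
    ultimately have "connected_component (- range e) (\<phi> 0) (\<phi> (of_real r2 * \<alpha>))"
      by (rule connected_component_image[OF _ continuous_on_subset[OF cont Diff_subset]])
    then obtain T where T: "connected T" "T \<subseteq> - range e" "\<phi> 0 \<in> T" "\<phi> (of_real r2 * \<alpha>) \<in> T"
      unfolding connected_component_def by blast
    then show False
      using connected_Int_frontier[of T "inside (range e)"] inside(2) r2_tail tail(3) zero_outside by blast
  qed
  moreover obtain h k where "homeomorphism (ball (0::complex) 1) (UNIV::complex set) h k"
    using homeomorphic_ball01_UNIV[where 'a = complex] unfolding homeomorphic_def by blast
  moreover have "0 \<in> ball (0::complex) 1" "of_real r2 * \<alpha> \<in> ball 0 1" using r2_tail tail(2) by auto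
  ultimately obtain C where C: "C \<in> components preimage"
    "\<not> connected_component (ball 0 1 - C) 0 (of_real r2 * \<alpha>)"
    using separation_by_component_homeomorphic_UNIV[OF _ closedin_preimage] by blast
  have "tail \<subseteq> ball 0 1 - C" using tail_preimage in_components_subset[OF C(1)] by blast
  then have "connected_component (ball 0 1 - C) (of_real r * \<alpha>) (of_real r2 * \<alpha>)" if "r0 < r" "r < 1" for r
    using tail(1) r2_tail that unfolding connected_component_def by (intro exI[of _ tail]) (auto simp: tail_def)
  then have "\<not> connected_component (ball 0 1 - C) 0 (of_real r * \<alpha>)" if "r0 < r" "r < 1" for r
    using that C(2) connected_component_trans by blast
  then show thesis
    using that[OF C(1)] r0(2) unfolding eventually_at_left_field by blast
qed

lemma separating_set_meets_radius:
  assumes "\<forall>\<^sub>F r in at_left (1::real). \<not> connected_component (ball 0 1 - C) 0 (of_real r * \<alpha>)"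
  obtains r1 :: real where "0 \<le> r1" "r1 < 1" "of_real r1 * \<alpha> \<in> C"
proof -
  have "\<forall>\<^sub>F r in at_left (1::real). 0 < r \<and> r < 1" by (rule eventually_at_leftI[of 0]) auto
  with assms have "\<forall>\<^sub>F r in at_left (1::real). 0 < r \<and> r < 1 \<and>
      \<not> connected_component (ball 0 1 - C) 0 (of_real r * \<alpha>)"
    by eventually_elim blast
  then obtain r where r: "0 < r" "r < 1" "\<not> connected_component (ball 0 1 - C) 0 (of_real r * \<alpha>)"
    using eventually_happens[of _ "at_left (1::real)"] by auto
  define segment where "segment = (\<lambda>r::real. of_real r * \<alpha>) ` {0..r}"
  have "connected segment" unfolding segment_def by (rule connected_radius) simp
  moreover have "0 \<in> segment" "of_real r * \<alpha> \<in> segment" using r(1) by (force simp: segment_def)+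
  ultimately have "\<not> segment \<subseteq> ball 0 1 - C" using r(3) unfolding connected_component_def by blast
  moreover have "segment \<subseteq> ball 0 1" using radius_in_ball r(2) by (auto simp: segment_def)
  ultimately show thesis using that r(2) by (force simp: segment_def)
qed

lemma component_in_fine_scale:
  assumes scale: "fine_scale \<delta> \<rho> \<epsilon>" and e: "range e \<subseteq> ball p \<epsilon>" and C: "C \<in> components preimage"
  shows "path_connected C \<Longrightarrow> diameter C < \<delta>" and "\<And>z. z \<in> C \<Longrightarrow> \<rho> < norm z"
proof -
  have sub: "C \<subseteq> ball 0 1" "\<phi> ` C \<subseteq> ball p \<epsilon>"
    using in_components_subset[OF C] e by (auto simp: preimage_def)
  then show "path_connected C \<Longrightarrow> diameter C < \<delta>"
    using scale by (simp add: fine_scale_def)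
  show "\<rho> < norm z" if "z \<in> C" for z
    using scale sub that unfolding fine_scale_def by blast
qed

lemma separating_arc_component:
  assumes p: "p islimpt frontier \<Omega>" and scale: "fine_scale \<delta> \<rho> \<epsilon>" "0 < \<rho>" and e: "range e \<subseteq> ball p \<epsilon>"
  shows "\<exists>C\<in>components preimage. separating_arc \<delta> C"
proof -
  obtain C where C: "C \<in> components preimage"
    and sep: "\<forall>\<^sub>F r in at_left (1::real). \<not> connected_component (ball 0 1 - C) 0 (of_real r * \<alpha>)"
    using separating_component_exists[OF fine_scale_zero_outside[OF scale(1) less_imp_le[OF scale(2)] e]] .
  note C_scale = component_in_fine_scale[OF scale(1) e C]
  have arc: "path_connected C \<and> (\<exists>\<gamma>. arc \<gamma> \<and> path_image \<gamma> = closure C) \<and> \<alpha> \<notin> closure C"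
    using crossing_component_arc interior_component_arc p C by blast
  have "closure C \<subseteq> - ball 0 \<rho>"
    using C_scale(2) by (intro closure_minimal) (force, simp add: closed_Compl)
  then have "0 \<notin> closure C" using scale(2) by auto
  moreover have "\<not> connected_component (cball 0 1 - closure C) 0 \<alpha>"
    using sep by (intro closure_separates_radius_end) (simp add: scaleR_conv_of_real)
  ultimately show ?thesis using arc C C_scale(1) unfolding separating_arc_def by blast
qed

lemma tangent_loop_component:
  assumes puncture: "\<epsilon>0 > 0" "ball p \<epsilon>0 - {p} \<subseteq> \<Omega>"
    and r0: "0 \<le> r0" "\<And>r::real. r0 < r \<Longrightarrow> r < 1 \<Longrightarrow> \<phi> (of_real r * \<alpha>) \<in> ball p \<epsilon>0"
    and scale: "fine_scale \<delta> r0 \<epsilon>" "\<epsilon> \<le> \<epsilon>0" and e: "range e \<subseteq> ball p \<epsilon>"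
  shows "\<exists>C\<in>components preimage. tangent_loop \<delta> C"
proof -
  obtain C where C: "C \<in> components preimage"
    and sep: "\<forall>\<^sub>F r in at_left (1::real). \<not> connected_component (ball 0 1 - C) 0 (of_real r * \<alpha>)"
    using separating_component_exists[OF fine_scale_zero_outside[OF scale(1) r0(1) e]] .
  obtain r1 where r1: "0 \<le> r1" "r1 < 1" "of_real r1 * \<alpha> \<in> C" by (rule separating_set_meets_radius[OF sep])
  note C_scale = component_in_fine_scale[OF scale(1) e C]
  have "r0 < r1" using C_scale(2)[OF r1(3)] r1(1) norm_\<alpha> by (simp add: norm_mult)
  moreover have "range e \<subseteq> ball p \<epsilon>0" using e subset_ball[OF scale(2)] by blast
  ultimately show ?thesis
    using interior_component_loop[OF puncture _ r0 C _ r1(2,3)] C C_scale(1)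
    unfolding tangent_loop_def by blast
qed

end

context disc_covering_radius
begin

lemma simple_loop_disc_covering_curve:
  assumes "simple_path g" "pathfinish g = pathstart g" "p \<in> inside (path_image g)"
  obtains e where "disc_covering_curve \<Omega> \<phi> \<alpha> p e" "range e = path_image g"
  using simple_loop_periodic_parametrization[OF assms(1,2)] assms(3) disc_covering_radius_axioms
  by (metis disc_covering_curve.intro disc_covering_curve_axioms.intro)

lemma separating_arc_components:
  assumes p: "p islimpt frontier \<Omega>" and "\<delta> > 0"
  shows "\<exists>\<epsilon>>0. \<forall>g. simple_path g \<and> pathfinish g = pathstart g \<and>
    path_image g \<subseteq> ball p \<epsilon> \<and> p \<in> inside (path_image g) \<longrightarrow>
    (\<exists>C\<in>components (ball 0 1 \<inter> \<phi> -` path_image g). separating_arc \<delta> C)"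
proof -
  obtain \<epsilon> where \<epsilon>: "fine_scale \<delta> (1 / 2) \<epsilon>"
    using fine_scale_exists[OF \<open>\<delta> > 0\<close>, of "1 / 2" 1] by auto
  have "\<exists>C\<in>components (ball 0 1 \<inter> \<phi> -` path_image g). separating_arc \<delta> C"
    if g: "simple_path g" "pathfinish g = pathstart g" "p \<in> inside (path_image g)" "path_image g \<subseteq> ball p \<epsilon>" for g
  proof -
    obtain e where "disc_covering_curve \<Omega> \<phi> \<alpha> p e" and range_e: "range e = path_image g"
      by (rule simple_loop_disc_covering_curve[OF g(1-3)])
    then interpret curve: disc_covering_curve \<Omega> \<phi> \<alpha> p e by simp
    show ?thesis
      using curve.separating_arc_component[OF p \<epsilon>] g(4) by (simp add: curve.preimage_def range_e)
  qed
  then show ?thesis using \<epsilon> unfolding fine_scale_def by blast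
qed

lemma tangent_loop_components:
  assumes p: "\<not> p islimpt frontier \<Omega>" and "\<delta> > 0"
  shows "\<exists>\<epsilon>>0. \<forall>g. simple_path g \<and> pathfinish g = pathstart g \<and>
    path_image g \<subseteq> ball p \<epsilon> \<and> p \<in> inside (path_image g) \<longrightarrow>
    (\<exists>C\<in>components (ball 0 1 \<inter> \<phi> -` path_image g). tangent_loop \<delta> C)"
proof -
  obtain \<epsilon>0 where puncture: "\<epsilon>0 > 0" "ball p \<epsilon>0 - {p} \<subseteq> \<Omega>"
    by (rule isolated_radial_limit_puncture[OF p])
  then obtain r0 where r0: "0 \<le> r0" "r0 < 1" "\<And>r. r0 < r \<Longrightarrow> r < 1 \<Longrightarrow> \<phi> (of_real r * \<alpha>) \<in> ball p \<epsilon>0"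
    using radial_limit_tail[of "ball p \<epsilon>0"] by auto
  obtain \<epsilon> where \<epsilon>: "fine_scale \<delta> r0 \<epsilon>" "\<epsilon> \<le> \<epsilon>0"
    by (rule fine_scale_exists[OF \<open>\<delta> > 0\<close> r0(2) puncture(1)])
  have "\<exists>C\<in>components (ball 0 1 \<inter> \<phi> -` path_image g). tangent_loop \<delta> C"
    if g: "simple_path g" "pathfinish g = pathstart g" "p \<in> inside (path_image g)" "path_image g \<subseteq> ball p \<epsilon>" for g
  proof -
    obtain e where "disc_covering_curve \<Omega> \<phi> \<alpha> p e" and range_e: "range e = path_image g"
      by (rule simple_loop_disc_covering_curve[OF g(1-3)])
    then interpret curve: disc_covering_curve \<Omega> \<phi> \<alpha> p e by simp
    show ?thesis
      using curve.tangent_loop_component[OF puncture r0(1,3) \<epsilon>] g(4) by (simp add: curve.preimage_def range_e)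
  qed
  then show ?thesis using \<epsilon>(1) unfolding fine_scale_def by blast
qed

end

theorem theorem2p6:
  fixes \<Omega> :: "complex set" and \<phi> :: "complex \<Rightarrow> complex" and \<alpha> p :: complex
  assumes "bounded \<Omega>" and "connected \<Omega>" and "open \<Omega>"
    and "\<phi> holomorphic_on ball 0 1"
    and "covering_space (ball 0 1) \<phi> \<Omega>"
    and "norm \<alpha> = 1"
    and "((\<lambda>r::real. \<phi> (complex_of_real r * \<alpha>)) \<longlongrightarrow> p) (at_left 1)"
  shows
    "(p islimpt frontier \<Omega> \<longrightarrow>
       (\<forall>\<delta>>0. \<exists>\<epsilon>>0. \<forall>g::real \<Rightarrow> complex.
          simple_path g \<and> pathfinish g = pathstart g \<and>
          path_image g \<subseteq> ball p \<epsilon> \<and> p \<in> inside (path_image g) \<longrightarrow>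
          (\<exists>C \<in> components (ball 0 1 \<inter> \<phi> -` path_image g).
             (\<exists>\<gamma>. arc \<gamma> \<and> path_image \<gamma> = closure C) \<and>
             0 \<notin> closure C \<and> \<alpha> \<notin> closure C \<and>
             \<not> connected_component (cball 0 1 - closure C) 0 \<alpha> \<and>
             diameter C < \<delta>)))
     \<and>
     (\<not> p islimpt frontier \<Omega> \<longrightarrow>
       (\<forall>\<delta>>0. \<exists>\<epsilon>>0. \<forall>g::real \<Rightarrow> complex.
          simple_path g \<and> pathfinish g = pathstart g \<and> path_image g \<subseteq> \<Omega> \<and>
          path_image g \<subseteq> ball p \<epsilon> \<and> p \<in> inside (path_image g) \<longrightarrow>
          (\<exists>C \<in> components (ball 0 1 \<inter> \<phi> -` path_image g).
             (\<exists>\<gamma>. simple_path \<gamma> \<and> pathfinish \<gamma> = pathstart \<gamma> \<and>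
                   path_image \<gamma> = closure C) \<and>
             closure C \<inter> sphere 0 1 = {\<alpha>} \<and>
             diameter C < \<delta>)))"
proof -
  interpret disc_covering_radius \<Omega> \<phi> \<alpha> p by unfold_locales (use assms in auto)
  show ?thesis
  proof (intro conjI allI impI, goal_cases nonisolated isolated)
    case (nonisolated \<delta>)
    then show ?case by (rule separating_arc_components[unfolded separating_arc_def])
  next
    case (isolated \<delta>)
    then show ?case using tangent_loop_components unfolding tangent_loop_def by meson
  qed
qed

end
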